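(* Let $\Psi$ satisfy the standing assumption on $\Psi$ below, let $\{H_k\}_{k=1}^\infty=\{(h_{s,k},h_{f,k})\}$ be two-timescale admissible with $\sum_{k=1}^\infty h_{f,k}^{1+\varrho}<\infty$ for some $\varrho\in[1,\infty)$, let $\mathbf X=(\mathbf x_s,\mathbf x_f)$ be a solution of the stochastic simulator (S) below, and let $\hat\Omega\subset\Omega$ be such that for almost every $\omega\in\hat\Omega$ the hybrid sequence $\mathbf X(\omega)$ is bounded and complete. Then for almost every $\omega\in\hat\Omega$, the pair $(\mathbf x_s(\omega),\{h_{s,k}\}_{k=1}^\infty)$ is an asymptotic simulation of $\mathcal H_{\mathrm{HB}}$, and $\omega$-limit set of $\mathbf x_s(\omega)$ is contained in $\mathcal M:=\mathcal Q^*\times\{0\}\times[0,2T]$.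
   Context: Standing assumption on $\Psi$: $\Psi:\mathbb R^n\to\mathbb R$ is continuously differentiable, has compact sublevel sets and globally Lipschitz gradient, and, with $\Psi^*:=\min\Psi$, satisfies $\mathcal Q^*:=\{q:\Psi(q)=\Psi^*\}=\{q:\nabla\Psi(q)=0\}$; moreover $\Psi=\frac1N\sum_{i=1}^N\Psi_i$ with $N\in\mathbb Z_{\ge1}$ and each $\Psi_i:\mathbb R^n\to\mathbb R$ continuously differentiable. Hybrid heavy ball. Fix $\kappa,T>0$. State $\chi=(q,p,\tau)\in\mathbb R^{2n+1}$, $\xi\in\mathbb R^n$. $F_{\mathrm{HB}}(\chi,\xi):=(p,\,-\kappa p-\xi,\,\min\{1,2-\tau/T\})$; $G_{\mathrm{HB}}(\chi):=(q,0,0)$. $\mathcal H_{\mathrm{HB}}$ is the hybrid inclusion on $\mathbb R^{2n+1}$: $\chi\in C_{\mathrm{HB}}$, $\dot\chi=F_{\mathrm{HB}}(\chi,\nabla\Psi(q))$; $\chi\in D_{\mathrm{HB}}$, $\chi^+=G_{\mathrm{HB}}(\chi)$, where $C_{\mathrm{HB}}:=\{\chi:\langle\nabla\Psi(q),p\rangle\le0,\tau\ge T\}\cup\{\chi:\tau\le T\}$ and $D_{\mathrm{HB}}:=\{\chi:\langle\nabla\Psi(q),p\rangle\ge0,\tau\ge T\}$. Also $C:=\{(\chi,\xi):\langle\xi,p\rangle\le0,\tau\ge T\}\cup\{(\chi,\xi):\tau\le T\}$, $D:=\{(\chi,\xi):\langle\xi,p\rangle\ge0,\tau\ge T\}$.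 Stochastic simulator (S). Let $(\Omega,\mathcal F,\mathbb P)$ be a probability space and $\{\mathbf y_k\}_{k\ge1}$ i.i.d. random variables uniform on $\{1,\dots,N\}$; $\{\mathcal F_k\}$ is the minimal filtration generated by them, $\mathcal F_0=\{\emptyset,\Omega\}$. A collection $\omega\mapsto\mathbf X(\omega)=(\mathbf x_s(\omega),\mathbf x_f(\omega))$, with $\mathbf x_s=(\mathbf q,\mathbf p,\boldsymbol\tau)$, is a solution of (S) if for every $\omega$, $\mathbf X(\omega)$ is a complete hybrid sequence in $\mathbb R^{3n+1}$ such that: whenever $(k,j),(k+1,j)\in\mathrm{dom}\,\mathbf X(\omega)$, $\mathbf X(k,j)\in C$, $\mathbf x_s(k+1,j)=\mathbf x_s(k,j)+h_{s,k+1}F_{\mathrm{HB}}(\mathbf x_s(k,j),\mathbf x_f(k,j))$ and $\mathbf x_f(k+1,j)=\mathbf x_f(k,j)+h_{f,k+1}(\nabla\Psi_{\mathbf y_{k+1}}(\mathbf q(k,j))-\mathbf x_f(k,j))$; whenever $(k,j),(k,j+1)\in\mathrm{dom}\,\mathbf X(\omega)$, $\mathbf X(k,j)\in D$, $\mathbf x_s(k,j+1)=G_{\mathrm{HB}}(\mathbf x_s(k,j))$, $\mathbf x_f(k,j+1)=\mathbf x_f(k,j)$; and $\mathbf X$ is adapted: for each $k$, $\omega\mapsto\mathrm{gph}(\mathbf X(\omega))\cap(\{k\}\times\mathbb R\times\mathbb R^{3n+1})$ is $\mathcal F_k$-measurable. Hybrid sequences and asymptotic simulations. A compact hybrid sequence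 domain is $\bigcup_{j=0}^{J-1}(\{k_j,\dots,k_{j+1}\}\times\{j\})$ with integers $0=k_0\le\dots\le k_J$; a hybrid sequence domain is a union of a nondecreasing sequence of such sets; a hybrid sequence is a map on one; complete = unbounded domain; complete in the $k$- (resp. $j$-) direction = set of $k$'s (resp. $j$'s) in the domain unbounded. $\bar\jmath_k:=\inf\{j:(k+1,j)\in\mathrm{dom}\}$, $\bar k_j:=\inf\{k:(k,j+1)\in\mathrm{dom}\}$. $\limsup$ of a sequence = its set of accumulation points. The $\omega$-limit set of a hybrid sequence $\phi$ is the set of all $\lim_i\phi(k_i,j_i)$ with $(k_i,j_i)\in\mathrm{dom}\,\phi$, $k_i+j_i\to\infty$. For $\mathcal H=(C',F,D',G)$, $F_{C'}(x):=F(x)$ if $x\in C'$ else $\emptyset$; $G_{D'}$ analogously. A sequence $\{h_k\}$ is admissible if $h_k>0$, $h_k\to0$, $\sum h_k=\infty$; $\tau_k:=\sum_{i=0}^{k-1}h_{i+1}$, $m(t):=\max\{k:\tau_k\le t\}$. $(\phi,\{h_k\})$ is an asymptotic simulation of $\mathcal H$ if $\phi$ is a bounded complete hybrid sequence, $\{h_k\}$ is admissible, and: (1) if $\phi$ is complete in the $k$-direction there is a bounded sequence $\{f_k\}$ with $\limsup_k(\phi(k,\bar\jmath_k),f_k)\subset\mathrm{gph}(F_{C'})$ and, with $\hat f_{k+1}:=(\phi(k+1,\bar\jmath_k)-\phi(k,\bar\jmath_k))/h_{k+1}$, for each $T'>0$, $\lim_{n\to\infty}\sup_{n+1\le k\le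 m(\tau_n+T')}|\sum_{i=n}^{k-1}h_{i+1}(\hat f_{i+1}-f_i)|=0$; (2) if $\phi$ is complete in the $j$-direction, $\limsup_j(\phi(\bar k_j,j),\phi(\bar k_j,j+1))\subset\mathrm{gph}(G_{D'})$. $\{(h_{s,k},h_{f,k})\}\subset\mathbb R^2_{>0}$ is two-timescale admissible if both component sequences are admissible and $h_{s,k}/h_{f,k}\to0$. *)

theory Defs
  imports "HOL-Analysis.Analysis" "HOL-Probability.Probability"
begin

text \<open>A hybrid sequence is represented by its domain E (a set of pairs (k,j)) together with
  a map phi :: nat => nat => 'b; only the values on E are relevant.\<close>

definition compact_hs_dom :: "(nat \<times> nat) set \<Rightarrow> bool" where
  "compact_hs_dom E \<longleftrightarrow>
     (\<exists>(J::nat) (kk::nat \<Rightarrow> nat). kk 0 = 0 \<and> (\<forall>j<J. kk j \<le> kk (Suc j)) \<and>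
        E = (\<Union>j<J. {kk j..kk (Suc j)} \<times> {j}))"

definition hs_dom :: "(nat \<times> nat) set \<Rightarrow> bool" where
  "hs_dom E \<longleftrightarrow> (\<exists>Es :: nat \<Rightarrow> (nat \<times> nat) set.
      (\<forall>i. compact_hs_dom (Es i)) \<and> incseq Es \<and> E = (\<Union>i. Es i))"

definition hs_complete :: "(nat \<times> nat) set \<Rightarrow> bool" where
  "hs_complete E \<longleftrightarrow> (\<forall>m. \<exists>(k, j)\<in>E. m < k + j)"

definition hs_complete_k :: "(nat \<times> nat) set \<Rightarrow> bool" where
  "hs_complete_k E \<longleftrightarrow> (\<forall>m. \<exists>(k, j)\<in>E. m < k)"

definition hs_complete_j :: "(nat \<times> nat) set \<Rightarrow> bool" where
  "hs_complete_j E \<longleftrightarrow> (\<forall>m. \<exists>(k, j)\<in>E. m < j)"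

definition hs_bounded :: "(nat \<times> nat) set \<Rightarrow> (nat \<Rightarrow> nat \<Rightarrow> 'b::metric_space) \<Rightarrow> bool" where
  "hs_bounded E phi \<longleftrightarrow> bounded ((\<lambda>(k, j). phi k j) ` E)"

definition jbar :: "(nat \<times> nat) set \<Rightarrow> nat \<Rightarrow> nat" where
  "jbar E k = (LEAST j. (Suc k, j) \<in> E)"

definition kbar :: "(nat \<times> nat) set \<Rightarrow> nat \<Rightarrow> nat" where
  "kbar E j = (LEAST k. (k, Suc j) \<in> E)"

definition acc_points :: "(nat \<Rightarrow> 'b::topological_space) \<Rightarrow> 'b set" where
  "acc_points s = {x. \<exists>r. strict_mono r \<and> (s \<circ> r) \<longlonglongrightarrow> x}"

definition omega_limit :: "(nat \<times> nat) set \<Rightarrow> (nat \<Rightarrow> nat \<Rightarrow> 'b::topological_space) \<Rightarrow> 'b set" where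
  "omega_limit E phi = {x. \<exists>s :: nat \<Rightarrow> nat \<times> nat. (\<forall>i. s i \<in> E) \<and>
      filterlim (\<lambda>i. fst (s i) + snd (s i)) at_top sequentially \<and>
      ((\<lambda>i. phi (fst (s i)) (snd (s i))) \<longlonglongrightarrow> x)}"

text \<open>Step sizes h_k are indexed by k >= 1; the value h 0 is irrelevant.\<close>
definition admissible :: "(nat \<Rightarrow> real) \<Rightarrow> bool" where
  "admissible h \<longleftrightarrow> (\<forall>k\<ge>1. 0 < h k) \<and> h \<longlonglongrightarrow> 0 \<and>
     filterlim (\<lambda>n. \<Sum>k<n. h (Suc k)) at_top sequentially"

definition two_timescale_admissible :: "(nat \<Rightarrow> real) \<Rightarrow> (nat \<Rightarrow> real) \<Rightarrow> bool" where
  "two_timescale_admissible hs hf \<longleftrightarrow> admissible hs \<and> admissible hf \<and>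
     (\<lambda>k. hs k / hf k) \<longlonglongrightarrow> 0"

definition tau_seq :: "(nat \<Rightarrow> real) \<Rightarrow> nat \<Rightarrow> real" where
  "tau_seq h k = (\<Sum>i<k. h (Suc i))"

definition m_fun :: "(nat \<Rightarrow> real) \<Rightarrow> real \<Rightarrow> nat" where
  "m_fun h t = (GREATEST k. tau_seq h k \<le> t)"

definition asymptotic_simulation ::
  "'b set \<Rightarrow> ('b \<Rightarrow> 'b) \<Rightarrow> 'b set \<Rightarrow> ('b \<Rightarrow> 'b) \<Rightarrow>
   (nat \<times> nat) set \<Rightarrow> (nat \<Rightarrow> nat \<Rightarrow> 'b::real_normed_vector) \<Rightarrow> (nat \<Rightarrow> real) \<Rightarrow> bool" where
  "asymptotic_simulation Cs Fm Ds Gm E phi h \<longleftrightarrow>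
     hs_dom E \<and> hs_complete E \<and> hs_bounded E phi \<and> admissible h \<and>
     (hs_complete_k E \<longrightarrow>
        (\<exists>f :: nat \<Rightarrow> 'b. bounded (range f) \<and>
           acc_points (\<lambda>k. (phi k (jbar E k), f k)) \<subseteq> {(x, Fm x) | x. x \<in> Cs} \<and>
           (let fhat = (\<lambda>k. (1 / h k) *\<^sub>R (phi k (jbar E (k - 1)) - phi (k - 1) (jbar E (k - 1))))
            in \<forall>T'>0. \<forall>\<epsilon>>0. \<exists>n0. \<forall>n\<ge>n0. \<forall>k. n + 1 \<le> k \<and> k \<le> m_fun h (tau_seq h n + T') \<longrightarrow>
                 norm (\<Sum>i\<in>{n..<k}. h (Suc i) *\<^sub>R (fhat (Suc i) - f i)) \<le> \<epsilon>))) \<and>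
     (hs_complete_j E \<longrightarrow>
        acc_points (\<lambda>j. (phi (kbar E j) j, phi (kbar E j) (Suc j))) \<subseteq> {(x, Gm x) | x. x \<in> Ds})"

text \<open>State chi = (q, p, tau) in R^n x R^n x R; gPsi is the gradient of Psi.\<close>

definition F_HB :: "real \<Rightarrow> real \<Rightarrow> ('a::real_inner \<times> 'a \<times> real) \<Rightarrow> 'a \<Rightarrow> 'a \<times> 'a \<times> real" where
  "F_HB \<kappa> T chi \<xi> = (case chi of (q, p, \<tau>) \<Rightarrow> (p, - (\<kappa> *\<^sub>R p) - \<xi>, min 1 (2 - \<tau> / T)))"

definition G_HB :: "('a::real_inner \<times> 'a \<times> real) \<Rightarrow> 'a \<times> 'a \<times> real" where
  "G_HB chi = (case chi of (q, p, \<tau>) \<Rightarrow> (q, 0, 0))"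

definition C_HB :: "('a::real_inner \<Rightarrow> 'a) \<Rightarrow> real \<Rightarrow> ('a \<times> 'a \<times> real) set" where
  "C_HB gPsi T = {(q, p, \<tau>). (inner (gPsi q) p \<le> 0 \<and> \<tau> \<ge> T) \<or> \<tau> \<le> T}"

definition D_HB :: "('a::real_inner \<Rightarrow> 'a) \<Rightarrow> real \<Rightarrow> ('a \<times> 'a \<times> real) set" where
  "D_HB gPsi T = {(q, p, \<tau>). inner (gPsi q) p \<ge> 0 \<and> \<tau> \<ge> T}"

definition Fflow_HB :: "real \<Rightarrow> real \<Rightarrow> ('a::real_inner \<Rightarrow> 'a) \<Rightarrow> ('a \<times> 'a \<times> real) \<Rightarrow> 'a \<times> 'a \<times> real" where
  "Fflow_HB \<kappa> T gPsi chi = F_HB \<kappa> T chi (gPsi (fst chi))"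

definition C_S :: "real \<Rightarrow> (('a::real_inner \<times> 'a \<times> real) \<times> 'a) set" where
  "C_S T = {((q, p, \<tau>), \<xi>). (inner \<xi> p \<le> 0 \<and> \<tau> \<ge> T) \<or> \<tau> \<le> T}"

definition D_S :: "real \<Rightarrow> (('a::real_inner \<times> 'a \<times> real) \<times> 'a) set" where
  "D_S T = {((q, p, \<tau>), \<xi>). inner \<xi> p \<ge> 0 \<and> \<tau> \<ge> T}"

definition filt :: "'w measure \<Rightarrow> (nat \<Rightarrow> 'w \<Rightarrow> nat) \<Rightarrow> nat \<Rightarrow> 'w measure" where
  "filt M y k = sigma (space M) {y i -` A \<inter> space M | i A. i \<in> {1..k}}"

definition graph_slice :: "(nat \<times> nat) set \<Rightarrow> (nat \<Rightarrow> nat \<Rightarrow> 'b) \<Rightarrow> nat \<Rightarrow> (nat \<times> nat \<times> 'b) set" where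
  "graph_slice E X k = {(k, j, X k j) | j. (k, j) \<in> E}"

definition solution_S ::
  "'w measure \<Rightarrow> (nat \<Rightarrow> 'w \<Rightarrow> nat) \<Rightarrow> (nat \<Rightarrow> 'a::euclidean_space \<Rightarrow> 'a) \<Rightarrow> real \<Rightarrow> real \<Rightarrow>
   (nat \<Rightarrow> real) \<Rightarrow> (nat \<Rightarrow> real) \<Rightarrow>
   ('w \<Rightarrow> (nat \<times> nat) set) \<Rightarrow> ('w \<Rightarrow> nat \<Rightarrow> nat \<Rightarrow> ('a \<times> 'a \<times> real) \<times> 'a) \<Rightarrow> bool" where
  "solution_S M y gPsi_i \<kappa> T hs hf hdom X \<longleftrightarrow>
     (\<forall>\<omega>\<in>space M.
        hs_dom (hdom \<omega>) \<and> hs_complete (hdom \<omega>) \<and>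
        (\<forall>k j. (k, j) \<in> hdom \<omega> \<and> (Suc k, j) \<in> hdom \<omega> \<longrightarrow>
           X \<omega> k j \<in> C_S T \<and>
           fst (X \<omega> (Suc k) j) = fst (X \<omega> k j) + hs (Suc k) *\<^sub>R F_HB \<kappa> T (fst (X \<omega> k j)) (snd (X \<omega> k j)) \<and>
           snd (X \<omega> (Suc k) j) = snd (X \<omega> k j) +
              hf (Suc k) *\<^sub>R (gPsi_i (y (Suc k) \<omega>) (fst (fst (X \<omega> k j))) - snd (X \<omega> k j))) \<and>
        (\<forall>k j. (k, j) \<in> hdom \<omega> \<and> (k, Suc j) \<in> hdom \<omega> \<longrightarrow>
           X \<omega> k j \<in> D_S T \<and>
           fst (X \<omega> k (Suc j)) = G_HB (fst (X \<omega> k j)) \<and>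
           snd (X \<omega> k (Suc j)) = snd (X \<omega> k j))) \<and>
     (\<forall>k. (\<lambda>\<omega>. graph_slice (hdom \<omega>) (X \<omega>) k) \<in> measurable (filt M y k) (count_space UNIV))"

end

theory Submission
  imports Defs
begin

text \<open>The fast variable tracks the gradient: after truncating the positions to a ball, the noise is a
  bounded martingale difference, and the linear filter it drives is shown to vanish almost surely by a
  maximal inequality for its \<open>2 * m\<close>-th moment with \<open>m \<ge> \<rho>\<close>; the rest of the tracking error contracts,
  since the slow step sizes are negligible against the fast ones. Along a path on which the tracking error
  vanishes, the asymptotic simulation property is immediate, and the limit set is located with the strict
  Lyapunov function \<open>\<Psi>(q) + |p|\<^sup>2 / 2 + \<delta> \<langle>\<nabla>\<Psi>(q), p\<rangle>\<close>, corrected by a small multiple of the timer at jumps.\<close>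

section \<open>Descent of the restarted heavy ball\<close>

text \<open>For \<open>rho > 1\<close> the fast step sizes need not be square summable, so second
  moments of the noise are not enough. In the recursion for a \<open>2 * m\<close>-th moment, the
  quadratic effect of the noise can outweigh the contraction only while the filter is of size about
  \<open>sqrt h\<close>; there it has order \<open>h ^ (m + 1)\<close>, which is summable. The bound
  of a path depends on the outcome, so no single radius works. The filter is run for every natural
  radius, and a bounded path later selects the radius that suits it. Jumps change neither the
  position nor the fast variable. The noise is therefore indexed by \<open>k\<close> alone, and the
  probabilistic part never sees the hybrid structure; what remains is deterministic. Strictness of
  the Lyapunov function replaces an invariance argument on the limit set: descent by itself drives
  it to zero.\<close>

lemma contraction_tendsto_zero:
  fixes v H \<epsilon> :: "nat \<Rightarrow> real"
  assumes nonneg: "\<And>n. 0 \<le> v n"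
    and step: "eventually (\<lambda>n. v (Suc n) \<le> (1 - H n) * v n + H n * \<epsilon> n) sequentially"
    and H_nonneg: "\<And>n. 0 \<le> H n"
    and H_lim: "H \<longlonglongrightarrow> 0"
    and H_sum: "filterlim (\<lambda>n. \<Sum>i<n. H i) at_top sequentially"
    and eps: "\<epsilon> \<longlonglongrightarrow> 0"
  shows "v \<longlonglongrightarrow> 0"
proof (rule order_tendstoI)
  fix a :: real assume "a < 0"
  then show "eventually (\<lambda>n. a < v n) sequentially"
    using nonneg by (intro always_eventually allI) (meson less_le_trans)
next
  fix a :: real assume a: "0 < a"
  define d where "d = a / 2"
  have d: "0 < d" using a by (simp add: d_def)
  have "eventually (\<lambda>n. \<epsilon> n < d) sequentially" using eps d by (rule order_tendstoD)
  moreover have "eventually (\<lambda>n. H n < 1) sequentially"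
    using H_lim by (rule order_tendstoD) simp
  ultimately have "eventually (\<lambda>n. \<epsilon> n < d \<and> H n < 1 \<and> v (Suc n) \<le> (1 - H n) * v n + H n * \<epsilon> n) sequentially"
    using step by eventually_elim auto
  then obtain n0 where n0: "\<And>n. n \<ge> n0 \<Longrightarrow> \<epsilon> n < d \<and> H n < 1 \<and> v (Suc n) \<le> (1 - H n) * v n + H n * \<epsilon> n"
    unfolding eventually_sequentially by blast
  \<comment> \<open>Only the excess over \<open>d\<close> contracts: once
    \<open>\<epsilon> n < d\<close>, subtracting \<open>d\<close> makes the forcing term
    non-positive. The bound \<open>1 - H n \<le> exp (- H n)\<close> then turns the product of the
    factors into an exponential of the divergent sum.\<close>
  define w where "w n = max (v n - d) 0" for n
  have w_step: "w (Suc n) \<le> exp (- H n) * w n" if "n \<ge> n0" for n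
  proof -
    have "v (Suc n) - d \<le> (1 - H n) * (v n - d) + H n * (\<epsilon> n - d)"
      using n0[OF that] by (simp add: algebra_simps)
    also have "\<dots> \<le> (1 - H n) * (v n - d)"
      using n0[OF that] H_nonneg[of n] by (simp add: mult_nonneg_nonpos)
    also have "\<dots> \<le> (1 - H n) * w n"
      using n0[OF that] by (intro mult_left_mono) (auto simp: w_def)
    finally have "w (Suc n) \<le> (1 - H n) * w n"
      using n0[OF that] unfolding w_def[of "Suc n"] by (auto simp: w_def)
    also have "\<dots> \<le> exp (- H n) * w n"
      using exp_ge_add_one_self[of "- H n"] by (intro mult_right_mono) (auto simp: w_def)
    finally show ?thesis .
  qed
  have w_bound: "w (n0 + i) \<le> exp (- (\<Sum>j<n0 + i. H j) + (\<Sum>j<n0. H j)) * w n0" for i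
  proof (induction i)
    case 0 then show ?case by simp
  next
    case (Suc i)
    have "w (Suc (n0 + i)) \<le> exp (- H (n0 + i)) * w (n0 + i)" by (rule w_step) simp
    also have "\<dots> \<le> exp (- H (n0 + i)) * (exp (- (\<Sum>j<n0 + i. H j) + (\<Sum>j<n0. H j)) * w n0)"
      using Suc by (intro mult_left_mono) auto
    also have "\<dots> = exp (- (\<Sum>j<n0 + Suc i. H j) + (\<Sum>j<n0. H j)) * w n0"
      by (simp add: mult_exp_exp[symmetric] exp_add[symmetric] algebra_simps)
    finally show ?case by simp
  qed
  have top: "filterlim (\<lambda>i. (- (\<Sum>j<n0. H j)) + (\<Sum>j<i + n0. H j)) at_top sequentially"
    by (intro filterlim_tendsto_add_at_top[OF tendsto_const]
        filterlim_compose[OF H_sum filterlim_add_const_nat_at_top])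
  have "((\<lambda>i. exp (- ((- (\<Sum>j<n0. H j)) + (\<Sum>j<i + n0. H j)))) \<longlongrightarrow> 0) sequentially"
    by (rule filterlim_compose[OF exp_at_bot]) (use top in \<open>simp add: filterlim_uminus_at_bot\<close>)
  then have "(\<lambda>i. exp (- (\<Sum>j<n0 + i. H j) + (\<Sum>j<n0. H j)) * w n0) \<longlonglongrightarrow> 0 * w n0"
    by (intro tendsto_mult tendsto_const) (simp add: add.commute)
  then have "eventually (\<lambda>i. exp (- (\<Sum>j<n0 + i. H j) + (\<Sum>j<n0. H j)) * w n0 < d) sequentially"
    using d by (intro order_tendstoD) auto
  then have "eventually (\<lambda>i. v (i + n0) < a) sequentially"
  proof eventually_elim
    case (elim i)
    then have "w (n0 + i) < d" using w_bound[of i] by linarith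
    then have "v (i + n0) - d < d" by (simp add: w_def add.commute)
    then show ?case by (simp add: d_def)
  qed
  then show "eventually (\<lambda>n. v n < a) sequentially"
    using eventually_sequentially_seg[of "\<lambda>n. v n < a" n0] by simp
qed

text \<open>\<open>U\<close> cannot stay above \<open>r\<close>, since the decrements
  \<open>c * H n\<close> sum to infinity while \<open>U\<close> is bounded below. After a visit
  below \<open>r\<close>, a step from below climbs by at most \<open>C * H n < \<eta>\<close>, and a
  step from above does not climb. A step with \<open>H n = 0\<close>, such as a jump, merely must
  not increase \<open>U\<close>.\<close>

lemma eventually_below_level:
  fixes U H :: "nat \<Rightarrow> real"
  assumes lower: "\<And>n. B \<le> U n"
    and c: "0 < c" and \<eta>: "0 < \<eta>"
    and down: "eventually (\<lambda>n. r \<le> U n \<longrightarrow> U (Suc n) \<le> U n - c * H n) sequentially"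
    and up: "eventually (\<lambda>n. U (Suc n) \<le> U n + C * H n) sequentially"
    and H_nonneg: "\<And>n. 0 \<le> H n"
    and H_lim: "H \<longlonglongrightarrow> 0"
    and H_sum: "filterlim (\<lambda>n. \<Sum>i<n. H i) at_top sequentially"
  shows "eventually (\<lambda>n. U n < r + \<eta>) sequentially"
proof -
  have "(\<lambda>n. C * H n) \<longlonglongrightarrow> C * 0" using H_lim by (intro tendsto_mult tendsto_const)
  then have "eventually (\<lambda>n. C * H n < \<eta>) sequentially"
    using \<eta> by (intro order_tendstoD) auto
  with down up have "eventually (\<lambda>n. C * H n < \<eta> \<and> (r \<le> U n \<longrightarrow> U (Suc n) \<le> U n - c * H n) \<and> U (Suc n) \<le> U n + C * H n) sequentially"
    by eventually_elim auto
  then obtain n0 where n0: "\<And>n. n \<ge> n0 \<Longrightarrow> C * H n < \<eta> \<and> (r \<le> U n \<longrightarrow> U (Suc n) \<le> U n - c * H n) \<and> U (Suc n) \<le> U n + C * H n"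
    unfolding eventually_sequentially by blast
  have "\<exists>n\<ge>n0. U n < r"
  proof (rule ccontr)
    assume "\<not> (\<exists>n\<ge>n0. U n < r)"
    then have ge: "\<And>n. n \<ge> n0 \<Longrightarrow> r \<le> U n" by force
    have dec: "U (n0 + i) \<le> U n0 - c * ((\<Sum>j<n0 + i. H j) - (\<Sum>j<n0. H j))" for i
    proof (induction i)
      case (Suc i)
      have "U (Suc (n0 + i)) \<le> U (n0 + i) - c * H (n0 + i)"
        using n0[of "n0 + i"] ge[of "n0 + i"] by auto
      with Suc show ?case by (simp add: algebra_simps)
    qed simp
    have "eventually (\<lambda>n. (U n0 - B) / c + (\<Sum>j<n0. H j) < (\<Sum>j<n. H j)) sequentially"
      using H_sum by (simp add: filterlim_at_top_dense)
    then obtain n1 where n1: "\<And>n. n \<ge> n1 \<Longrightarrow> (U n0 - B) / c + (\<Sum>j<n0. H j) < (\<Sum>j<n. H j)"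
      unfolding eventually_sequentially by blast
    have "(U n0 - B) / c < (\<Sum>j<n0 + n1. H j) - (\<Sum>j<n0. H j)" using n1[of "n0 + n1"] by simp
    then have "U n0 - B < c * ((\<Sum>j<n0 + n1. H j) - (\<Sum>j<n0. H j))"
      using c by (simp add: pos_divide_less_eq mult.commute)
    with dec[of n1] lower[of "n0 + n1"] show False by simp
  qed
  then obtain n1 where n1: "n1 \<ge> n0" "U n1 < r" by blast
  have "U (n1 + i) < r + \<eta>" for i
  proof (induction i)
    case 0 then show ?case using n1 \<eta> by simp
  next
    case (Suc i)
    have *: "n1 + i \<ge> n0" using n1 by simp
    show ?case
    proof (cases "r \<le> U (n1 + i)")
      case True
      have "U (Suc (n1 + i)) \<le> U (n1 + i) - c * H (n1 + i)" using n0[OF *] True by simp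
      also have "\<dots> \<le> U (n1 + i)" using c H_nonneg by simp
      finally show ?thesis using Suc by simp
    next
      case False
      then show ?thesis using n0[OF *] by simp
    qed
  qed
  then show ?thesis
    unfolding eventually_sequentially by (metis le_Suc_ex)
qed

text \<open>The mean value theorem on the segment from \<open>x\<close> to \<open>x + d\<close>,
  then the Lipschitz bound at the intermediate point. This yields \<open>L\<close> where integration
  would yield \<open>L / 2\<close>; the difference only affects constants.\<close>

lemma GDERIV_lipschitz_upper_bound:
  fixes \<Psi> :: "'a::real_inner \<Rightarrow> real"
  assumes grad: "\<And>x. GDERIV \<Psi> x :> g x" and lip: "lipschitz_on L UNIV g"
  shows "\<Psi> (x + d) \<le> \<Psi> x + inner (g x) d + L * (norm d)\<^sup>2"
proof -
  have der: "((\<lambda>t. \<Psi> (x + t *\<^sub>R d)) has_real_derivative inner d (g (x + t *\<^sub>R d))) (at t)" for t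
  proof -
    have "((\<lambda>t. x + t *\<^sub>R d) has_derivative (\<lambda>s. s *\<^sub>R d)) (at t)"
      by (auto intro!: derivative_eq_intros)
    moreover have "(\<Psi> has_derivative (\<lambda>h. inner h (g (x + t *\<^sub>R d)))) (at (x + t *\<^sub>R d))"
      using grad by (simp add: gderiv_def)
    ultimately have "((\<lambda>t. \<Psi> (x + t *\<^sub>R d)) has_derivative (\<lambda>s. inner (s *\<^sub>R d) (g (x + t *\<^sub>R d)))) (at t)"
      using has_derivative_compose by blast
    then show ?thesis
      by (simp add: has_field_derivative_def mult_commute_abs)
  qed
  have "\<exists>z::real. 0 < z \<and> z < 1 \<and> \<Psi> (x + 1 *\<^sub>R d) - \<Psi> (x + 0 *\<^sub>R d) = (1 - 0) * inner d (g (x + z *\<^sub>R d))"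
    by (rule MVT2) (use der in auto)
  then obtain z where z: "0 < z" "z < 1" "\<Psi> (x + d) - \<Psi> x = inner d (g (x + z *\<^sub>R d))"
    by auto
  have L: "0 \<le> L" using lip by (rule lipschitz_on_nonneg)
  have "norm (g (x + z *\<^sub>R d) - g x) \<le> L * norm (z *\<^sub>R d)"
    using lipschitz_onD[OF lip, of "x + z *\<^sub>R d" x] by (simp add: dist_norm)
  also have "\<dots> \<le> L * norm d" using z L by (intro mult_left_mono) (auto intro: mult_left_le_one_le)
  finally have "norm d * norm (g (x + z *\<^sub>R d) - g x) \<le> norm d * (L * norm d)"
    by (rule mult_left_mono) simp
  then have "inner d (g (x + z *\<^sub>R d) - g x) \<le> L * (norm d)\<^sup>2"
    using norm_cauchy_schwarz[of d "g (x + z *\<^sub>R d) - g x"] by (simp add: power2_eq_square mult_ac)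
  then show ?thesis using z(3) by (simp add: inner_diff_right inner_commute)
qed

text \<open>\<open>H\<close> is the slow step size on flow steps and \<open>0\<close> on jumps, so
  that sums of \<open>H\<close> measure flow time. Of the dynamics of the fast variable only its
  bound and \<open>fast\<close> are kept. At a jump the sign of \<open>inner (\<xi> n) (p n)\<close>
  stands in for that of \<open>inner (g (q n)) (p n)\<close>.\<close>

locale restarting_path =
  fixes \<Psi> :: "'a::euclidean_space \<Rightarrow> real" and g :: "'a \<Rightarrow> 'a" and L \<kappa> T R :: real and qmin :: 'a
    and q p :: "nat \<Rightarrow> 'a" and \<tau> :: "nat \<Rightarrow> real" and \<xi> :: "nat \<Rightarrow> 'a"
    and flow :: "nat \<Rightarrow> bool" and H :: "nat \<Rightarrow> real"
  assumes grad: "\<And>x. GDERIV \<Psi> x :> g x"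
    and lip: "lipschitz_on L UNIV g" and L: "1 \<le> L"
    and minimal: "\<And>x. \<Psi> qmin \<le> \<Psi> x"
    and crit: "\<And>x. g x = 0 \<Longrightarrow> \<Psi> x = \<Psi> qmin"
    and \<kappa>: "0 < \<kappa>" and T: "0 < T"
    and flow_step: "\<And>n. flow n \<Longrightarrow> q (Suc n) = q n + H n *\<^sub>R p n
        \<and> p (Suc n) = p n + H n *\<^sub>R (- (\<kappa> *\<^sub>R p n) - \<xi> n)
        \<and> \<tau> (Suc n) = \<tau> n + H n * min 1 (2 - \<tau> n / T)"
    and jump_step: "\<And>n. \<not> flow n \<Longrightarrow> q (Suc n) = q n \<and> p (Suc n) = 0 \<and> \<tau> (Suc n) = 0
        \<and> 0 \<le> inner (\<xi> n) (p n) \<and> T \<le> \<tau> n"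
    and H_nonneg: "\<And>n. 0 \<le> H n" and H_jump: "\<And>n. \<not> flow n \<Longrightarrow> H n = 0"
    and H_lim: "H \<longlonglongrightarrow> 0"
    and H_sum: "filterlim (\<lambda>n. \<Sum>i<n. H i) at_top sequentially"
    and q_bound: "\<And>n. norm (q n) \<le> R" and p_bound: "\<And>n. norm (p n) \<le> R"
    and \<tau>_bound: "\<And>n. \<bar>\<tau> n\<bar> \<le> R" and \<xi>_bound: "\<And>n. norm (\<xi> n) \<le> R"
    and fast: "(\<lambda>n. \<xi> n - g (q n)) \<longlonglongrightarrow> 0"
begin

section \<open>Limits of the timer\<close>

lemma R_nonneg: "0 \<le> R"
  using q_bound[of 0] norm_ge_zero[of "q 0"] by linarith

text \<open>The drift is at most \<open>2 - \<tau> n / T\<close>, that is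
  \<open>- (\<tau> n - 2 * T) / T\<close>, so the excess over \<open>2 * T\<close> contracts at rate
  \<open>H n / T\<close>; a jump sets it to zero.\<close>

lemma timer_upper: "(\<lambda>n. max (\<tau> n - 2 * T) 0) \<longlonglongrightarrow> 0"
proof (rule contraction_tendsto_zero[where H = "\<lambda>n. H n / T" and \<epsilon> = "\<lambda>_. 0"])
  have "(\<lambda>n. H n / T) \<longlonglongrightarrow> 0 / T" using H_lim T by (intro tendsto_divide tendsto_const) auto
  then show HT: "(\<lambda>n. H n / T) \<longlonglongrightarrow> 0" by simp
  have "eventually (\<lambda>n. H n / T < 1) sequentially" using HT by (rule order_tendstoD) simp
  then show "eventually (\<lambda>n. max (\<tau> (Suc n) - 2 * T) 0
      \<le> (1 - H n / T) * max (\<tau> n - 2 * T) 0 + H n / T * 0) sequentially"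
  proof eventually_elim
    case (elim n)
    show ?case
    proof (cases "flow n")
      case True
      have "\<tau> (Suc n) \<le> \<tau> n + H n * (2 - \<tau> n / T)"
        using flow_step[OF True] H_nonneg[of n] by (simp add: mult_left_mono)
      also have "\<dots> = 2 * T + (1 - H n / T) * (\<tau> n - 2 * T)"
        using T by (simp add: field_simps)
      also have "\<dots> \<le> 2 * T + (1 - H n / T) * max (\<tau> n - 2 * T) 0"
        using elim by (intro add_left_mono mult_left_mono) auto
      finally show ?thesis using elim by auto
    next
      case False
      then show ?thesis using jump_step[OF False] elim T by auto
    qed
  qed
  show "filterlim (\<lambda>n. \<Sum>i<n. H i / T) at_top sequentially"
    using filterlim_tendsto_pos_mult_at_top[OF tendsto_const _ H_sum, of "1 / T"] T
    by (simp add: sum_distrib_left)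
qed (use H_nonneg T in auto)

text \<open>A negative timer has drift exactly \<open>1\<close>. This constant gain is weakened to a
  contraction by means of \<open>- \<tau> n \<le> R + 1\<close>; the denominator is
  \<open>R + 1\<close> because \<open>R\<close> may be zero.\<close>

lemma timer_lower: "(\<lambda>n. max (- \<tau> n) 0) \<longlonglongrightarrow> 0"
proof (rule contraction_tendsto_zero[where H = "\<lambda>n. H n / (R + 1)" and \<epsilon> = "\<lambda>_. 0"])
  have R: "0 < R + 1" using R_nonneg by simp
  have "(\<lambda>n. H n / (R + 1)) \<longlonglongrightarrow> 0 / (R + 1)" using H_lim R by (intro tendsto_divide tendsto_const) auto
  then show HR: "(\<lambda>n. H n / (R + 1)) \<longlonglongrightarrow> 0" by simp
  have "eventually (\<lambda>n. H n < T) sequentially" using H_lim T by (rule order_tendstoD)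
  moreover have "eventually (\<lambda>n. H n / (R + 1) < 1) sequentially" using HR by (rule order_tendstoD) simp
  ultimately show "eventually (\<lambda>n. max (- \<tau> (Suc n)) 0
      \<le> (1 - H n / (R + 1)) * max (- \<tau> n) 0 + H n / (R + 1) * 0) sequentially"
  proof eventually_elim
    case (elim n)
    show ?case
    proof (cases "flow n \<and> \<tau> n < 0")
      case True
      then have "1 \<le> 2 - \<tau> n / T" using T by (simp add: divide_neg_pos le_less)
      then have \<tau>': "\<tau> (Suc n) = \<tau> n + H n" using flow_step[of n] True by simp
      have "- \<tau> n \<le> R + 1" using \<tau>_bound[of n] by linarith
      then have "H n * (- \<tau> n) \<le> H n * (R + 1)" using H_nonneg by (intro mult_left_mono) auto
      then have "H n / (R + 1) * (- \<tau> n) \<le> H n" using R by (simp add: field_simps)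
      then have "- \<tau> (Suc n) \<le> (1 - H n / (R + 1)) * (- \<tau> n)"
        unfolding \<tau>' by (simp add: algebra_simps)
      moreover have "0 \<le> (1 - H n / (R + 1)) * (- \<tau> n)" using True elim
        by (intro mult_nonneg_nonneg) auto
      ultimately show ?thesis using True by simp
    next
      case False
      have "0 \<le> \<tau> (Suc n)"
      proof (cases "flow n")
        case True
        with False have \<tau>0: "0 \<le> \<tau> n" by simp
        have "0 \<le> \<tau> n + H n * min 1 (2 - \<tau> n / T)"
        proof (cases "0 \<le> 2 - \<tau> n / T")
          case True
          then show ?thesis using \<tau>0 H_nonneg[of n] by simp
        next
          case neg: False
          \<comment> \<open>A negative drift occurs only beyond \<open>2 * T\<close>, and with
            \<open>H n < T\<close> one Euler step still lands at or above \<open>2 * T\<close>, so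
            it cannot overshoot to negative values.\<close>
          define d where "d = 2 - \<tau> n / T"
          have "T * d \<le> H n * d" using neg elim unfolding d_def by (intro mult_right_mono_neg) auto
          moreover have "T * d = 2 * T - \<tau> n" using T by (simp add: d_def field_simps)
          moreover have "min 1 d = d" using neg unfolding d_def by (intro min_absorb2) linarith
          ultimately show ?thesis using T unfolding d_def[symmetric] by simp
        qed
        then show ?thesis using flow_step[OF True] by simp
      next
        case False then show ?thesis using jump_step by simp
      qed
      then show ?thesis using elim by auto
    qed
  qed
  show "filterlim (\<lambda>n. \<Sum>i<n. H i / (R + 1)) at_top sequentially"
    using filterlim_tendsto_pos_mult_at_top[OF tendsto_const _ H_sum, of "1 / (R + 1)"] R
    by (simp add: sum_distrib_left)
qed (use H_nonneg R_nonneg in auto)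

text \<open>Minimality at \<open>x - g x / (2 L)\<close>.\<close>
lemma grad_norm_le: "(norm (g x))\<^sup>2 \<le> 4 * L * (\<Psi> x - \<Psi> qmin)"
proof -
  have "\<Psi> qmin \<le> \<Psi> (x + (- 1 / (2 * L)) *\<^sub>R g x)" by (rule minimal)
  also have "\<dots> \<le> \<Psi> x + inner (g x) ((- 1 / (2 * L)) *\<^sub>R g x) + L * (norm ((- 1 / (2 * L)) *\<^sub>R g x))\<^sup>2"
    using grad lip by (rule GDERIV_lipschitz_upper_bound)
  also have "\<dots> = \<Psi> x - (norm (g x))\<^sup>2 / (4 * L)"
    using L by (simp add: dot_square_norm power_mult_distrib power_divide field_simps power2_eq_square)
  finally show ?thesis using L by (simp add: field_simps)
qed

text \<open>Weight of the cross term. The first bound keeps \<open>W\<close> nonnegative by way of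
  \<open>grad_norm_le\<close>. The second solves
  \<open>\<delta> * (L + \<kappa>\<^sup>2 / 2) \<le> \<kappa> / 2\<close>, so that what the cross
  term costs in \<open>(norm v)\<^sup>2\<close> uses at most half of the friction.\<close>

definition "\<delta> = min (1 / (4 * L)) (\<kappa> / (2 * L + \<kappa>\<^sup>2))"

lemma \<delta>: "0 < \<delta>" "\<delta> \<le> 1 / (4 * L)" "\<delta> * L + \<delta> * \<kappa>\<^sup>2 / 2 \<le> \<kappa> / 2"
proof -
  have pos: "0 < 2 * L + \<kappa>\<^sup>2" using L by (smt (verit) zero_le_power2)
  then show "0 < \<delta>" "\<delta> \<le> 1 / (4 * L)" using L \<kappa> by (auto simp: \<delta>_def)
  have "\<delta> \<le> \<kappa> / (2 * L + \<kappa>\<^sup>2)" by (simp add: \<delta>_def)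
  then have "\<delta> * (2 * L + \<kappa>\<^sup>2) \<le> \<kappa>" using pos by (simp add: field_simps)
  then show "\<delta> * L + \<delta> * \<kappa>\<^sup>2 / 2 \<le> \<kappa> / 2" by (simp add: field_simps)
qed

text \<open>Along the flow the energy loses only \<open>\<kappa> * (norm v)\<^sup>2\<close>, which
  vanishes at rest even away from critical points. The change of \<open>inner (g x) v\<close>
  contributes \<open>- (norm (g x))\<^sup>2\<close> and closes this gap.\<close>

definition "W x v = \<Psi> x - \<Psi> qmin + (norm v)\<^sup>2 / 2 + \<delta> * inner (g x) v"

text \<open>Young's inequality splits the cross term: \<open>\<delta> \<le> 1 / (4 * L)\<close> and
  \<open>grad_norm_le\<close> charge half of the potential gap, and
  \<open>\<delta> \<le> 1 / 2\<close> charges half of the kinetic energy.\<close>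

lemma W_lower: "2 * (\<Psi> x - \<Psi> qmin) + (norm v)\<^sup>2 \<le> 4 * W x v"
proof -
  have "\<bar>inner (g x) v\<bar> \<le> norm (g x) * norm v" by (rule Cauchy_Schwarz_ineq2)
  also have "\<dots> \<le> ((norm (g x))\<^sup>2 + (norm v)\<^sup>2) / 2"
    using sum_squares_bound[of "norm (g x)" "norm v"] by (simp add: field_simps)
  finally have "\<delta> * \<bar>inner (g x) v\<bar> \<le> \<delta> * (((norm (g x))\<^sup>2 + (norm v)\<^sup>2) / 2)"
    using \<delta>(1) by (intro mult_left_mono) auto
  also have "\<dots> = \<delta> * (norm (g x))\<^sup>2 / 2 + \<delta> * (norm v)\<^sup>2 / 2" by (simp add: field_simps)
  also have "\<delta> * (norm (g x))\<^sup>2 \<le> 1 / (4 * L) * (4 * L * (\<Psi> x - \<Psi> qmin))"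
    using \<delta> L grad_norm_le[of x] minimal[of x] by (intro mult_mono) auto
  also have "1 / (4 * L) * (4 * L * (\<Psi> x - \<Psi> qmin)) = \<Psi> x - \<Psi> qmin" using L by simp
  also have "\<delta> * (norm v)\<^sup>2 \<le> 1 / 2 * (norm v)\<^sup>2"
  proof (rule mult_right_mono)
    have "1 / (4 * L) \<le> 1 / 2" using L by (simp add: field_simps)
    with \<delta>(2) show "\<delta> \<le> 1 / 2" by linarith
  qed simp
  finally have "\<delta> * \<bar>inner (g x) v\<bar> \<le> (\<Psi> x - \<Psi> qmin) / 2 + (norm v)\<^sup>2 / 4" by simp
  moreover have "- (\<delta> * \<bar>inner (g x) v\<bar>) \<le> \<delta> * inner (g x) v"
    using \<delta>(1) by (simp add: abs_if mult_less_0_iff)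
  ultimately show ?thesis by (simp add: W_def field_simps)
qed

lemma W_nonneg: "0 \<le> W x v"
  and potential_le_W: "\<Psi> x - \<Psi> qmin \<le> 2 * W x v"
  and momentum_le_W: "(norm v)\<^sup>2 \<le> 4 * W x v"
proof -
  define z where "z = (norm v)\<^sup>2"
  have "0 \<le> \<Psi> x - \<Psi> qmin" "0 \<le> z" using minimal by (auto simp: z_def)
  with W_lower[of x v, folded z_def]
  have "0 \<le> W x v \<and> \<Psi> x - \<Psi> qmin \<le> 2 * W x v \<and> z \<le> 4 * W x v"
    by (intro conjI; argo)
  then show "0 \<le> W x v" "\<Psi> x - \<Psi> qmin \<le> 2 * W x v" "(norm v)\<^sup>2 \<le> 4 * W x v"
    by (auto simp: z_def)
qed

text \<open>A coarse sum, so that one constant serves three bounds: \<open>R\<close> for the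
  momentum, \<open>norm (g 0) + L * R\<close> for the gradient on the ball, and
  \<open>\<kappa> * R + R\<close> for the force
  \<open>\<kappa> *\<^sub>R p n + \<xi> n\<close>.\<close>

definition "B = R + norm (g 0) + L * R + \<kappa> * R"

lemma B_bounds:
  shows "norm (p n) \<le> B" and "norm (g (q n)) \<le> B"
    and "norm (\<kappa> *\<^sub>R p n + \<xi> n) \<le> B"
proof -
  have LR: "0 \<le> L * R" "0 \<le> \<kappa> * R" using R_nonneg L \<kappa> by auto
  then show "norm (p n) \<le> B"
    unfolding B_def using p_bound[of n] by (smt (verit) norm_ge_zero)
  have "norm (g (q n)) \<le> norm (g 0) + norm (g (q n) - g 0)" by (rule norm_triangle_sub)
  also have "norm (g (q n) - g 0) \<le> L * norm (q n)"
    using lipschitz_onD[OF lip, of "q n" 0] by (simp add: dist_norm)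
  also have "\<dots> \<le> L * R" using L q_bound by (intro mult_left_mono) auto
  finally show "norm (g (q n)) \<le> B"
    using R_nonneg LR by (simp add: B_def)
  have "norm (\<kappa> *\<^sub>R p n + \<xi> n) \<le> \<kappa> * norm (p n) + norm (\<xi> n)"
    using norm_triangle_ineq[of "\<kappa> *\<^sub>R p n" "\<xi> n"] \<kappa> by simp
  also have "\<kappa> * norm (p n) \<le> \<kappa> * R" using \<kappa> p_bound by (intro mult_left_mono) auto
  finally show "norm (\<kappa> *\<^sub>R p n + \<xi> n) \<le> B"
    using \<xi>_bound[of n] LR norm_ge_zero[of "g 0"] unfolding B_def by linarith
qed

lemma B_nonneg: "0 \<le> B"
  using B_bounds(1)[of 0] norm_ge_zero[of "p 0"] by linarith

text \<open>The first-order terms \<open>inner G v\<close> of potential and kinetic energy cancel,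
  leaving friction and the cross term. The summands \<open>L\<close>, \<open>1 / 2\<close> and
  \<open>\<delta> * L\<close> are the second-order remainders of potential, kinetic energy and cross
  term; \<open>B + \<delta> * B\<close> collects the tracking error in the latter two.\<close>

lemma W_flow:
  assumes "flow n"
  shows "W (q (Suc n)) (p (Suc n)) \<le> W (q n) (p n)
    - H n * (\<kappa> / 2 * (norm (p n))\<^sup>2 + \<delta> / 2 * (norm (g (q n)))\<^sup>2)
    + H n * ((B + \<delta> * B) * norm (\<xi> n - g (q n)) + H n * ((L + 1 / 2 + \<delta> * L) * B\<^sup>2))"
proof -
  define h x v G e w x' where "h = H n" and "x = q n" and "v = p n" and "G = g (q n)"
    and "e = \<xi> n - g (q n)" and "w = \<kappa> *\<^sub>R p n + \<xi> n" and "x' = q (Suc n)"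
  have h: "0 \<le> h" using H_nonneg by (simp add: h_def)
  have x': "x' = x + h *\<^sub>R v" and v': "p (Suc n) = v - h *\<^sub>R w"
    using flow_step[OF assms] by (auto simp: x'_def x_def h_def v_def w_def algebra_simps)
  have bnd: "norm v \<le> B" "norm G \<le> B" "norm w \<le> B" "0 \<le> B"
    using B_bounds[of n] B_nonneg by (auto simp: v_def G_def w_def)
  have vB: "(norm v)\<^sup>2 \<le> B\<^sup>2" and wB: "(norm w)\<^sup>2 \<le> B\<^sup>2" using bnd by (auto intro!: power_mono)
  have gd: "norm (g x' - G) \<le> L * (h * norm v)"
    using lipschitz_onD[OF lip, of x' x] h by (simp add: dist_norm x' x_def G_def)
  have e1: "\<Psi> x' \<le> \<Psi> x + h * inner G v + h * (h * (L * B\<^sup>2))"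
  proof -
    have "\<Psi> x' \<le> \<Psi> x + inner (g x) (h *\<^sub>R v) + L * (norm (h *\<^sub>R v))\<^sup>2"
      unfolding x' using grad lip by (rule GDERIV_lipschitz_upper_bound)
    also have "L * (norm (h *\<^sub>R v))\<^sup>2 = h * (h * (L * (norm v)\<^sup>2))"
      by (simp add: power_mult_distrib power2_eq_square)
    also have "\<dots> \<le> h * (h * (L * B\<^sup>2))" using h L vB by (intro mult_left_mono) auto
    finally show ?thesis by (simp add: G_def x_def)
  qed
  have e2: "(norm (v - h *\<^sub>R w))\<^sup>2 / 2 \<le> (norm v)\<^sup>2 / 2 - h * inner v w + h * (h * (1 / 2 * B\<^sup>2))"
  proof -
    have "(norm (v - h *\<^sub>R w))\<^sup>2 = (norm v)\<^sup>2 - 2 * (h * inner v w) + h * (h * (norm w)\<^sup>2)"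
      by (simp add: dot_square_norm[symmetric] inner_diff_left inner_diff_right inner_commute algebra_simps)
    moreover have "h * (h * (norm w)\<^sup>2) \<le> h * (h * B\<^sup>2)" using h wB by (intro mult_left_mono) auto
    ultimately show ?thesis by simp
  qed
  \<comment> \<open>\<open>g\<close> is only Lipschitz, so its change is bounded by \<open>L\<close>
    times the displacement. Against \<open>v\<close> this costs
    \<open>h * (L * (norm v)\<^sup>2)\<close>, of first order in \<open>h\<close>; against
    \<open>h *\<^sub>R w\<close> the cost is of second order.\<close>
  have e3: "inner (g x') (v - h *\<^sub>R w) \<le> inner G v - h * inner G w + h * (L * (norm v)\<^sup>2) + h * (h * (L * B\<^sup>2))"
  proof -
    have "inner (g x') (v - h *\<^sub>R w)
        = inner G v - h * inner G w + inner (g x' - G) v + h * inner (G - g x') w"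
      by (simp add: inner_diff_left inner_diff_right algebra_simps)
    moreover have "inner (g x' - G) v \<le> h * (L * (norm v)\<^sup>2)"
    proof -
      have "inner (g x' - G) v \<le> norm (g x' - G) * norm v" by (rule norm_cauchy_schwarz)
      also have "\<dots> \<le> L * (h * norm v) * norm v" using gd by (intro mult_right_mono) auto
      finally show ?thesis by (simp add: power2_eq_square mult_ac)
    qed
    moreover have "inner (G - g x') w \<le> h * (L * B\<^sup>2)"
    proof -
      have "inner (G - g x') w \<le> norm (G - g x') * norm w" by (rule norm_cauchy_schwarz)
      also have "\<dots> \<le> L * (h * B) * B"
      proof (rule mult_mono)
        have "L * (h * norm v) \<le> L * (h * B)" using bnd h L by (intro mult_left_mono) auto
        with gd show "norm (G - g x') \<le> L * (h * B)" by (simp add: norm_minus_commute)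
      qed (use bnd h L in auto)
      finally show ?thesis by (simp add: power2_eq_square mult_ac)
    qed
    then have "h * inner (G - g x') w \<le> h * (h * (L * B\<^sup>2))" using h by (intro mult_left_mono)
    ultimately show ?thesis by linarith
  qed
  have ve: "- inner v e \<le> B * norm e" and Ge: "- inner G e \<le> B * norm e"
  proof -
    have "- inner v e \<le> norm v * norm e" "- inner G e \<le> norm G * norm e"
      using Cauchy_Schwarz_ineq2[of v e] Cauchy_Schwarz_ineq2[of G e] by auto
    then show "- inner v e \<le> B * norm e" "- inner G e \<le> B * norm e"
      using mult_right_mono[OF bnd(1), of "norm e"] mult_right_mono[OF bnd(2), of "norm e"] by auto
  qed
  have w: "w = \<kappa> *\<^sub>R v + G + e" by (simp add: w_def v_def G_def e_def)
  \<comment> \<open>The square of \<open>G + \<kappa> *\<^sub>R v\<close> uses up half of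
    \<open>(norm G)\<^sup>2\<close>; the other half remains as dissipation.\<close>
  have Gv: "- (\<kappa> * inner G v) \<le> (norm G)\<^sup>2 / 2 + \<kappa>\<^sup>2 * (norm v)\<^sup>2 / 2"
  proof -
    have "0 \<le> (norm (G + \<kappa> *\<^sub>R v))\<^sup>2" by simp
    also have "\<dots> = (norm G)\<^sup>2 + 2 * (\<kappa> * inner G v) + \<kappa>\<^sup>2 * (norm v)\<^sup>2"
      by (simp add: dot_square_norm[symmetric] inner_add_left inner_add_right inner_commute
          power2_eq_square[of \<kappa>] algebra_simps)
    finally show ?thesis by simp
  qed
  have br: "inner G v - inner v w + \<delta> * (L * (norm v)\<^sup>2 - inner G w)
      \<le> - (\<kappa> / 2 * (norm v)\<^sup>2 + \<delta> / 2 * (norm G)\<^sup>2) + (B + \<delta> * B) * norm e"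
  proof -
    have "inner G v - inner v w = - \<kappa> * (norm v)\<^sup>2 - inner v e"
      unfolding w by (simp add: inner_add_right dot_square_norm inner_commute)
    moreover have "L * (norm v)\<^sup>2 - inner G w
        \<le> L * (norm v)\<^sup>2 + \<kappa>\<^sup>2 * (norm v)\<^sup>2 / 2 - (norm G)\<^sup>2 / 2 + B * norm e"
      using Gv Ge unfolding w by (simp add: inner_add_right dot_square_norm)
    then have "\<delta> * (L * (norm v)\<^sup>2 - inner G w)
        \<le> \<delta> * (L * (norm v)\<^sup>2 + \<kappa>\<^sup>2 * (norm v)\<^sup>2 / 2 - (norm G)\<^sup>2 / 2 + B * norm e)"
      using \<delta>(1) by (intro mult_left_mono) auto
    moreover have "(\<delta> * L + \<delta> * \<kappa>\<^sup>2 / 2) * (norm v)\<^sup>2 \<le> \<kappa> / 2 * (norm v)\<^sup>2"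
      using \<delta>(3) by (rule mult_right_mono) simp
    ultimately show ?thesis using ve by (simp add: algebra_simps)
  qed
  have "\<delta> * inner (g x') (v - h *\<^sub>R w)
      \<le> \<delta> * (inner G v - h * inner G w + h * (L * (norm v)\<^sup>2) + h * (h * (L * B\<^sup>2)))"
    using e3 \<delta>(1) by (intro mult_left_mono) auto
  with e1 e2 have "W x' (v - h *\<^sub>R w) \<le> W x v
      + h * (inner G v - inner v w + \<delta> * (L * (norm v)\<^sup>2 - inner G w))
      + h * (h * ((L + 1 / 2 + \<delta> * L) * B\<^sup>2))"
    unfolding W_def by (simp add: algebra_simps G_def x_def)
  also have "h * (inner G v - inner v w + \<delta> * (L * (norm v)\<^sup>2 - inner G w))
      \<le> h * (- (\<kappa> / 2 * (norm v)\<^sup>2 + \<delta> / 2 * (norm G)\<^sup>2) + (B + \<delta> * B) * norm e)"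
    using br h by (rule mult_left_mono)
  finally show ?thesis
    unfolding v' x'_def[symmetric] by (simp add: x_def v_def G_def e_def h_def algebra_simps)
qed

text \<open>The reset removes the kinetic energy and the cross term. Losing the latter hurts only if
  \<open>inner (g (q n)) (p n) < 0\<close>; since the jump requires
  \<open>0 \<le> inner (\<xi> n) (p n)\<close>, that inner product is negative by no more than the
  tracking error allows.\<close>

lemma W_jump:
  assumes "\<not> flow n"
  shows "W (q (Suc n)) (p (Suc n)) \<le> W (q n) (p n) + \<delta> * B * norm (\<xi> n - g (q n))"
proof -
  have "- inner (g (q n)) (p n) \<le> inner (\<xi> n - g (q n)) (p n)"
    using jump_step[OF assms] by (simp add: inner_diff_left)
  also have "\<dots> \<le> norm (\<xi> n - g (q n)) * norm (p n)" by (rule norm_cauchy_schwarz)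
  also have "\<dots> \<le> norm (\<xi> n - g (q n)) * B" using B_bounds by (intro mult_left_mono) auto
  finally have "- inner (g (q n)) (p n) \<le> norm (\<xi> n - g (q n)) * B" .
  then have "\<delta> * (- inner (g (q n)) (p n)) \<le> \<delta> * (norm (\<xi> n - g (q n)) * B)"
    using \<delta>(1) by (intro mult_left_mono) auto
  moreover have "0 \<le> (norm (p n))\<^sup>2" by simp
  ultimately show ?thesis using jump_step[OF assms] by (simp add: W_def mult_ac)
qed

text \<open>Compactness of the bounded set where \<open>r \<le> W\<close>: the dissipation vanishes
  only at rest at a critical point, and there \<open>crit\<close> makes \<open>W\<close>
  zero.\<close>

lemma W_dissipation:
  assumes "0 < r"
  obtains c where "0 < c"
    "\<And>n. r \<le> W (q n) (p n) \<Longrightarrow> c \<le> \<kappa> / 2 * (norm (p n))\<^sup>2 + \<delta> / 2 * (norm (g (q n)))\<^sup>2"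
proof -
  define f where "f z = \<kappa> / 2 * (norm (snd z))\<^sup>2 + \<delta> / 2 * (norm (g (fst z)))\<^sup>2" for z :: "'a \<times> 'a"
  define S where "S = (cball 0 R \<times> cball 0 R) \<inter> {z. r \<le> W (fst z) (snd z)}"
  have cg: "continuous_on UNIV g" using lip by (rule lipschitz_on_continuous_on)
  then have cgf: "continuous_on UNIV (\<lambda>z::'a \<times> 'a. g (fst z))"
    by (rule continuous_on_compose2) (auto intro: continuous_intros)
  have "continuous_on UNIV \<Psi>"
    using grad unfolding gderiv_def
    by (meson continuous_at_imp_continuous_on has_derivative_continuous)
  then have c\<Psi>: "continuous_on UNIV (\<lambda>z::'a \<times> 'a. \<Psi> (fst z))"
    by (rule continuous_on_compose2) (auto intro: continuous_intros)
  have cf: "continuous_on S f"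
    unfolding f_def by (intro continuous_intros continuous_on_subset[OF cgf]) auto
  have "continuous_on UNIV (\<lambda>z::'a \<times> 'a. W (fst z) (snd z))"
    unfolding W_def by (intro continuous_intros c\<Psi> cgf) auto
  then have "closed {z::'a \<times> 'a. r \<le> W (fst z) (snd z)}"
    by (intro closed_Collect_le continuous_on_const)
  then have S: "compact S" unfolding S_def by (intro compact_Int_closed compact_Times) auto
  have S_pos: "0 < f z" if "z \<in> S" for z
  proof (rule ccontr)
    assume "\<not> 0 < f z"
    moreover have "0 \<le> \<kappa> / 2 * (norm (snd z))\<^sup>2" "0 \<le> \<delta> / 2 * (norm (g (fst z)))\<^sup>2"
      using \<kappa> \<delta>(1) by auto
    ultimately have "\<kappa> / 2 * (norm (snd z))\<^sup>2 = 0" "\<delta> / 2 * (norm (g (fst z)))\<^sup>2 = 0"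
      unfolding f_def by linarith+
    then have "snd z = 0" "g (fst z) = 0" using \<kappa> \<delta>(1) by auto
    then have "W (fst z) (snd z) = 0" using crit[of "fst z"] by (simp add: W_def)
    with that assms show False by (simp add: S_def)
  qed
  have "\<exists>c>0. \<forall>z\<in>S. c \<le> f z"
  proof (cases "S = {}")
    case True then show ?thesis by (auto intro: exI[of _ 1])
  next
    case False
    then obtain z0 where "z0 \<in> S" "\<forall>z\<in>S. f z0 \<le> f z"
      using continuous_attains_inf[OF S _ cf] by blast
    then show ?thesis using S_pos by blast
  qed
  then obtain c where "0 < c" "\<And>z. z \<in> S \<Longrightarrow> c \<le> f z" by blast
  then show ?thesis
    using q_bound p_bound by (intro that[of c]) (auto simp: S_def f_def)
qed

text \<open>A jump may increase \<open>W\<close> by an error that vanishes but need not be summable. Since the timer is at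
  least \<open>T\<close> before a jump and \<open>0\<close> after it, a small multiple of \<open>min \<tau> T\<close> pays for that error.\<close>
lemma W_tendsto: "(\<lambda>n. W (q n) (p n)) \<longlonglongrightarrow> 0"
proof (rule order_tendstoI)
  fix a :: real assume "a < 0"
  then show "eventually (\<lambda>n. a < W (q n) (p n)) sequentially"
    by (intro always_eventually allI) (meson less_le_trans W_nonneg)
next
  fix a :: real assume a: "0 < a"
  \<comment> \<open>The timer term is at most \<open>r\<close> in absolute value. Hence
    \<open>2 * r \<le> U n\<close> implies \<open>r \<le> W\<close>, descent leads to
    \<open>U n < 3 * r\<close>, and this gives \<open>W < 4 * r\<close>.\<close>
  define r where "r = a / 4"
  have r: "0 < r" using a by (simp add: r_def)
  obtain c where c: "0 < c"
    "\<And>n. r \<le> W (q n) (p n) \<Longrightarrow> c \<le> \<kappa> / 2 * (norm (p n))\<^sup>2 + \<delta> / 2 * (norm (g (q n)))\<^sup>2"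
    using W_dissipation[OF r] by blast
  \<comment> \<open>The first bound lets the growth of the timer term consume at most a quarter of
    the dissipation rate \<open>c\<close>; the second keeps the timer term within
    \<open>r\<close>.\<close>
  define \<beta> where "\<beta> = min (c / 4) (r / (R + T))"
  have RT: "0 < R + T" using R_nonneg T by simp
  have \<beta>: "0 < \<beta>" "\<beta> \<le> c / 4"
    using c(1) r RT unfolding \<beta>_def by (simp, intro min.cobounded1)
  have "\<beta> \<le> r / (R + T)" by (simp add: \<beta>_def)
  then have \<beta>RT: "\<beta> * (R + T) \<le> r" using RT by (simp add: pos_le_divide_eq)
  define U where "U n = W (q n) (p n) + \<beta> * min (\<tau> n) T" for n
  define \<eta> where "\<eta> n = (B + \<delta> * B) * norm (\<xi> n - g (q n)) + H n * ((L + 1 / 2 + \<delta> * L) * B\<^sup>2)" for n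
  have timer: "\<bar>\<beta> * min (\<tau> n) T\<bar> \<le> r" for n
  proof -
    have "\<bar>min (\<tau> n) T\<bar> \<le> R + T" using \<tau>_bound[of n] T R_nonneg by (auto simp: min_def)
    then have "\<beta> * \<bar>min (\<tau> n) T\<bar> \<le> \<beta> * (R + T)" using \<beta> by (intro mult_left_mono) auto
    with \<beta>RT have "\<beta> * \<bar>min (\<tau> n) T\<bar> \<le> r" by (rule order_trans[rotated])
    then show ?thesis using \<beta>(1) by (simp add: abs_mult)
  qed
  have nf: "(\<lambda>n. norm (\<xi> n - g (q n))) \<longlonglongrightarrow> 0" using fast by (rule tendsto_norm_zero)
  have "\<eta> \<longlonglongrightarrow> (B + \<delta> * B) * 0 + 0 * ((L + 1 / 2 + \<delta> * L) * B\<^sup>2)"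
    unfolding \<eta>_def by (intro tendsto_intros nf H_lim)
  then have ev\<eta>: "eventually (\<lambda>n. \<eta> n < c / 4) sequentially" using c by (intro order_tendstoD) auto
  have "(\<lambda>n. \<delta> * B * norm (\<xi> n - g (q n))) \<longlonglongrightarrow> \<delta> * B * 0" by (intro tendsto_intros nf)
  then have evj: "eventually (\<lambda>n. \<delta> * B * norm (\<xi> n - g (q n)) < \<beta> * T) sequentially"
    using \<beta> T by (intro order_tendstoD) auto
  have U_jump: "U (Suc n) \<le> U n" if "\<not> flow n" "\<delta> * B * norm (\<xi> n - g (q n)) < \<beta> * T" for n
    using W_jump[OF that(1)] jump_step[OF that(1)] that(2) T by (simp add: U_def)
  \<comment> \<open>The \<open>c / 2\<close> consists of \<open>c / 4\<close> for the timer term,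
    whose drift is at most \<open>1\<close>, and \<open>c / 4\<close> for the error
    \<open>\<eta> n\<close>.\<close>
  have U_flow: "U (Suc n) \<le> U n - H n * (\<kappa> / 2 * (norm (p n))\<^sup>2 + \<delta> / 2 * (norm (g (q n)))\<^sup>2) + H n * (c / 2)"
    if "flow n" "\<eta> n < c / 4" for n
  proof -
    have "H n * min 1 (2 - \<tau> n / T) \<le> H n" using H_nonneg[of n] by (simp add: mult_left_le)
    then have "min (\<tau> (Suc n)) T \<le> min (\<tau> n) T + H n"
      using flow_step[OF that(1)] H_nonneg[of n] by (auto simp: min_def)
    then have "\<beta> * min (\<tau> (Suc n)) T \<le> \<beta> * (min (\<tau> n) T + H n)" using \<beta> by (intro mult_left_mono) auto
    moreover have "H n * \<eta> n + H n * \<beta> \<le> H n * (c / 2)"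
      unfolding distrib_left[symmetric] using that(2) \<beta> H_nonneg[of n] by (intro mult_left_mono) auto
    ultimately show ?thesis
      using W_flow[OF that(1)] unfolding U_def \<eta>_def by (simp add: distrib_left mult_ac)
  qed
  have "eventually (\<lambda>n. U n < 2 * r + r) sequentially"
  proof (rule eventually_below_level[where H = H and c = "c / 2" and C = "c / 2" and B = "- r"])
    show "- r \<le> U n" for n
      using timer[of n] W_nonneg[of "q n" "p n"] unfolding U_def by linarith
    show "eventually (\<lambda>n. 2 * r \<le> U n \<longrightarrow> U (Suc n) \<le> U n - c / 2 * H n) sequentially"
      using ev\<eta> evj
    proof eventually_elim
      case (elim n)
      show ?case
      proof (cases "flow n")
        case True
        show ?thesis
        proof
          assume "2 * r \<le> U n"
          then have "r \<le> W (q n) (p n)" using timer[of n] unfolding U_def by linarith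
          then have "H n * c \<le> H n * (\<kappa> / 2 * (norm (p n))\<^sup>2 + \<delta> / 2 * (norm (g (q n)))\<^sup>2)"
            using c(2) H_nonneg by (intro mult_left_mono) auto
          with U_flow[OF True elim(1)] show "U (Suc n) \<le> U n - c / 2 * H n"
            by (simp add: algebra_simps)
        qed
      next
        case False
        then show ?thesis using U_jump[of n] elim H_jump[of n] by simp
      qed
    qed
    show "eventually (\<lambda>n. U (Suc n) \<le> U n + c / 2 * H n) sequentially"
      using ev\<eta> evj
    proof eventually_elim
      case (elim n)
      show ?case
      proof (cases "flow n")
        case True
        have "0 \<le> H n * (\<kappa> / 2 * (norm (p n))\<^sup>2 + \<delta> / 2 * (norm (g (q n)))\<^sup>2)"
          using H_nonneg \<kappa> \<delta>(1) by (intro mult_nonneg_nonneg add_nonneg_nonneg) auto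
        with U_flow[OF True elim(1)] show ?thesis by (simp add: mult.commute)
      next
        case False
        then show ?thesis using U_jump[of n] elim H_jump[of n] by simp
      qed
    qed
  qed (use c r H_nonneg H_lim H_sum in auto)
  then show "eventually (\<lambda>n. W (q n) (p n) < a) sequentially"
  proof eventually_elim
    case (elim n)
    then show ?case using timer[of n] unfolding U_def r_def by linarith
  qed
qed

section \<open>Limits of potential and momentum\<close>

lemma potential_tendsto: "(\<lambda>n. \<Psi> (q n)) \<longlonglongrightarrow> \<Psi> qmin"
proof -
  have "(\<lambda>n. 2 * W (q n) (p n)) \<longlonglongrightarrow> 2 * 0" by (intro tendsto_intros W_tendsto)
  then have "(\<lambda>n. 2 * W (q n) (p n)) \<longlonglongrightarrow> 0" by simp
  then have "(\<lambda>n. \<Psi> (q n) - \<Psi> qmin) \<longlonglongrightarrow> 0"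
  proof (rule tendsto_sandwich[OF _ _ tendsto_const, rotated 2])
    show "eventually (\<lambda>n. 0 \<le> \<Psi> (q n) - \<Psi> qmin) sequentially" using minimal by simp
    show "eventually (\<lambda>n. \<Psi> (q n) - \<Psi> qmin \<le> 2 * W (q n) (p n)) sequentially"
      using potential_le_W by simp
  qed
  then show ?thesis by (rule LIM_zero_cancel)
qed

lemma momentum_tendsto: "p \<longlonglongrightarrow> 0"
proof -
  have "(\<lambda>n. 4 * W (q n) (p n)) \<longlonglongrightarrow> 4 * 0" by (intro tendsto_intros W_tendsto)
  then have "(\<lambda>n. 4 * W (q n) (p n)) \<longlonglongrightarrow> 0" by simp
  then have "(\<lambda>n. (norm (p n))\<^sup>2) \<longlonglongrightarrow> 0"
  proof (rule tendsto_sandwich[OF _ _ tendsto_const, rotated 2])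
    show "eventually (\<lambda>n. (norm (p n))\<^sup>2 \<le> 4 * W (q n) (p n)) sequentially"
      using momentum_le_W by simp
  qed simp
  then have "(\<lambda>n. norm (p n)) \<longlonglongrightarrow> 0" by (simp add: tendsto_power_zero power_tendsto_0_iff)
  then show ?thesis by (rule tendsto_norm_zero_cancel)
qed

end

section \<open>Filtered martingale noise\<close>

text \<open>Multiplying the remainder for one exponent by \<open>x + y\<close> gives the next
  remainder up to \<open>real (n + 2) * x ^ (n + 1) * y\<^sup>2\<close>; the crude factor
  \<open>(real (n + 2))\<^sup>2\<close> grows fast enough to absorb it.\<close>

lemma power_add_taylor_bound:
  fixes x y :: real
  shows "\<bar>(x + y) ^ (n + 2) - x ^ (n + 2) - real (n + 2) * x ^ (n + 1) * y\<bar>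
    \<le> (real (n + 2))\<^sup>2 * y\<^sup>2 * (\<bar>x\<bar> + \<bar>y\<bar>) ^ n"
proof (induction n)
  case 0
  have "(x + y)\<^sup>2 - x\<^sup>2 - 2 * x * y = y\<^sup>2" by (simp add: power2_eq_square algebra_simps)
  then show ?case by (simp add: numeral_2_eq_2[symmetric])
next
  case (Suc n)
  define R where "R = (x + y) ^ (n + 2) - x ^ (n + 2) - real (n + 2) * x ^ (n + 1) * y"
  have eq: "(x + y) ^ (Suc n + 2) - x ^ (Suc n + 2) - real (Suc n + 2) * x ^ (Suc n + 1) * y
      = (x + y) * R + real (n + 2) * x ^ (n + 1) * y\<^sup>2"
    by (simp add: R_def power2_eq_square algebra_simps)
  have "\<bar>(x + y) * R\<bar> \<le> (\<bar>x\<bar> + \<bar>y\<bar>) * ((real (n + 2))\<^sup>2 * y\<^sup>2 * (\<bar>x\<bar> + \<bar>y\<bar>) ^ n)"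
    unfolding abs_mult using Suc by (intro mult_mono) (auto simp: R_def)
  also have "\<dots> = (real (n + 2))\<^sup>2 * (y\<^sup>2 * (\<bar>x\<bar> + \<bar>y\<bar>) ^ Suc n)" by (simp add: mult_ac)
  finally have 1: "\<bar>(x + y) * R\<bar> \<le> (real (n + 2))\<^sup>2 * (y\<^sup>2 * (\<bar>x\<bar> + \<bar>y\<bar>) ^ Suc n)" .
  have "\<bar>real (n + 2) * x ^ (n + 1) * y\<^sup>2\<bar> = real (n + 2) * (y\<^sup>2 * \<bar>x\<bar> ^ Suc n)"
    by (simp add: abs_mult power_abs)
  also have "\<dots> \<le> real (n + 2) * (y\<^sup>2 * (\<bar>x\<bar> + \<bar>y\<bar>) ^ Suc n)"
    by (intro mult_left_mono power_mono) auto
  finally have "\<bar>(x + y) * R + real (n + 2) * x ^ (n + 1) * y\<^sup>2\<bar>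
      \<le> ((real (n + 2))\<^sup>2 + real (n + 2)) * (y\<^sup>2 * (\<bar>x\<bar> + \<bar>y\<bar>) ^ Suc n)"
    using 1 abs_triangle_ineq[of "(x + y) * R" "real (n + 2) * x ^ (n + 1) * y\<^sup>2"]
    unfolding distrib_right[of "(real (n + 2))\<^sup>2"] by linarith
  also have "\<dots> \<le> (real (Suc n + 2))\<^sup>2 * (y\<^sup>2 * (\<bar>x\<bar> + \<bar>y\<bar>) ^ Suc n)"
  proof (rule mult_right_mono)
    show "(real (n + 2))\<^sup>2 + real (n + 2) \<le> (real (Suc n + 2))\<^sup>2"
      by (simp add: power2_eq_square algebra_simps)
  qed simp
  finally show ?case unfolding eq by (simp add: mult_ac)
qed

text \<open>Half of the contraction is spent on the quadratic remainder
  \<open>c * h\<^sup>2 * (\<bar>x\<bar> + h * B) ^ (2 * k)\<close>, where \<open>m = Suc k\<close>.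
  If \<open>A * h \<le> x\<^sup>2\<close>, it is at most \<open>h / 2 * x ^ (2 * m)\<close>;
  otherwise \<open>x\<close> has size at most of order \<open>sqrt h\<close>, and the remainder has
  order \<open>h ^ (k + 2)\<close>. This is the origin of the exponent \<open>m + 1\<close>. The
  term linear in \<open>z\<close> is kept exact so that averaging can remove it.\<close>

lemma even_moment_step:
  fixes B :: real
  assumes "0 \<le> B" "1 \<le> m"
  obtains C where "0 \<le> C"
    "\<And>h x z. 0 \<le> h \<Longrightarrow> h \<le> 1 \<Longrightarrow> \<bar>z\<bar> \<le> B \<Longrightarrow> ((1 - h) * x + h * z) ^ (2 * m)
      \<le> (1 - h / 2) * x ^ (2 * m) + C * h ^ (m + 1) + real (2 * m) * ((1 - h) * x) ^ (2 * m - 1) * (h * z)"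
proof -
  obtain k where m: "m = Suc k" using assms(2) by (cases m) auto
  have m2: "2 * m = 2 * k + 2" "2 * m - 1 = 2 * k + 1" by (auto simp: m)
  define c where "c = (real (2 * k + 2))\<^sup>2 * B\<^sup>2"
  \<comment> \<open>\<open>B\<^sup>2 \<le> A\<close> ensures
    \<open>h * B \<le> \<bar>x\<bar>\<close> whenever \<open>A * h \<le> x\<^sup>2\<close>; then
    \<open>2 * c * 4 ^ k \<le> A\<close> yields the factor \<open>h / 2\<close>.\<close>
  define A where "A = B\<^sup>2 + 2 * c * 4 ^ k"
  have c: "0 \<le> c" by (simp add: c_def)
  then have A: "B\<^sup>2 \<le> A" "2 * c * 4 ^ k \<le> A" "0 \<le> A" by (auto simp: A_def)
  show thesis
  proof (rule that[of "c * (4 * A) ^ k"])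
    show "0 \<le> c * (4 * A) ^ k" using c A by simp
    fix h x z :: real assume h: "0 \<le> h" "h \<le> 1" and z: "\<bar>z\<bar> \<le> B"
    define x' where "x' = (1 - h) * x"
    have x': "\<bar>x'\<bar> \<le> \<bar>x\<bar>" using h by (simp add: x'_def abs_mult mult_left_le_one_le)
    have hz: "\<bar>h * z\<bar> \<le> h * B" using h z by (simp add: abs_mult mult_left_mono)
    have hB: "(h * B)\<^sup>2 \<le> h * B\<^sup>2"
      unfolding power_mult_distrib using h
      by (intro mult_right_mono) (auto simp: power2_eq_square mult_left_le_one_le)
    have "(x' + h * z) ^ (2 * k + 2) \<le> x' ^ (2 * k + 2) + real (2 * k + 2) * x' ^ (2 * k + 1) * (h * z)
        + (real (2 * k + 2))\<^sup>2 * (h * z)\<^sup>2 * (\<bar>x'\<bar> + \<bar>h * z\<bar>) ^ (2 * k)"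
      using power_add_taylor_bound[of x' "h * z" "2 * k"] by linarith
    also have "x' ^ (2 * k + 2) \<le> (1 - h) * x ^ (2 * k + 2)"
    proof -
      have "(1 - h) ^ (2 * k + 2) \<le> (1 - h) ^ 1" using h by (intro power_decreasing) auto
      then show ?thesis unfolding x'_def power_mult_distrib by (intro mult_right_mono zero_le_even_power) auto
    qed
    also have "(real (2 * k + 2))\<^sup>2 * (h * z)\<^sup>2 * (\<bar>x'\<bar> + \<bar>h * z\<bar>) ^ (2 * k)
        \<le> (real (2 * k + 2))\<^sup>2 * (h * B)\<^sup>2 * (\<bar>x\<bar> + h * B) ^ (2 * k)"
    proof (rule mult_mono)
      have "\<bar>h * z\<bar>\<^sup>2 \<le> (h * B)\<^sup>2" using hz by (intro power_mono) auto
      then show "(real (2 * k + 2))\<^sup>2 * (h * z)\<^sup>2 \<le> (real (2 * k + 2))\<^sup>2 * (h * B)\<^sup>2"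
        by (intro mult_left_mono) auto
      show "(\<bar>x'\<bar> + \<bar>h * z\<bar>) ^ (2 * k) \<le> (\<bar>x\<bar> + h * B) ^ (2 * k)"
        using x' hz by (intro power_mono add_mono) auto
    qed auto
    also have "\<dots> = c * h\<^sup>2 * (\<bar>x\<bar> + h * B) ^ (2 * k)"
      by (simp add: c_def power_mult_distrib mult_ac)
    also have "\<dots> \<le> h / 2 * x ^ (2 * k + 2) + c * (4 * A) ^ k * h ^ (k + 2)"
    proof (cases "A * h \<le> x\<^sup>2")
      case True
      have "(h * B)\<^sup>2 \<le> x\<^sup>2" using hB True A(1) h by (smt (verit) mult.commute mult_left_mono)
      then have "h * B \<le> \<bar>x\<bar>" using h assms(1) by (simp add: abs_le_square_iff[symmetric])
      then have "(\<bar>x\<bar> + h * B) ^ (2 * k) \<le> (2 * \<bar>x\<bar>) ^ (2 * k)"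
        using h assms(1) by (intro power_mono) auto
      also have "\<dots> = 4 ^ k * x ^ (2 * k)" by (simp add: power_mult power_mult_distrib)
      finally have "c * h\<^sup>2 * (\<bar>x\<bar> + h * B) ^ (2 * k) \<le> c * h\<^sup>2 * (4 ^ k * x ^ (2 * k))"
        using c by (intro mult_left_mono) auto
      also have "\<dots> = h / 2 * x ^ (2 * k) * (2 * c * 4 ^ k * h)" by (simp add: power2_eq_square mult_ac)
      also have "\<dots> \<le> h / 2 * x ^ (2 * k) * x\<^sup>2"
      proof (rule mult_left_mono)
        show "2 * c * 4 ^ k * h \<le> x\<^sup>2" using True mult_right_mono[OF A(2) h(1)] by linarith
      qed (use h in auto)
      also have "\<dots> = h / 2 * x ^ (2 * k + 2)" by (simp add: power_add power2_eq_square mult_ac)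
      finally show ?thesis using c A h by (smt (verit) mult_nonneg_nonneg zero_le_power)
    next
      case False
      have "(\<bar>x\<bar> + h * B)\<^sup>2 \<le> 2 * x\<^sup>2 + 2 * (h * B)\<^sup>2"
        using sum_squares_bound[of "\<bar>x\<bar>" "h * B"] by (simp add: power2_sum)
      also have "\<dots> \<le> 2 * (A * h) + 2 * (A * h)"
      proof (intro add_mono mult_left_mono)
        show "x\<^sup>2 \<le> A * h" using False by simp
        show "(h * B)\<^sup>2 \<le> A * h"
          using hB mult_right_mono[OF A(1) h(1)] by (simp add: mult.commute)
      qed auto
      also have "\<dots> = 4 * A * h" by simp
      finally have "((\<bar>x\<bar> + h * B)\<^sup>2) ^ k \<le> (4 * A * h) ^ k" by (intro power_mono) auto
      then have "c * h\<^sup>2 * (\<bar>x\<bar> + h * B) ^ (2 * k) \<le> c * h\<^sup>2 * (4 * A * h) ^ k"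
        unfolding power_mult using c by (intro mult_left_mono) auto
      also have "\<dots> = c * (4 * A) ^ k * h ^ (k + 2)"
        by (simp add: power_mult_distrib power_add power2_eq_square mult_ac)
      finally show ?thesis using h by (smt (verit) mult_nonneg_nonneg zero_le_even_power even_add even_mult_iff even_numeral divide_nonneg_nonneg)
    qed
    finally show "((1 - h) * x + h * z) ^ (2 * m) \<le> (1 - h / 2) * x ^ (2 * m)
        + c * (4 * A) ^ k * h ^ (m + 1) + real (2 * m) * ((1 - h) * x) ^ (2 * m - 1) * (h * z)"
      unfolding m2 x'_def by (simp add: m algebra_simps)
  qed
qed

section \<open>The filtration of the samples\<close>

lemma sets_filt: "sets (filt M y k) = sigma_sets (space M) {y i -` A \<inter> space M | i A. i \<in> {1..k}}"
  unfolding filt_def by (rule sets_measure_of) auto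

lemma space_filt [simp]: "space (filt M y k) = space M"
  unfolding filt_def by (rule space_measure_of) auto

lemma sets_filt_subset:
  assumes "\<And>k. k \<ge> 1 \<Longrightarrow> y k \<in> measurable M (count_space UNIV)"
  shows "sets (filt M y k) \<subseteq> sets M"
  unfolding sets_filt using assms by (intro sets.sigma_sets_subset) (auto intro: measurable_sets)

lemma filt_mono: "k \<le> l \<Longrightarrow> sets (filt M y k) \<subseteq> sets (filt M y l)"
  unfolding sets_filt by (intro sigma_sets_mono') fastforce

lemma measurable_filt_mono: "f \<in> measurable (filt M y k) N \<Longrightarrow> k \<le> l \<Longrightarrow> f \<in> measurable (filt M y l) N"
  using filt_mono[of k l M y] by (auto simp: measurable_def)

lemma measurable_filt_imp:
  assumes "\<And>k. k \<ge> 1 \<Longrightarrow> y k \<in> measurable M (count_space UNIV)" "f \<in> measurable (filt M y k) N"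
  shows "f \<in> measurable M N"
  using sets_filt_subset[of y M k] assms by (auto simp: measurable_def)

lemma measurable_y_filt:
  assumes "1 \<le> i" "i \<le> k"
  shows "y i \<in> measurable (filt M y k) (count_space UNIV)"
proof (rule measurableI)
  fix A show "y i -` A \<inter> space (filt M y k) \<in> sets (filt M y k)"
    unfolding sets_filt space_filt using assms by (intro sigma_sets.Basic) auto
qed simp

context prob_space
begin

text \<open>The indices are grouped into \<open>{1..k}\<close> and \<open>{Suc k}\<close>. Their
  generators are intersection stable, so the generated sigma-algebras are independent, and those of
  \<open>W\<close> and of the indicator are contained in them. The indicator is real-valued so that
  expectations of products factor.\<close>

lemma indep_filt_next:
  assumes y_rv: "\<And>k. k \<ge> 1 \<Longrightarrow> y k \<in> measurable M (count_space UNIV)"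
    and y_indep: "indep_vars (\<lambda>_. count_space UNIV) y {1..}"
    and W: "W \<in> borel_measurable (filt M y k)"
  shows "indep_var borel W borel (\<lambda>\<omega>. indicator {i} (y (Suc k) \<omega>) :: real)"
proof -
  let ?E = "\<lambda>i. {y i -` A \<inter> space M |A. A \<in> sets (count_space UNIV)}"
  let ?I = "\<lambda>b. if b then {1..k} else {Suc k}"
  have "indep_sets ?E {1..}" using y_indep unfolding indep_vars_def2 by simp
  then have "indep_sets ?E (\<Union>b\<in>UNIV. ?I b)" by (rule indep_sets_mono_index[rotated]) (auto split: if_splits)
  then have "indep_sets (\<lambda>b. sigma_sets (space M) (\<Union>i\<in>?I b. ?E i)) UNIV"
  proof (rule indep_sets_collect_sigma)
    show "Int_stable (?E i)" for i
    proof (rule Int_stableI)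
      fix a b assume "a \<in> ?E i" "b \<in> ?E i"
      then obtain A A' where "a = y i -` A \<inter> space M" "b = y i -` A' \<inter> space M" by auto
      then show "a \<inter> b \<in> ?E i" by (intro CollectI exI[of _ "A \<inter> A'"]) auto
    qed
  qed (auto simp: disjoint_family_on_def)
  then have "indep_set (sets (filt M y k)) (sigma_sets (space M) (?E (Suc k)))"
    unfolding indep_set_def
  proof (rule indep_sets_mono_sets)
    fix b :: bool
    have "{y i -` A \<inter> space M | i A. i \<in> {1..k}} = (\<Union>i\<in>{1..k}. ?E i)"
    proof -
      have "{f i A | i A. i \<in> I} = (\<Union>i\<in>I. {f i A |A. A \<in> sets (count_space UNIV)})"
        for f :: "nat \<Rightarrow> nat set \<Rightarrow> 'a set" and I by auto
      then show ?thesis .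
    qed
    then show "(case b of True \<Rightarrow> sets (filt M y k) | False \<Rightarrow> sigma_sets (space M) (?E (Suc k)))
        \<subseteq> sigma_sets (space M) (\<Union>i\<in>?I b. ?E i)"
      by (cases b) (simp_all add: sets_filt)
  qed
  then have "indep_set (sigma_sets (space M) {W -` A \<inter> space M |A. A \<in> sets borel})
      (sigma_sets (space M) {(\<lambda>\<omega>. indicator {i} (y (Suc k) \<omega>) :: real) -` A \<inter> space M |A. A \<in> sets borel})"
    unfolding indep_set_def
  proof (rule indep_sets_mono_sets)
    fix b :: bool
    have 1: "sigma_sets (space M) {W -` A \<inter> space M |A. A \<in> sets borel} \<subseteq> sets (filt M y k)"
      by (rule sets.sigma_sets_subset[of _ "filt M y k", unfolded space_filt])
         (use measurable_sets[OF W] in auto)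
    have 2: "sigma_sets (space M) {(\<lambda>\<omega>. indicator {i} (y (Suc k) \<omega>) :: real) -` A \<inter> space M |A. A \<in> sets borel}
        \<subseteq> sigma_sets (space M) (?E (Suc k))"
    proof (rule sigma_sets_mono', rule subsetI)
      fix S assume "S \<in> {(\<lambda>\<omega>. indicator {i} (y (Suc k) \<omega>) :: real) -` A \<inter> space M |A. A \<in> sets borel}"
      then obtain A where "S = (\<lambda>\<omega>. indicator {i} (y (Suc k) \<omega>) :: real) -` A \<inter> space M" by blast
      then have "S = y (Suc k) -` ((indicator {i} :: nat \<Rightarrow> real) -` A) \<inter> space M" by auto
      then show "S \<in> ?E (Suc k)" by auto
    qed
    show "(case b of True \<Rightarrow> sigma_sets (space M) {W -` A \<inter> space M |A. A \<in> sets borel}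
        | False \<Rightarrow> sigma_sets (space M) {(\<lambda>\<omega>. indicator {i} (y (Suc k) \<omega>) :: real) -` A \<inter> space M |A. A \<in> sets borel})
      \<subseteq> (case b of True \<Rightarrow> sets (filt M y k) | False \<Rightarrow> sigma_sets (space M) (?E (Suc k)))"
      using 1 2 by (cases b) auto
  qed
  moreover have "W \<in> borel_measurable M" using measurable_filt_imp[OF y_rv W] .
  moreover have "(\<lambda>\<omega>. indicator {i} (y (Suc k) \<omega>) :: real) \<in> borel_measurable M"
    by (rule measurable_compose[of "y (Suc k)" M "count_space UNIV"]) (auto intro: y_rv)
  ultimately show ?thesis unfolding indep_var_eq by simp
qed

text \<open>Conditional mean zero of the next noise term, tested against a bounded adapted weight.
  Splitting by the value of \<open>y (Suc k)\<close> frees \<open>g i\<close> from the random index,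
  independence gives each value the weight \<open>1 / N\<close>, and the sum over \<open>i\<close>
  vanishes.\<close>

lemma expectation_next_zero:
  fixes g :: "nat \<Rightarrow> 'a \<Rightarrow> real"
  assumes y_rv: "\<And>k. k \<ge> 1 \<Longrightarrow> y k \<in> measurable M (count_space UNIV)"
    and y_unif: "\<And>k. k \<ge> 1 \<Longrightarrow> distr M (count_space UNIV) (y k) = measure_pmf (pmf_of_set {1..N})"
    and y_indep: "indep_vars (\<lambda>_. count_space UNIV) y {1..}"
    and N: "N \<ge> 1"
    and W: "W \<in> borel_measurable (filt M y k)" and W_bound: "\<And>\<omega>. \<bar>W \<omega>\<bar> \<le> c"
    and g: "\<And>i. g i \<in> borel_measurable (filt M y k)" and g_bound: "\<And>i \<omega>. \<bar>g i \<omega>\<bar> \<le> B"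
    and g_mean: "\<And>\<omega>. (\<Sum>i\<in>{1..N}. g i \<omega>) = 0"
  shows "expectation (\<lambda>\<omega>. W \<omega> * g (y (Suc k) \<omega>) \<omega>) = 0"
proof -
  let ?\<chi> = "\<lambda>i \<omega>. indicator {i} (y (Suc k) \<omega>) :: real"
  have Suc_k: "1 \<le> Suc k" by simp
  have y_meas [measurable]: "y (Suc k) \<in> measurable M (count_space UNIV)" by (rule y_rv) simp
  have W_M [measurable]: "W \<in> borel_measurable M" by (rule measurable_filt_imp[OF y_rv W])
  have g_M [measurable]: "g i \<in> borel_measurable M" for i by (rule measurable_filt_imp[OF y_rv g])
  have gy [measurable]: "(\<lambda>\<omega>. g (y (Suc k) \<omega>) \<omega>) \<in> borel_measurable M"
    by (rule measurable_compose_countable[OF g_M y_meas])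
  have \<chi>_M [measurable]: "?\<chi> i \<in> borel_measurable M" for i
    by (rule measurable_compose[OF y_meas]) simp
  have Wg: "\<bar>W \<omega> * g i \<omega>\<bar> \<le> c * B" for i \<omega>
    unfolding abs_mult using W_bound[of \<omega>] g_bound[of i \<omega>] by (intro mult_mono) auto
  have int: "integrable M (\<lambda>\<omega>. W \<omega> * g i \<omega>)" for i
    using Wg by (intro integrable_const_bound[where B = "c * B"]) auto
  have int': "integrable M (?\<chi> i)" for i
    by (intro integrable_const_bound[where B = 1]) (auto simp: indicator_def)
  have set_pmf: "set_pmf (pmf_of_set {1..N}) = {1..N}" using N by (intro set_pmf_of_set) auto
  have "AE i in distr M (count_space UNIV) (y (Suc k)). i \<in> {1..N}"
    unfolding y_unif[OF Suc_k] AE_measure_pmf_iff set_pmf by blast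
  then have "AE \<omega> in M. y (Suc k) \<omega> \<in> {1..N}" by (subst (asm) AE_distr_iff) auto
  then have "AE \<omega> in M. W \<omega> * g (y (Suc k) \<omega>) \<omega> = (\<Sum>i\<in>{1..N}. W \<omega> * g i \<omega> * ?\<chi> i \<omega>)"
  proof eventually_elim
    case (elim \<omega>)
    then show ?case by (simp add: indicator_def if_distrib[of "times _"] sum.delta' cong: if_cong)
  qed
  then have "expectation (\<lambda>\<omega>. W \<omega> * g (y (Suc k) \<omega>) \<omega>)
      = expectation (\<lambda>\<omega>. \<Sum>i\<in>{1..N}. W \<omega> * g i \<omega> * ?\<chi> i \<omega>)"
    by (intro integral_cong_AE) auto
  also have "\<dots> = (\<Sum>i\<in>{1..N}. expectation (\<lambda>\<omega>. W \<omega> * g i \<omega> * ?\<chi> i \<omega>))"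
  proof (rule Bochner_Integration.integral_sum)
    fix i
    have "\<bar>W \<omega> * g i \<omega> * ?\<chi> i \<omega>\<bar> \<le> c * B" for \<omega>
      using Wg[of \<omega> i] by (auto simp: indicator_def)
    then show "integrable M (\<lambda>\<omega>. W \<omega> * g i \<omega> * ?\<chi> i \<omega>)"
      by (intro integrable_const_bound[where B = "c * B"]) auto
  qed
  also have "\<dots> = (\<Sum>i\<in>{1..N}. expectation (\<lambda>\<omega>. W \<omega> * g i \<omega>) * (1 / N))"
  proof (rule sum.cong)
    fix i assume i: "i \<in> {1..N}"
    have "(\<lambda>\<omega>. W \<omega> * g i \<omega>) \<in> borel_measurable (filt M y k)" using W g by measurable
    then have "indep_var borel (\<lambda>\<omega>. W \<omega> * g i \<omega>) borel (?\<chi> i)"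
      using indep_filt_next[OF y_rv y_indep] by blast
    then have "expectation (\<lambda>\<omega>. W \<omega> * g i \<omega> * ?\<chi> i \<omega>)
        = expectation (\<lambda>\<omega>. W \<omega> * g i \<omega>) * expectation (?\<chi> i)"
      using int int' by (intro indep_var_lebesgue_integral)
    also have "expectation (?\<chi> i) = integral\<^sup>L (distr M (count_space UNIV) (y (Suc k))) (indicator {i})"
      by (subst integral_distr) auto
    also have "\<dots> = 1 / N"
      unfolding y_unif[OF Suc_k] using N i by (simp add: measure_pmf_single pmf_of_set)
    finally show "expectation (\<lambda>\<omega>. W \<omega> * g i \<omega> * ?\<chi> i \<omega>) = expectation (\<lambda>\<omega>. W \<omega> * g i \<omega>) * (1 / N)" .
  qed simp
  also have "\<dots> = expectation (\<lambda>\<omega>. \<Sum>i\<in>{1..N}. W \<omega> * g i \<omega>) * (1 / N)"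
    using int by (simp add: sum_distrib_right sum_divide_distrib)
  also have "\<dots> = 0" unfolding sum_distrib_left[symmetric] g_mean by simp
  finally show ?thesis .
qed

text \<open>\<open>V k\<close> plus the remaining sum of \<open>d\<close> is a nonnegative
  supermartingale, expressed through integrals over sets of \<open>F k\<close>. Its maximal
  inequality bounds the probability that \<open>V\<close> reaches \<open>l\<close> at or after time
  \<open>n\<close> by \<open>(expectation (V n) + r n) / l\<close>, and both summands tend to
  zero.\<close>

lemma supermartingale_tendsto_zero:
  fixes V :: "nat \<Rightarrow> 'a \<Rightarrow> real" and d :: "nat \<Rightarrow> real" and F :: "nat \<Rightarrow> 'a measure"
  assumes F_space: "\<And>k. space (F k) = space M" and F_sub: "\<And>k. sets (F k) \<subseteq> sets M"
    and F_mono: "\<And>k l. k \<le> l \<Longrightarrow> sets (F k) \<subseteq> sets (F l)"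
    and V: "\<And>k. V k \<in> borel_measurable (F k)"
    and V_nonneg: "\<And>k \<omega>. 0 \<le> V k \<omega>" and V_bound: "\<And>k \<omega>. V k \<omega> \<le> K"
    and d_nonneg: "\<And>k. 0 \<le> d k" and d_sum: "summable d"
    and step: "\<And>k A. A \<in> sets (F k) \<Longrightarrow>
      expectation (\<lambda>\<omega>. indicator A \<omega> * V (Suc k) \<omega>) \<le> expectation (\<lambda>\<omega>. indicator A \<omega> * V k \<omega>) + d k"
    and mean: "(\<lambda>k. expectation (V k)) \<longlonglongrightarrow> 0"
  shows "AE \<omega> in M. (\<lambda>k. V k \<omega>) \<longlonglongrightarrow> 0"
proof -
  define r where "r k = (\<Sum>i. d (i + k))" for k
  have r: "r k = d k + r (Suc k)" for k
    using suminf_split_head[of "\<lambda>i. d (i + k)"] d_sum by (simp add: r_def summable_iff_shift)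
  have r_nonneg: "0 \<le> r k" for k
    unfolding r_def using d_sum d_nonneg by (intro suminf_nonneg) (auto simp: summable_iff_shift)
  have r_lim: "r \<longlonglongrightarrow> 0"
    unfolding r_def using suminf_exist_split2[OF d_sum] by (simp add: add.commute)
  have V_M [measurable]: "V k \<in> borel_measurable M" for k
    using V[of k] F_space[of k] F_sub[of k] by (auto simp: measurable_def)
  have int_V: "integrable M (V k)" for k
    using V_nonneg V_bound by (intro integrable_const_bound[where B = K]) auto
  have int_AV: "integrable M (\<lambda>\<omega>. indicator A \<omega> * V k \<omega>)" if "A \<in> sets M" for A k
    using integrable_mult_indicator[OF that int_V] by simp
  define G where "G l = {\<omega> \<in> space M. \<exists>n. \<forall>i\<ge>n. V i \<omega> < l}" for l
  have G_sets [measurable]: "G l \<in> sets M" for l unfolding G_def by measurable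
  have G_prob: "1 - (expectation (V n) + r n) / l \<le> prob (G l)" if l: "0 < l" for n l
  proof -
    \<comment> \<open>The event that no exit has happened up to time \<open>n + k\<close>. It is
      decided at that time, which is what \<open>step\<close> asks for.\<close>
    define A where "A k = {\<omega> \<in> space M. \<forall>i\<in>{n..n+k}. V i \<omega> < l}" for k
    have A_F: "A k \<in> sets (F (n + k))" for k
    proof -
      have "{\<omega> \<in> space (F (n + k)). V i \<omega> < l} \<in> sets (F (n + k))" if "i \<in> {n..n+k}" for i
      proof -
        have "{\<omega> \<in> space (F i). V i \<omega> < l} \<in> sets (F i)" using V[of i] by measurable
        with F_mono[of i "n + k"] that show ?thesis by (auto simp: F_space)
      qed
      then have "{\<omega> \<in> space (F (n + k)). \<forall>i\<in>{n..n+k}. V i \<omega> < l} \<in> sets (F (n + k))"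
        by (intro sets.sets_Collect_finite_All') auto
      then show ?thesis by (simp add: A_def F_space)
    qed
    then have A_M [measurable]: "A k \<in> sets M" for k using F_sub by blast
    have int_ind: "integrable M (\<lambda>\<omega>. l * indicator S \<omega>)" if "S \<in> sets M" for S
      using that by (intro integrable_const_bound[where B = "\<bar>l\<bar>"]) (auto simp: indicator_def)
    have A_Suc: "A (Suc k) \<subseteq> A k" for k by (auto simp: A_def)
    \<comment> \<open>The stopped process, by induction: a path that exits at time
      \<open>n + Suc k\<close> has value at least \<open>l\<close> and is frozen there with value
      \<open>l\<close>, the surviving part is carried on, and the tail \<open>r\<close> pays for
      \<open>d\<close>.\<close>
    have claim: "l * (1 - prob (A k)) + expectation (\<lambda>\<omega>. indicator (A k) \<omega> * V (n + k) \<omega>) + r (n + k)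
        \<le> expectation (V n) + r n" for k
    proof (induction k)
      case 0
      have "l * (1 - prob (A 0)) = expectation (\<lambda>\<omega>. l * indicator (space M - A 0) \<omega>)"
        by (simp add: prob_compl)
      also have "\<dots> + expectation (\<lambda>\<omega>. indicator (A 0) \<omega> * V n \<omega>)
          = expectation (\<lambda>\<omega>. l * indicator (space M - A 0) \<omega> + indicator (A 0) \<omega> * V n \<omega>)"
        by (intro Bochner_Integration.integral_add[symmetric] int_AV int_ind) auto
      also have "\<dots> \<le> expectation (V n)"
        by (intro integral_mono Bochner_Integration.integrable_add int_AV int_V int_ind)
           (auto simp: A_def indicator_def not_less)
      finally show ?case by simp
    next
      case (Suc k)
      have "l * (prob (A k) - prob (A (Suc k))) = l * prob (A k - A (Suc k))"
        using A_Suc by (simp add: finite_measure_Diff)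
      also have "\<dots> = expectation (\<lambda>\<omega>. l * indicator (A k - A (Suc k)) \<omega>)" by simp
      also have "\<dots> + expectation (\<lambda>\<omega>. indicator (A (Suc k)) \<omega> * V (n + Suc k) \<omega>)
          = expectation (\<lambda>\<omega>. l * indicator (A k - A (Suc k)) \<omega> + indicator (A (Suc k)) \<omega> * V (n + Suc k) \<omega>)"
        by (intro Bochner_Integration.integral_add[symmetric] int_AV int_ind) auto
      also have "\<dots> \<le> expectation (\<lambda>\<omega>. indicator (A k) \<omega> * V (n + Suc k) \<omega>)"
      proof (intro integral_mono Bochner_Integration.integrable_add int_AV int_ind)
        fix \<omega> assume \<omega>: "\<omega> \<in> space M"
        have "l \<le> V (n + Suc k) \<omega>" if "\<omega> \<in> A k" "\<omega> \<notin> A (Suc k)"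
          using that by (force simp: A_def le_Suc_eq not_less)
        then show "l * indicator (A k - A (Suc k)) \<omega> + indicator (A (Suc k)) \<omega> * V (n + Suc k) \<omega>
            \<le> indicator (A k) \<omega> * V (n + Suc k) \<omega>"
          using A_Suc[of k] V_nonneg[of "n + Suc k" \<omega>] by (auto simp: indicator_def)
      qed auto
      also have "\<dots> \<le> expectation (\<lambda>\<omega>. indicator (A k) \<omega> * V (n + k) \<omega>) + d (n + k)"
        using step[OF A_F[of k]] by simp
      finally show ?case using Suc r[of "n + k"] by (simp add: algebra_simps)
    qed
    have "1 - prob (A k) \<le> (expectation (V n) + r n) / l" for k
    proof -
      have "0 \<le> expectation (\<lambda>\<omega>. indicator (A k) \<omega> * V (n + k) \<omega>)"
        using V_nonneg by (intro Bochner_Integration.integral_nonneg) auto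
      with claim[of k] r_nonneg[of "n + k"] have "l * (1 - prob (A k)) \<le> expectation (V n) + r n" by linarith
      then show ?thesis using l by (simp add: pos_le_divide_eq mult.commute)
    qed
    then have "1 - (expectation (V n) + r n) / l \<le> prob (A k)" for k
      by (smt (verit))
    moreover have "(\<lambda>k. prob (A k)) \<longlonglongrightarrow> prob (\<Inter>k. A k)"
      by (rule finite_Lim_measure_decseq) (auto intro!: decseq_SucI A_Suc)
    ultimately have "1 - (expectation (V n) + r n) / l \<le> prob (\<Inter>k. A k)"
      by (intro LIMSEQ_le_const[of "\<lambda>k. prob (A k)"]) auto
    also have "\<dots> \<le> prob (G l)"
    proof (rule finite_measure_mono)
      show "(\<Inter>k. A k) \<subseteq> G l"
      proof
        fix \<omega> assume "\<omega> \<in> (\<Inter>k. A k)"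
        then have A: "\<And>k. \<omega> \<in> A k" by blast
        have "V i \<omega> < l" if "n \<le> i" for i using A[of "i - n"] that by (simp add: A_def)
        then show "\<omega> \<in> G l" using A[of 0] by (auto simp: G_def A_def)
      qed
    qed simp
    finally show ?thesis .
  qed
  \<comment> \<open>\<open>G_prob\<close> holds for every start \<open>n\<close>, while
    \<open>G\<close> does not depend on \<open>n\<close>; so \<open>n\<close> may tend to
    infinity.\<close>
  have "AE \<omega> in M. \<omega> \<in> G (1 / real (Suc j))" for j
  proof -
    have "(\<lambda>n. 1 - (expectation (V n) + r n) / (1 / real (Suc j))) \<longlonglongrightarrow> 1 - (0 + 0) / (1 / real (Suc j))"
      by (intro tendsto_intros mean r_lim) auto
    then have "1 \<le> prob (G (1 / real (Suc j)))"
      using G_prob[of "1 / real (Suc j)"] by (intro LIMSEQ_le_const2) auto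
    then have "prob (G (1 / real (Suc j))) = 1" using prob_le_1 by (intro antisym) auto
    then show ?thesis by (subst (asm) prob_eq_1) auto
  qed
  then have "AE \<omega> in M. \<forall>j. \<omega> \<in> G (1 / real (Suc j))" by (simp add: AE_all_countable)
  then show ?thesis
  proof eventually_elim
    case (elim \<omega>)
    show ?case
    proof (rule order_tendstoI)
      fix a :: real assume "a < 0"
      then show "eventually (\<lambda>k. a < V k \<omega>) sequentially"
        using V_nonneg by (intro always_eventually allI) (meson less_le_trans)
    next
      fix a :: real assume "0 < a"
      then obtain j where j: "inverse (real (Suc j)) < a" using reals_Archimedean by blast
      have "\<omega> \<in> G (1 / real (Suc j))" using elim by blast
      then obtain n where "\<And>i. i \<ge> n \<Longrightarrow> V i \<omega> < 1 / real (Suc j)" by (auto simp: G_def)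
      then show "eventually (\<lambda>k. V k \<omega> < a) sequentially"
        using j unfolding eventually_sequentially by (metis inverse_eq_divide less_trans)
    qed
  qed
qed

text \<open>With \<open>V = a ^ (2 * m)\<close>, one step of the filter gives \<open>E[V' | F] \<le> (1 - h / 2) V + C h ^ (m + 1)\<close>,
  because the term of the Taylor expansion that is linear in the noise has conditional mean zero.\<close>
lemma filtered_noise_tendsto_zero:
  fixes g :: "nat \<Rightarrow> nat \<Rightarrow> 'a \<Rightarrow> real" and a :: "nat \<Rightarrow> 'a \<Rightarrow> real" and h :: "nat \<Rightarrow> real"
  assumes y_rv: "\<And>k. k \<ge> 1 \<Longrightarrow> y k \<in> measurable M (count_space UNIV)"
    and y_unif: "\<And>k. k \<ge> 1 \<Longrightarrow> distr M (count_space UNIV) (y k) = measure_pmf (pmf_of_set {1..N})"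
    and y_indep: "indep_vars (\<lambda>_. count_space UNIV) y {1..}"
    and N: "N \<ge> 1"
    and g: "\<And>k i. g k i \<in> borel_measurable (filt M y k)" and g_bound: "\<And>k i \<omega>. \<bar>g k i \<omega>\<bar> \<le> B"
    and g_mean: "\<And>k \<omega>. (\<Sum>i\<in>{1..N}. g k i \<omega>) = 0"
    and h: "\<And>k. 0 \<le> h k" "\<And>k. h k \<le> 1" and h_lim: "h \<longlonglongrightarrow> 0"
    and h_top: "filterlim (\<lambda>n. \<Sum>k<n. h k) at_top sequentially"
    and m: "1 \<le> m" and h_sum: "summable (\<lambda>k. h k ^ (m + 1))"
    and a_0: "\<And>\<omega>. a 0 \<omega> = 0"
    and a_Suc: "\<And>k \<omega>. a (Suc k) \<omega> = (1 - h k) * a k \<omega> + h k * g k (y (Suc k) \<omega>) \<omega>"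
  shows "AE \<omega> in M. (\<lambda>k. a k \<omega>) \<longlonglongrightarrow> 0"
proof -
  have B: "0 \<le> B" using g_bound[of 0 0] abs_ge_zero order_trans by blast
  obtain C where C: "0 \<le> C" "\<And>h x z. 0 \<le> h \<Longrightarrow> h \<le> 1 \<Longrightarrow> \<bar>z\<bar> \<le> B \<Longrightarrow> ((1 - h) * x + h * z) ^ (2 * m)
      \<le> (1 - h / 2) * x ^ (2 * m) + C * h ^ (m + 1) + real (2 * m) * ((1 - h) * x) ^ (2 * m - 1) * (h * z)"
    using even_moment_step[OF B m] by blast
  define V where "V k \<omega> = a k \<omega> ^ (2 * m)" for k \<omega>
  have a_F: "a k \<in> borel_measurable (filt M y k)" for k
  proof (induction k)
    case 0
    have "a 0 = (\<lambda>_. 0)" using a_0 by auto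
    then show ?case by simp
  next
    case (Suc k)
    have gy: "(\<lambda>\<omega>. g k (y (Suc k) \<omega>) \<omega>) \<in> borel_measurable (filt M y (Suc k))"
      by (rule measurable_compose_countable[OF measurable_filt_mono[OF g] measurable_y_filt]) auto
    have "a k \<in> borel_measurable (filt M y (Suc k))" by (rule measurable_filt_mono[OF Suc]) simp
    then have "(\<lambda>\<omega>. (1 - h k) * a k \<omega> + h k * g k (y (Suc k) \<omega>) \<omega>) \<in> borel_measurable (filt M y (Suc k))"
      using gy by measurable
    then show ?case by (simp add: a_Suc[abs_def])
  qed
  have a_bound: "\<bar>a k \<omega>\<bar> \<le> B" for k \<omega>
  proof (induction k)
    case 0 then show ?case using B by (simp add: a_0)
  next
    case (Suc k)
    have "\<bar>a (Suc k) \<omega>\<bar> \<le> (1 - h k) * \<bar>a k \<omega>\<bar> + h k * \<bar>g k (y (Suc k) \<omega>) \<omega>\<bar>"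
      unfolding a_Suc using h[of k] by (intro abs_triangle_ineq[THEN order_trans]) (simp add: abs_mult)
    also have "\<dots> \<le> (1 - h k) * B + h k * B"
      using Suc h[of k] g_bound by (intro add_mono mult_left_mono) auto
    finally show ?case by (simp add: algebra_simps)
  qed
  have V_F: "V k \<in> borel_measurable (filt M y k)" for k
    unfolding V_def using a_F by measurable
  have V_M [measurable]: "V k \<in> borel_measurable M" for k by (rule measurable_filt_imp[OF y_rv V_F])
  have gy_M [measurable]: "(\<lambda>\<omega>. g k (y (Suc k) \<omega>) \<omega>) \<in> borel_measurable M" for k
    by (rule measurable_compose_countable[OF measurable_filt_imp[OF y_rv g] y_rv]) auto
  have V_nonneg: "0 \<le> V k \<omega>" for k \<omega> unfolding V_def by (simp add: zero_le_even_power)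
  have V_bound: "V k \<omega> \<le> B ^ (2 * m)" for k \<omega>
    unfolding V_def using power_mono[OF a_bound[of k \<omega>], of "2 * m"] by (simp add: power_even_abs)
  have int_V: "integrable M (V k)" for k
    using V_nonneg V_bound by (intro integrable_const_bound[where B = "B ^ (2 * m)"]) auto
  have step: "expectation (\<lambda>\<omega>. indicator A \<omega> * V (Suc k) \<omega>)
      \<le> (1 - h k / 2) * expectation (\<lambda>\<omega>. indicator A \<omega> * V k \<omega>) + C * h k ^ (m + 1)"
    if A: "A \<in> sets (filt M y k)" for A k
  proof -
    have A_M [measurable]: "A \<in> sets M" using A sets_filt_subset[of y M k] y_rv by blast
    have int_AV: "integrable M (\<lambda>\<omega>. indicator A \<omega> * V j \<omega>)" for j
      using integrable_mult_indicator[OF A_M int_V] by simp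
    \<comment> \<open>The adapted factor of the noise in the linear Taylor term, restricted to
      \<open>A\<close>; \<open>expectation_next_zero\<close> then removes that term.\<close>
    define W where "W \<omega> = indicator A \<omega> * (real (2 * m) * ((1 - h k) * a k \<omega>) ^ (2 * m - 1) * h k)" for \<omega>
    have W_F: "W \<in> borel_measurable (filt M y k)" unfolding W_def using a_F A by measurable
    have W_bound: "\<bar>W \<omega>\<bar> \<le> real (2 * m) * B ^ (2 * m - 1)" for \<omega>
    proof -
      have "\<bar>(1 - h k) * a k \<omega>\<bar> \<le> B"
        unfolding abs_mult using h[of k] a_bound[of k \<omega>] B
        by (smt (verit) abs_ge_zero mult_left_le_one_le)
      then have "\<bar>(1 - h k) * a k \<omega>\<bar> ^ (2 * m - 1) \<le> B ^ (2 * m - 1)" by (intro power_mono) auto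
      then have "real (2 * m) * \<bar>(1 - h k) * a k \<omega>\<bar> ^ (2 * m - 1) * h k \<le> real (2 * m) * B ^ (2 * m - 1) * 1"
        using h[of k] B by (intro mult_mono mult_left_mono) auto
      moreover have "\<bar>W \<omega>\<bar> \<le> real (2 * m) * \<bar>(1 - h k) * a k \<omega>\<bar> ^ (2 * m - 1) * h k"
        unfolding W_def using h[of k] by (simp add: indicator_def abs_mult power_abs)
      ultimately show ?thesis by simp
    qed
    have Wg: "\<bar>W \<omega> * g k (y (Suc k) \<omega>) \<omega>\<bar> \<le> real (2 * m) * B ^ (2 * m - 1) * B" for \<omega>
      unfolding abs_mult using W_bound[of \<omega>] g_bound B by (intro mult_mono) auto
    have W_M [measurable]: "W \<in> borel_measurable M" by (rule measurable_filt_imp[OF y_rv W_F])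
    have int_Wg: "integrable M (\<lambda>\<omega>. W \<omega> * g k (y (Suc k) \<omega>) \<omega>)"
      using Wg by (intro integrable_const_bound[where B = "real (2 * m) * B ^ (2 * m - 1) * B"]) auto
    have zero: "expectation (\<lambda>\<omega>. W \<omega> * g k (y (Suc k) \<omega>) \<omega>) = 0"
      using y_rv y_unif y_indep N W_F W_bound g g_bound g_mean by (rule expectation_next_zero)
    have "expectation (\<lambda>\<omega>. indicator A \<omega> * V (Suc k) \<omega>)
        \<le> expectation (\<lambda>\<omega>. (1 - h k / 2) * (indicator A \<omega> * V k \<omega>) + C * h k ^ (m + 1)
            + W \<omega> * g k (y (Suc k) \<omega>) \<omega>)"
    proof (intro integral_mono Bochner_Integration.integrable_add integrable_mult_right int_AV int_Wg)
      fix \<omega>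
      have "V (Suc k) \<omega> \<le> (1 - h k / 2) * V k \<omega> + C * h k ^ (m + 1)
          + real (2 * m) * ((1 - h k) * a k \<omega>) ^ (2 * m - 1) * (h k * g k (y (Suc k) \<omega>) \<omega>)"
        unfolding V_def a_Suc using h g_bound by (intro C(2)) auto
      moreover have "0 \<le> C * h k ^ (m + 1)" using C(1) h by simp
      ultimately show "indicator A \<omega> * V (Suc k) \<omega> \<le> (1 - h k / 2) * (indicator A \<omega> * V k \<omega>)
          + C * h k ^ (m + 1) + W \<omega> * g k (y (Suc k) \<omega>) \<omega>"
        by (simp add: W_def indicator_def mult_ac)
    qed simp
    also have "\<dots> = (1 - h k / 2) * expectation (\<lambda>\<omega>. indicator A \<omega> * V k \<omega>) + C * h k ^ (m + 1)"
      using int_AV int_Wg zero by (simp add: prob_space)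
    finally show ?thesis .
  qed
  have mean: "(\<lambda>k. expectation (V k)) \<longlonglongrightarrow> 0"
  \<comment> \<open>The product of \<open>h k / 2\<close> and \<open>2 * C * h k ^ m\<close> is the
    error \<open>C * h k ^ (m + 1)\<close> of \<open>step\<close>; the second factor vanishes in the
    limit because \<open>1 \<le> m\<close>.\<close>
  proof (rule contraction_tendsto_zero[where H = "\<lambda>k. h k / 2" and \<epsilon> = "\<lambda>k. 2 * C * h k ^ m"])
    have "(\<lambda>k. h k / 2) \<longlonglongrightarrow> 0 / 2" using h_lim by (intro tendsto_divide tendsto_const) auto
    then show "(\<lambda>k. h k / 2) \<longlonglongrightarrow> 0" by simp
    have "(\<lambda>k. 2 * C * h k ^ m) \<longlonglongrightarrow> 2 * C * 0 ^ m" by (intro tendsto_intros h_lim)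
    then show "(\<lambda>k. 2 * C * h k ^ m) \<longlonglongrightarrow> 0" using m by (simp add: power_0_left)
    show "filterlim (\<lambda>n. \<Sum>i<n. h i / 2) at_top sequentially"
      using filterlim_tendsto_pos_mult_at_top[OF tendsto_const _ h_top, of "1 / 2"]
      by (simp add: sum_distrib_left)
    show "eventually (\<lambda>k. expectation (V (Suc k)) \<le> (1 - h k / 2) * expectation (V k)
        + h k / 2 * (2 * C * h k ^ m)) sequentially"
    proof (intro always_eventually allI)
      fix k
      have "space M \<in> sets (filt M y k)" using sets.top[of "filt M y k"] by simp
      moreover have "expectation (\<lambda>\<omega>. indicator (space M) \<omega> * V j \<omega>) = expectation (V j)" for j
        by (rule Bochner_Integration.integral_cong) auto
      ultimately show "expectation (V (Suc k)) \<le> (1 - h k / 2) * expectation (V k)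
          + h k / 2 * (2 * C * h k ^ m)"
        using step[of "space M" k] by (simp only: power_add power_one_right) (simp add: algebra_simps)
    qed
    show "0 \<le> expectation (V k)" for k using V_nonneg by (intro Bochner_Integration.integral_nonneg)
  qed (use h in auto)
  have "AE \<omega> in M. (\<lambda>k. V k \<omega>) \<longlonglongrightarrow> 0"
  \<comment> \<open>Here the contraction is dropped and only the summable error kept; the
    contraction has already served to send the mean to zero.\<close>
  proof (rule supermartingale_tendsto_zero[where F = "filt M y" and d = "\<lambda>k. C * h k ^ (m + 1)"])
    show "sets (filt M y k) \<subseteq> events" for k using y_rv by (rule sets_filt_subset)
    show "sets (filt M y k) \<subseteq> sets (filt M y l)" if "k \<le> l" for k l using that by (rule filt_mono)
    show "summable (\<lambda>k. C * h k ^ (m + 1))" using h_sum by (rule summable_mult)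
    fix k A assume A: "A \<in> sets (filt M y k)"
    have "0 \<le> expectation (\<lambda>\<omega>. indicator A \<omega> * V k \<omega>)"
      using V_nonneg by (intro Bochner_Integration.integral_nonneg) auto
    then have "(1 - h k / 2) * expectation (\<lambda>\<omega>. indicator A \<omega> * V k \<omega>) \<le> expectation (\<lambda>\<omega>. indicator A \<omega> * V k \<omega>)"
      using h[of k] by (intro mult_left_le_one_le) auto
    with step[OF A] show "expectation (\<lambda>\<omega>. indicator A \<omega> * V (Suc k) \<omega>)
        \<le> expectation (\<lambda>\<omega>. indicator A \<omega> * V k \<omega>) + C * h k ^ (m + 1)" by linarith
  qed (use C(1) h V_nonneg V_bound V_F mean in auto)
  then show ?thesis
  proof eventually_elim
    case (elim \<omega>)
    then have "(\<lambda>k. \<bar>a k \<omega>\<bar> ^ (2 * m)) \<longlonglongrightarrow> 0" by (simp add: V_def power_even_abs)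
    then have "(\<lambda>k. \<bar>a k \<omega>\<bar>) \<longlonglongrightarrow> 0" using m by (simp add: power_tendsto_0_iff)
    then show ?case by (rule tendsto_rabs_zero_cancel)
  qed
qed

end

section \<open>Hybrid sequence domains\<close>

text \<open>The jump times \<open>kk\<close> are nondecreasing, so a lower row ends no later than a
  higher one starts.\<close>

lemma compact_hs_dom_mono:
  assumes "compact_hs_dom E" "(k, j) \<in> E" "(k', j') \<in> E" "k < k'"
  shows "j \<le> j'"
proof (rule ccontr)
  assume "\<not> j \<le> j'"
  obtain J kk where kk: "\<And>j. j < J \<Longrightarrow> kk j \<le> kk (Suc j)" and E: "E = (\<Union>j<J. {kk j..kk (Suc j)} \<times> {j})"
    using assms(1) unfolding compact_hs_dom_def by blast
  from assms E have "j < J" "kk j \<le> k" "k' \<le> kk (Suc j')" by auto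
  moreover have "kk (Suc j') \<le> kk j"
  proof -
    have "kk (min (Suc j') J) \<le> kk (min j J)"
    \<comment> \<open>\<open>kk\<close> is known to be monotone only up to \<open>J\<close>; capping
      the index extends this to all indices.\<close>
    proof (rule lift_Suc_mono_le[where f = "\<lambda>i. kk (min i J)"])
      show "kk (min n J) \<le> kk (min (Suc n) J)" for n
        using kk[of n] by (cases "n < J") (auto simp: min_def)
    qed (use \<open>\<not> j \<le> j'\<close> in auto)
    then show ?thesis using \<open>\<not> j \<le> j'\<close> \<open>j < J\<close> by (simp add: min_def)
  qed
  ultimately show False using assms(4) by simp
qed

text \<open>A point past the jump time \<open>kk j\<close> is preceded by a flow step; a point at
  \<open>kk j\<close> is reached by a jump from the end of the previous row.\<close>

lemma compact_hs_dom_pred: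
  assumes "compact_hs_dom E" "(k, j) \<in> E" "(k, j) \<noteq> (0, 0)"
  shows "(\<exists>k'. k = Suc k' \<and> (k', j) \<in> E) \<or> (\<exists>j'. j = Suc j' \<and> (k, j') \<in> E)"
proof -
  obtain J kk where kk0: "kk 0 = 0" and kk: "\<And>j. j < J \<Longrightarrow> kk j \<le> kk (Suc j)"
    and E: "E = (\<Union>j<J. {kk j..kk (Suc j)} \<times> {j})"
    using assms(1) unfolding compact_hs_dom_def by blast
  from assms(2) E have j: "j < J" "kk j \<le> k" "k \<le> kk (Suc j)" by auto
  show ?thesis
  proof (cases "kk j < k")
    case True
    then obtain k' where "k = Suc k'" by (cases k) auto
    with True j show ?thesis by (auto simp: E)
  next
    case False
    with j have k: "k = kk j" by simp
    then obtain j' where j': "j = Suc j'" using assms(3) kk0 by (cases j) auto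
    then have "(k, j') \<in> E" using j kk[of j'] k by (auto simp: E)
    with j' show ?thesis by blast
  qed
qed

locale complete_hs_dom =
  fixes E :: "(nat \<times> nat) set"
  assumes dom: "hs_dom E" and complete: "hs_complete E"
begin

lemma dom_mono:
  assumes "(k, j) \<in> E" "(k', j') \<in> E" "k < k'"
  shows "j \<le> j'"
proof -
  obtain Es where Es: "\<And>i. compact_hs_dom (Es i)" "incseq Es" "E = (\<Union>i. Es i)"
    using dom unfolding hs_dom_def by blast
  obtain i where i: "(k, j) \<in> Es i" using assms(1) unfolding Es(3) by blast
  moreover obtain i' where i': "(k', j') \<in> Es i'" using assms(2) unfolding Es(3) by blast
  moreover have "Es i \<subseteq> Es (max i i')" "Es i' \<subseteq> Es (max i i')"
    by (rule incseqD[OF Es(2)], simp)+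
  ultimately have "(k, j) \<in> Es (max i i')" "(k', j') \<in> Es (max i i')" by (auto dest: subsetD)
  then show ?thesis using compact_hs_dom_mono[OF Es(1)] assms(3) by metis
qed

lemma dom_pred:
  assumes "(k, j) \<in> E" "(k, j) \<noteq> (0, 0)"
  shows "(\<exists>k'. k = Suc k' \<and> (k', j) \<in> E) \<or> (\<exists>j'. j = Suc j' \<and> (k, j') \<in> E)"
proof -
  obtain Es where Es: "\<And>i. compact_hs_dom (Es i)" "incseq Es" "E = (\<Union>i. Es i)"
    using dom unfolding hs_dom_def by blast
  obtain i where i: "(k, j) \<in> Es i" using assms(1) unfolding Es(3) by blast
  have "Es i \<subseteq> E" unfolding Es(3) by blast
  with compact_hs_dom_pred[OF Es(1) i assms(2)] show ?thesis by (auto dest: subsetD)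
qed

lemma dom_unique:
  assumes "(k, j) \<in> E" "(k', j') \<in> E" "k + j = k' + j'"
  shows "k = k' \<and> j = j'"
proof (cases k k' rule: linorder_cases)
  case less
  with dom_mono[OF assms(1,2)] assms(3) show ?thesis by simp
next
  case greater
  with dom_mono[OF assms(2,1)] assms(3) show ?thesis by simp
qed (use assms(3) in simp)

text \<open>Completeness supplies a point far out, and descending through predecessors lowers
  \<open>k + j\<close> by one at a time. Together with \<open>dom_unique\<close> this orders the
  domain linearly.\<close>

lemma dom_exists: "\<exists>k j. (k, j) \<in> E \<and> k + j = n"
proof -
  have "\<exists>k j. (k, j) \<in> E \<and> k + j = n" if "(k, j) \<in> E" "n \<le> k + j" "d = k + j - n" for k j d
    using that
  proof (induction d arbitrary: k j)
    case 0
    then have "k + j = n" by simp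
    with 0 show ?case by blast
  next
    case (Suc d)
    then have "(k, j) \<noteq> (0, 0)" by auto
    from dom_pred[OF Suc.prems(1) this] show ?case
    proof (elim disjE exE conjE)
      fix k' assume "k = Suc k'" "(k', j) \<in> E"
      with Suc.prems show ?case by (intro Suc.IH[of k' j]) auto
    next
      fix j' assume "j = Suc j'" "(k, j') \<in> E"
      with Suc.prems show ?case by (intro Suc.IH[of k j']) auto
    qed
  qed
  moreover obtain k j where "(k, j) \<in> E" "n < k + j" using complete unfolding hs_complete_def by blast
  ultimately show ?thesis using less_imp_le[OF \<open>n < k + j\<close>] by simp
qed

text \<open>The domain is traversed by the sequence of its points \<open>(K n, J n)\<close> with \<open>K n + J n = n\<close>;
  this puts flow steps and jumps on a common index.\<close>
definition "pt n = (SOME z. z \<in> E \<and> fst z + snd z = n)"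
definition "K n = fst (pt n)"
definition "J n = snd (pt n)"
definition "flow n \<longleftrightarrow> K (Suc n) = Suc (K n)"

lemma pt: "(K n, J n) \<in> E" "K n + J n = n"
proof -
  have "\<exists>z. z \<in> E \<and> fst z + snd z = n" using dom_exists[of n] by force
  then have "pt n \<in> E \<and> fst (pt n) + snd (pt n) = n" unfolding pt_def by (rule someI_ex)
  then show "(K n, J n) \<in> E" "K n + J n = n" by (simp_all add: K_def J_def)
qed

lemma pt_eq:
  assumes "(k, j) \<in> E"
  shows "K (k + j) = k" and "J (k + j) = j"
  using dom_unique[OF pt(1) assms pt(2)] by (rule conjunct1, rule conjunct2)

lemma step_cases:
  "(flow n \<and> K (Suc n) = Suc (K n) \<and> J (Suc n) = J n) \<or> (\<not> flow n \<and> K (Suc n) = K n \<and> J (Suc n) = Suc (J n))"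
proof -
  have "(K (Suc n), J (Suc n)) \<noteq> (0, 0)" using pt(2)[of "Suc n"] by auto
  from dom_pred[OF pt(1) this] show ?thesis
  proof (elim disjE exE conjE)
    fix k' assume k': "K (Suc n) = Suc k'" "(k', J (Suc n)) \<in> E"
    then have "k' + J (Suc n) = n" using pt(2)[of "Suc n"] by simp
    with pt_eq[OF k'(2)] k'(1) show ?thesis by (simp add: flow_def)
  next
    fix j' assume j': "J (Suc n) = Suc j'" "(K (Suc n), j') \<in> E"
    then have "K (Suc n) + j' = n" using pt(2)[of "Suc n"] by simp
    with pt_eq[OF j'(2)] j'(1) show ?thesis by (simp add: flow_def)
  qed
qed

lemma K_flow: "flow n \<Longrightarrow> K (Suc n) = Suc (K n)"
  by (simp add: flow_def)

lemma J_flow: "flow n \<Longrightarrow> J (Suc n) = J n"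
  using step_cases[of n] by meson

lemma K_jump: "\<not> flow n \<Longrightarrow> K (Suc n) = K n"
  using step_cases[of n] by meson

lemma J_jump: "\<not> flow n \<Longrightarrow> J (Suc n) = Suc (J n)"
  using step_cases[of n] by meson

lemma K_mono:
  assumes "n \<le> n'"
  shows "K n \<le> K n'"
proof (rule lift_Suc_mono_le[of K])
  show "K i \<le> K (Suc i)" for i using step_cases[of i] by auto
qed (rule assms)

lemma flow_sum: "(\<Sum>i<n. if flow i then h (Suc (K i)) else 0) = (\<Sum>i<K n. h (Suc i))"
  for h :: "nat \<Rightarrow> real"
proof (induction n)
  case 0
  have "K 0 = 0" using pt(2)[of 0] by simp
  then show ?case by simp
next
  case (Suc n)
  then show ?case by (cases "flow n") (simp_all add: K_flow K_jump)
qed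

text \<open>Two points with equal \<open>k\<close> are joined by jumps alone, because
  \<open>K\<close> is monotone along the traversal. The intended \<open>f\<close> is the position,
  which jumps leave fixed.\<close>

lemma jump_invariant_eq:
  assumes "\<And>k j. (k, j) \<in> E \<Longrightarrow> (k, Suc j) \<in> E \<Longrightarrow> f k (Suc j) = f k j"
    and "(k, j) \<in> E" "(k, j') \<in> E"
  shows "f k j = f k j'"
proof -
  have *: "f (K (n + d)) (J (n + d)) = f (K n) (J n)" if "K (n + d) = K n" for n d
    using that
  proof (induction d)
    case (Suc d)
    have "K n \<le> K (n + d)" "K (n + d) \<le> K (Suc (n + d))" by (rule K_mono, simp)+
    with Suc.prems have eq: "K (n + d) = K n" "\<not> flow (n + d)" by (auto simp: flow_def)
    have "f (K (n + d)) (Suc (J (n + d))) = f (K (n + d)) (J (n + d))"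
      by (rule assms(1)[OF pt(1) pt(1)[of "Suc (n + d)", unfolded K_jump[OF eq(2)] J_jump[OF eq(2)]]])
    with Suc.IH[OF eq(1)] K_jump[OF eq(2)] J_jump[OF eq(2)] show ?case by simp
  qed simp
  show ?thesis
  proof (cases "j \<le> j'")
    case True
    then show ?thesis using *[of "k + j" "j' - j"] pt_eq[OF assms(2)] pt_eq[OF assms(3)] by simp
  next
    case False
    then show ?thesis using *[of "k + j'" "j - j'"] pt_eq[OF assms(2)] pt_eq[OF assms(3)] by simp
  qed
qed

text \<open>As \<open>jbar E k\<close> is the least row meeting column \<open>Suc k\<close>, its
  point in that column cannot be reached by a jump; hence the flow step from \<open>k\<close>
  happens in this row.\<close>

lemma jbar_in:
  assumes "\<exists>j. (Suc k, j) \<in> E"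
  shows "(k, jbar E k) \<in> E" "(Suc k, jbar E k) \<in> E"
proof -
  show 1: "(Suc k, jbar E k) \<in> E" unfolding jbar_def using LeastI_ex[of "\<lambda>j. (Suc k, j) \<in> E", OF assms] .
  have "(Suc k, j) \<notin> E" if "jbar E k = Suc j" for j
    using not_less_Least[of j "\<lambda>j. (Suc k, j) \<in> E", folded jbar_def] that by auto
  with dom_pred[OF 1] show "(k, jbar E k) \<in> E" by auto
qed

lemma dom_row:
  assumes "(k, j') \<in> E" "j \<le> j'"
  shows "\<exists>k. (k, j) \<in> E"
  using assms
proof (induction "k + j'" arbitrary: k j' rule: less_induct)
  case less
  show ?case
  proof (cases "j = j'")
    case True
    then show ?thesis using less.prems by blast
  next
    case False
    then have "(k, j') \<noteq> (0, 0)" using less.prems by auto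
    from dom_pred[OF less.prems(1) this] show ?thesis
    proof (elim disjE exE conjE)
      fix k' assume "k = Suc k'" "(k', j') \<in> E"
      then show ?thesis using less.hyps[of k' j'] less.prems by simp
    next
      fix j'' assume "j' = Suc j''" "(k, j'') \<in> E"
      then show ?thesis using less.hyps[of k j''] less.prems False by simp
    qed
  qed
qed

lemma kbar_in:
  assumes "\<exists>k. (k, Suc j) \<in> E"
  shows "(kbar E j, j) \<in> E" "(kbar E j, Suc j) \<in> E"
proof -
  show 1: "(kbar E j, Suc j) \<in> E" unfolding kbar_def using LeastI_ex[of "\<lambda>k. (k, Suc j) \<in> E", OF assms] .
  have "(k, Suc j) \<notin> E" if "kbar E j = Suc k" for k
    using not_less_Least[of k "\<lambda>k. (k, Suc j) \<in> E", folded kbar_def] that by auto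
  with dom_pred[OF 1] show "(kbar E j, j) \<in> E" by auto
qed

end

section \<open>Simulations with vanishing tracking error\<close>

lemma closed_C_S: "closed (C_S T)"
proof -
  have eq: "C_S T = {z. inner (snd z) (fst (snd (fst z))) \<le> 0 \<and> T \<le> snd (snd (fst z))} \<union> {z. snd (snd (fst z)) \<le> T}"
    by (auto simp: C_S_def)
  show ?thesis
    unfolding eq by (intro closed_Un closed_Collect_conj closed_Collect_le continuous_intros)
qed

lemma closed_D_S: "closed (D_S T)"
proof -
  have eq: "D_S T = {z. 0 \<le> inner (snd z) (fst (snd (fst z))) \<and> T \<le> snd (snd (fst z))}"
    by (auto simp: D_S_def)
  show ?thesis
    unfolding eq by (intro closed_Un closed_Collect_conj closed_Collect_le continuous_intros)
qed

lemma C_S_iff: "(c, g (fst c)) \<in> C_S T \<longleftrightarrow> c \<in> C_HB g T"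
  by (cases c) (auto simp: C_S_def C_HB_def)

lemma D_S_iff: "(c, g (fst c)) \<in> D_S T \<longleftrightarrow> c \<in> D_HB g T"
  by (cases c) (auto simp: D_S_def D_HB_def)

text \<open>\<open>GREATEST\<close> is meaningful only on a bounded nonempty set: divergence of the
  step sums gives the bound, and \<open>n\<close> is a member.\<close>

lemma tau_seq_m_fun:
  assumes "admissible h" "tau_seq h n \<le> t" "k \<le> m_fun h t"
  shows "tau_seq h k \<le> t"
proof -
  have mono: "tau_seq h i \<le> tau_seq h j" if "i \<le> j" for i j
    unfolding tau_seq_def using assms(1) that by (intro sum_mono2) (auto simp: admissible_def less_imp_le)
  have "filterlim (tau_seq h) at_top sequentially"
    using assms(1) by (simp add: admissible_def tau_seq_def[abs_def])
  then have "eventually (\<lambda>k. t < tau_seq h k) sequentially" by (simp add: filterlim_at_top_dense)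
  then obtain b where b: "\<And>k. k \<ge> b \<Longrightarrow> t < tau_seq h k" unfolding eventually_sequentially by blast
  have "tau_seq h (m_fun h t) \<le> t"
    unfolding m_fun_def
  proof (rule GreatestI_nat[where P = "\<lambda>k. tau_seq h k \<le> t"])
    show "i \<le> b" if "tau_seq h i \<le> t" for i using b[of i] that by (meson not_le nle_le)
  qed (rule assms(2))
  with mono[OF assms(3)] show ?thesis by linarith
qed

text \<open>One fixed realisation. \<open>noise k\<close> is the deviation of the sampled gradient
  from \<open>g\<close>, and \<open>a\<close> is that noise after the linear filter of the fast
  variable; all that probability has to supply is \<open>a_lim\<close>. The truncation
  \<open>min 1 (hf (Suc k))\<close> is inactive from some index on.\<close>

locale sim_path = complete_hs_dom E for E +
  fixes \<Psi> :: "'a::euclidean_space \<Rightarrow> real" and g :: "'a \<Rightarrow> 'a" and L \<kappa> T :: real and qmin :: 'a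
    and X :: "nat \<Rightarrow> nat \<Rightarrow> ('a \<times> 'a \<times> real) \<times> 'a" and hs hf :: "nat \<Rightarrow> real" and noise a :: "nat \<Rightarrow> 'a"
  assumes grad: "\<And>x. GDERIV \<Psi> x :> g x"
    and lip: "lipschitz_on L UNIV g" and L: "1 \<le> L"
    and minimal: "\<And>x. \<Psi> qmin \<le> \<Psi> x"
    and crit: "\<And>x. g x = 0 \<Longrightarrow> \<Psi> x = \<Psi> qmin"
    and \<kappa>: "0 < \<kappa>" and T: "0 < T"
    and two_ts: "two_timescale_admissible hs hf"
    and bdd: "hs_bounded E X"
    and flow_eq: "\<And>k j. (k, j) \<in> E \<Longrightarrow> (Suc k, j) \<in> E \<Longrightarrow> X k j \<in> C_S T
      \<and> fst (X (Suc k) j) = fst (X k j) + hs (Suc k) *\<^sub>R F_HB \<kappa> T (fst (X k j)) (snd (X k j))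
      \<and> snd (X (Suc k) j) = snd (X k j) + hf (Suc k) *\<^sub>R (g (fst (fst (X k j))) + noise k - snd (X k j))"
    and jump_eq: "\<And>k j. (k, j) \<in> E \<Longrightarrow> (k, Suc j) \<in> E \<Longrightarrow> X k j \<in> D_S T
      \<and> fst (X k (Suc j)) = G_HB (fst (X k j)) \<and> snd (X k (Suc j)) = snd (X k j)"
    and a_Suc: "\<And>k. a (Suc k) = (1 - min 1 (hf (Suc k))) *\<^sub>R a k + min 1 (hf (Suc k)) *\<^sub>R noise k"
    and a_lim: "a \<longlonglongrightarrow> 0"
begin

section \<open>The path along the traversal of its domain\<close>

definition "Z n = X (K n) (J n)"
definition "q n = fst (fst (Z n))"
definition "p n = fst (snd (fst (Z n)))"
definition "\<tau> n = snd (snd (fst (Z n)))"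
definition "\<xi> n = snd (Z n)"
definition "H n = (if flow n then hs (Suc (K n)) else 0)"
definition "Hf n = (if flow n then hf (Suc (K n)) else 0)"

lemma Z_eq: "Z n = ((q n, p n, \<tau> n), \<xi> n)"
  by (simp add: q_def p_def \<tau>_def \<xi>_def)

lemma hs: "admissible hs" and hf: "admissible hf" and ratio: "(\<lambda>k. hs k / hf k) \<longlonglongrightarrow> 0"
  using two_ts by (auto simp: two_timescale_admissible_def)

lemma hs_pos: "0 < hs (Suc k)"
  using hs by (simp add: admissible_def)

lemma hf_pos: "0 < hf (Suc k)"
  using hf by (simp add: admissible_def)

lemma flow_Z:
  assumes "flow n"
  shows "Z n \<in> C_S T" "q (Suc n) = q n + H n *\<^sub>R p n"
    "p (Suc n) = p n + H n *\<^sub>R (- (\<kappa> *\<^sub>R p n) - \<xi> n)"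
    "\<tau> (Suc n) = \<tau> n + H n * min 1 (2 - \<tau> n / T)"
    "\<xi> (Suc n) = \<xi> n + Hf n *\<^sub>R (g (q n) + noise (K n) - \<xi> n)"
proof -
  have "(K n, J n) \<in> E" "(Suc (K n), J n) \<in> E"
    using pt(1)[of n] pt(1)[of "Suc n"] K_flow[OF assms] J_flow[OF assms] by auto
  from flow_eq[OF this] have Z: "Z n \<in> C_S T"
    "fst (Z (Suc n)) = fst (Z n) + H n *\<^sub>R F_HB \<kappa> T (fst (Z n)) (snd (Z n))"
    "snd (Z (Suc n)) = snd (Z n) + Hf n *\<^sub>R (g (fst (fst (Z n))) + noise (K n) - snd (Z n))"
    using K_flow[OF assms] J_flow[OF assms] assms by (auto simp: Z_def H_def Hf_def)
  show "Z n \<in> C_S T" by (rule Z(1))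
  show "q (Suc n) = q n + H n *\<^sub>R p n"
    "p (Suc n) = p n + H n *\<^sub>R (- (\<kappa> *\<^sub>R p n) - \<xi> n)"
    "\<tau> (Suc n) = \<tau> n + H n * min 1 (2 - \<tau> n / T)"
    "\<xi> (Suc n) = \<xi> n + Hf n *\<^sub>R (g (q n) + noise (K n) - \<xi> n)"
    using Z(2,3) unfolding Z_eq by (simp_all add: F_HB_def)
qed

lemma jump_Z:
  assumes "\<not> flow n"
  shows "Z n \<in> D_S T" "q (Suc n) = q n" "p (Suc n) = 0" "\<tau> (Suc n) = 0" "\<xi> (Suc n) = \<xi> n"
    "0 \<le> inner (\<xi> n) (p n)" "T \<le> \<tau> n"
proof -
  have "(K n, J n) \<in> E" "(K n, Suc (J n)) \<in> E"
    using pt(1)[of n] pt(1)[of "Suc n"] K_jump[OF assms] J_jump[OF assms] by auto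
  from jump_eq[OF this] have Z: "Z n \<in> D_S T" "fst (Z (Suc n)) = G_HB (fst (Z n))" "snd (Z (Suc n)) = snd (Z n)"
    using K_jump[OF assms] J_jump[OF assms] by (auto simp: Z_def)
  show "Z n \<in> D_S T" by (rule Z(1))
  show "q (Suc n) = q n" "p (Suc n) = 0" "\<tau> (Suc n) = 0" "\<xi> (Suc n) = \<xi> n"
    using Z(2,3) unfolding Z_eq by (simp_all add: G_HB_def)
  show "0 \<le> inner (\<xi> n) (p n)" "T \<le> \<tau> n"
    using Z(1) unfolding Z_eq by (simp_all add: D_S_def)
qed

text \<open>A jump resets the timer to \<open>0 < T\<close>, hence no two consecutive steps are jumps.\<close>
lemma K_top: "filterlim K at_top sequentially"
proof -
  have two: "Suc (K n) \<le> K (Suc (Suc n))" for n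
  proof (cases "flow n")
    case True
    then show ?thesis using K_flow[OF True] K_mono[of "Suc n" "Suc (Suc n)"] by simp
  next
    case False
    then have "flow (Suc n)" using jump_Z(4)[OF False] jump_Z(7)[of "Suc n"] T by fastforce
    then show ?thesis using K_flow[of "Suc n"] K_mono[of n "Suc n"] by simp
  qed
  have div_le: "n div 2 \<le> K n" for n
  proof (induction n rule: induct_nat_012)
    case (ge2 n)
    then show ?case using two[of n] by simp
  qed auto
  have "filterlim (\<lambda>n::nat. n div 2) at_top sequentially"
    unfolding filterlim_at_top
  proof
    fix m :: nat
    show "eventually (\<lambda>n. m \<le> n div 2) sequentially"
      using eventually_ge_at_top[of "2 * m"] by eventually_elim simp
  qed
  then show ?thesis by (rule filterlim_at_top_mono) (simp add: div_le)
qed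

text \<open>\<open>K\<close> starts at \<open>0\<close>, rises by at most one per step and is
  unbounded, so no value is skipped.\<close>

lemma point_above: "\<exists>j. (Suc k, j) \<in> E"
proof -
  have "eventually (\<lambda>n. Suc k \<le> K n) sequentially" using K_top by (simp add: filterlim_at_top)
  then obtain n where n: "Suc k \<le> K n" unfolding eventually_sequentially by blast
  have "\<exists>n. Suc k = K n"
  proof -
    define n0 where "n0 = (LEAST n. Suc k \<le> K n)"
    have ge: "Suc k \<le> K n0" unfolding n0_def using n by (rule LeastI)
    have "K 0 = 0" using pt(2)[of 0] by simp
    then obtain i where i: "n0 = Suc i" using ge by (cases n0) auto
    have "\<not> Suc k \<le> K i" using not_less_Least[of i "\<lambda>n. Suc k \<le> K n", folded n0_def] i by simp
    then have "Suc k = K n0" using ge i K_flow[of i] K_jump[of i] by (cases "flow i") auto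
    then show ?thesis by blast
  qed
  then show ?thesis using pt(1) by metis
qed

text \<open>The traversal index of the flow step that leaves column \<open>k\<close>.\<close>

definition "nk k = k + jbar E k"

lemma nk: "flow (nk k)" "K (nk k) = k" "J (nk k) = jbar E k" "k \<le> nk k"
  "Z (nk k) = X k (jbar E k)" "Z (Suc (nk k)) = X (Suc k) (jbar E k)"
proof -
  note in_E = jbar_in[OF point_above[of k]]
  show 1: "K (nk k) = k" "J (nk k) = jbar E k" using pt_eq[OF in_E(1)] by (auto simp: nk_def)
  have 2: "K (Suc (nk k)) = Suc k" "J (Suc (nk k)) = jbar E k" using pt_eq[OF in_E(2)] by (auto simp: nk_def)
  show "flow (nk k)" using 1 2 by (simp add: flow_def)
  show "k \<le> nk k" by (simp add: nk_def)
  show "Z (nk k) = X k (jbar E k)" "Z (Suc (nk k)) = X (Suc k) (jbar E k)" using 1 2 by (simp_all add: Z_def)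
qed

lemma nk_top: "filterlim nk at_top sequentially"
  by (rule filterlim_at_top_mono[OF filterlim_ident]) (simp add: nk(4))

lemma sum_flow_top:
  assumes "admissible h"
  shows "filterlim (\<lambda>n. \<Sum>i<n. if flow i then h (Suc (K i)) else 0) at_top sequentially"
proof -
  have "filterlim (\<lambda>n. \<Sum>i<n. h (Suc i)) at_top sequentially" using assms by (simp add: admissible_def)
  from filterlim_compose[OF this K_top] show ?thesis by (simp only: flow_sum)
qed

lemma flow_tendsto_zero:
  fixes h :: "nat \<Rightarrow> real"
  assumes "h \<longlonglongrightarrow> 0"
  shows "(\<lambda>n. if flow n then h (Suc (K n)) else 0) \<longlonglongrightarrow> 0"
proof (rule tendsto_0_le[where K = 1])
  show "(\<lambda>n. h (Suc (K n))) \<longlonglongrightarrow> 0"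
    by (rule filterlim_compose[OF LIMSEQ_Suc[OF assms] K_top])
qed auto

lemma bound: obtains R where "\<And>n. norm (Z n) \<le> R"
proof -
  obtain R where R: "\<And>z. z \<in> (\<lambda>(k, j). X k j) ` E \<Longrightarrow> norm z \<le> R"
    using bdd unfolding hs_bounded_def bounded_iff by blast
  have "Z n \<in> (\<lambda>(k, j). X k j) ` E" for n
    unfolding Z_def using pt(1)[of n] by (intro rev_image_eqI[of "(K n, J n)"]) auto
  with R show ?thesis by (intro that) blast
qed

lemma component_bounds:
  assumes "norm (Z n) \<le> R"
  shows "norm (q n) \<le> R" and "norm (p n) \<le> R" and "\<bar>\<tau> n\<bar> \<le> R" and "norm (\<xi> n) \<le> R"
proof -
  have fst: "norm (fst (Z n)) \<le> R" using norm_fst_le[of "fst (Z n)" "snd (Z n)"] assms by simp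
  then show "norm (q n) \<le> R" unfolding q_def
    using norm_fst_le[of "fst (fst (Z n))" "snd (fst (Z n))"] by simp
  have snd: "norm (snd (fst (Z n))) \<le> R"
    using norm_snd_le[of "snd (fst (Z n))" "fst (fst (Z n))"] fst by simp
  then show "norm (p n) \<le> R" unfolding p_def
    using norm_fst_le[of "fst (snd (fst (Z n)))" "snd (snd (fst (Z n)))"] by simp
  from snd show "\<bar>\<tau> n\<bar> \<le> R" unfolding \<tau>_def
    using norm_snd_le[of "snd (snd (fst (Z n)))" "fst (snd (fst (Z n)))"] by simp
  show "norm (\<xi> n) \<le> R" unfolding \<xi>_def
    using norm_snd_le[of "snd (Z n)" "fst (Z n)"] assms by simp
qed

text \<open>Up to the filtered noise \<open>a\<close>, the error of the fast variable contracts at the rate of the fast step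
  size, while \<open>g (q n)\<close> drifts at the rate of the slow one.\<close>
lemma fast_error: "(\<lambda>n. \<xi> n - g (q n)) \<longlonglongrightarrow> 0"
proof -
  obtain R where R: "\<And>n. norm (Z n) \<le> R" using bound by blast
  \<comment> \<open>Subtracting \<open>a\<close> cancels the noise, because \<open>\<xi>\<close> and
    \<open>a\<close> obey the same linear filter once \<open>Hf n < 1\<close> makes the truncation
    inactive.\<close>
  define e where "e n = \<xi> n - g (q n) - a (K n)" for n
  have hf0: "hf \<longlonglongrightarrow> 0" using hf by (simp add: admissible_def)
  have Hf0: "Hf \<longlonglongrightarrow> 0" unfolding Hf_def[abs_def] by (rule flow_tendsto_zero[OF hf0])
  have "(\<lambda>n. norm (e n)) \<longlonglongrightarrow> 0"
  \<comment> \<open>A flow step moves \<open>q\<close> by at most \<open>R\<close> times the slow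
    step size, hence \<open>g (q n)\<close> by at most \<open>L * R\<close> times it. Dividing by
    the fast step size produces the ratio that tends to zero. On jumps \<open>Hf n = 0\<close> and
    the error is unchanged.\<close>
  proof (rule contraction_tendsto_zero[where H = Hf and \<epsilon> = "\<lambda>n. L * R * (hs (Suc (K n)) / hf (Suc (K n)))"])
    have "(\<lambda>n. hs (Suc (K n)) / hf (Suc (K n))) \<longlonglongrightarrow> 0"
      by (rule filterlim_compose[OF LIMSEQ_Suc[OF ratio] K_top])
    then have "(\<lambda>n. L * R * (hs (Suc (K n)) / hf (Suc (K n)))) \<longlonglongrightarrow> L * R * 0" by (intro tendsto_intros)
    then show "(\<lambda>n. L * R * (hs (Suc (K n)) / hf (Suc (K n)))) \<longlonglongrightarrow> 0" by simp
    show "0 \<le> Hf n" for n using hf_pos by (simp add: Hf_def less_imp_le)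
    show "filterlim (\<lambda>n. \<Sum>i<n. Hf i) at_top sequentially"
      unfolding Hf_def using hf by (rule sum_flow_top)
    have "eventually (\<lambda>n. Hf n < 1) sequentially" using Hf0 by (rule order_tendstoD) simp
    then show "eventually (\<lambda>n. norm (e (Suc n)) \<le> (1 - Hf n) * norm (e n)
        + Hf n * (L * R * (hs (Suc (K n)) / hf (Suc (K n))))) sequentially"
    proof eventually_elim
      case (elim n)
      show ?case
      proof (cases "flow n")
        case True
        then have Hf: "Hf n = hf (Suc (K n))" and H: "H n = hs (Suc (K n))" by (auto simp: Hf_def H_def)
        have "e (Suc n) = (1 - Hf n) *\<^sub>R e n + (g (q n) - g (q (Suc n)))"
          unfolding e_def flow_Z(5)[OF True] K_flow[OF True] a_Suc
          using elim by (simp add: Hf algebra_simps)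
        then have "norm (e (Suc n)) \<le> (1 - Hf n) * norm (e n) + norm (g (q n) - g (q (Suc n)))"
          using elim by (metis abs_of_pos diff_gt_0_iff_gt norm_scaleR norm_triangle_ineq)
        also have "norm (g (q n) - g (q (Suc n))) \<le> L * norm (q n - q (Suc n))"
          using lipschitz_onD[OF lip, of "q n" "q (Suc n)"] by (simp add: dist_norm)
        also have "norm (q n - q (Suc n)) \<le> hs (Suc (K n)) * R"
          unfolding flow_Z(2)[OF True] using hs_pos[of "K n"] component_bounds(2)[OF R]
          by (simp add: H mult_left_mono)
        also have "L * (hs (Suc (K n)) * R) = Hf n * (L * R * (hs (Suc (K n)) / hf (Suc (K n))))"
          using hf_pos[of "K n"] by (simp add: Hf)
        finally show ?thesis using L by simp
      next
        case False
        then show ?thesis using jump_Z[OF False] K_jump[OF False] by (simp add: e_def Hf_def)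
      qed
    qed
  qed (use Hf0 in auto)
  then have "e \<longlonglongrightarrow> 0" by (rule tendsto_norm_zero_cancel)
  moreover have "(\<lambda>n. a (K n)) \<longlonglongrightarrow> 0" by (rule filterlim_compose[OF a_lim K_top])
  ultimately have "(\<lambda>n. e n + a (K n)) \<longlonglongrightarrow> 0 + 0" by (rule tendsto_add)
  then show ?thesis by (simp add: e_def)
qed

text \<open>In the limit the fast variable becomes the gradient, so that membership in the closed
  sets \<open>C_S\<close> and \<open>D_S\<close> turns into membership in \<open>C_HB\<close> and
  \<open>D_HB\<close>.\<close>

lemma limit_graph:
  assumes "filterlim m at_top sequentially" "(\<lambda>i. fst (Z (m i))) \<longlonglongrightarrow> c"
  shows "(\<lambda>i. (fst (Z (m i)), \<xi> (m i))) \<longlonglongrightarrow> (c, g (fst c))"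
proof -
  have cg: "continuous_on UNIV g" using lip by (rule lipschitz_on_continuous_on)
  have "(\<lambda>i. q (m i)) \<longlonglongrightarrow> fst c" unfolding q_def using assms(2) by (rule tendsto_fst)
  then have "(\<lambda>i. g (q (m i))) \<longlonglongrightarrow> g (fst c)" by (rule continuous_on_tendsto_compose[OF cg]) auto
  moreover have "(\<lambda>i. \<xi> (m i) - g (q (m i))) \<longlonglongrightarrow> 0" by (rule filterlim_compose[OF fast_error assms(1)])
  ultimately have "(\<lambda>i. (\<xi> (m i) - g (q (m i))) + g (q (m i))) \<longlonglongrightarrow> 0 + g (fst c)" by (intro tendsto_add)
  then show ?thesis using assms(2) by (intro tendsto_Pair) simp_all
qed

lemma limit_C:
  assumes "filterlim m at_top sequentially" "(\<lambda>i. fst (Z (m i))) \<longlonglongrightarrow> c" "\<And>i. flow (m i)"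
  shows "c \<in> C_HB g T"
proof -
  have mem: "(fst (Z (m i)), \<xi> (m i)) \<in> C_S T" for i using flow_Z(1)[OF assms(3)[of i]] by (simp add: \<xi>_def)
  have "(c, g (fst c)) \<in> C_S T"
    by (rule closed_sequentially[OF closed_C_S mem limit_graph[OF assms(1,2)]])
  then show ?thesis by (simp add: C_S_iff)
qed

lemma limit_D:
  assumes "filterlim m at_top sequentially" "(\<lambda>i. fst (Z (m i))) \<longlonglongrightarrow> c" "\<And>i. \<not> flow (m i)"
  shows "c \<in> D_HB g T"
proof -
  have mem: "(fst (Z (m i)), \<xi> (m i)) \<in> D_S T" for i using jump_Z(1)[OF assms(3)[of i]] by (simp add: \<xi>_def)
  have "(c, g (fst c)) \<in> D_S T"
    by (rule closed_sequentially[OF closed_D_S mem limit_graph[OF assms(1,2)]])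
  then show ?thesis by (simp add: D_S_iff)
qed

lemma continuous_Fflow: "continuous_on UNIV (Fflow_HB \<kappa> T g)"
proof -
  have "continuous_on UNIV g" using lip by (rule lipschitz_on_continuous_on)
  then have cgf: "continuous_on UNIV (\<lambda>z::'a \<times> 'a \<times> real. g (fst z))"
    by (rule continuous_on_compose2) (auto intro: continuous_intros)
  have eq: "Fflow_HB \<kappa> T g = (\<lambda>z. (fst (snd z), - (\<kappa> *\<^sub>R fst (snd z)) - g (fst z), min 1 (2 - snd (snd z) / T)))"
    by (auto simp: Fflow_HB_def F_HB_def)
  show ?thesis unfolding eq using T by (intro continuous_intros cgf) auto
qed

lemma continuous_G: "continuous_on UNIV (G_HB :: 'a \<times> 'a \<times> real \<Rightarrow> _)"
proof -
  have eq: "G_HB = (\<lambda>z :: 'a \<times> 'a \<times> real. (fst z, 0, 0))" by (auto simp: G_HB_def)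
  show ?thesis unfolding eq by (intro continuous_intros)
qed

text \<open>\<open>F_HB\<close> is affine in the fast variable, so \<open>fhat (Suc i) - f i\<close>
  has the norm of the tracking error. Summed with weights \<open>hs\<close> over a window of length
  \<open>T'\<close>, it contributes at most \<open>T'\<close> times its supremum; hence the
  threshold \<open>\<epsilon> / T'\<close>.\<close>

lemma flow_window:
  defines "f \<equiv> (\<lambda>k. Fflow_HB \<kappa> T g (fst (X k (jbar E k))))"
  defines "fhat \<equiv> (\<lambda>k. (1 / hs k) *\<^sub>R (fst (X k (jbar E (k - 1))) - fst (X (k - 1) (jbar E (k - 1)))))"
  assumes T': "0 < T'" and \<epsilon>: "0 < \<epsilon>"
  shows "\<exists>n0. \<forall>n\<ge>n0. \<forall>k. n + 1 \<le> k \<and> k \<le> m_fun hs (tau_seq hs n + T') \<longrightarrow>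
    norm (\<Sum>i\<in>{n..<k}. hs (Suc i) *\<^sub>R (fhat (Suc i) - f i)) \<le> \<epsilon>"
proof -
  have err: "norm (fhat (Suc i) - f i) = norm (\<xi> (nk i) - g (q (nk i)))" for i
  proof -
    note eqs = flow_eq[OF jbar_in[OF point_above[of i]]]
    have "fhat (Suc i) = F_HB \<kappa> T (fst (X i (jbar E i))) (snd (X i (jbar E i)))"
      unfolding fhat_def using eqs hs_pos[of i] by simp
    then have "fhat (Suc i) - f i = (0, - (\<xi> (nk i) - g (q (nk i))), 0)"
      unfolding f_def Fflow_HB_def F_HB_def \<xi>_def q_def nk(5) by (simp split: prod.split)
    then show ?thesis by (simp add: norm_Pair norm_minus_commute)
  qed
  have "(\<lambda>i. norm (\<xi> (nk i) - g (q (nk i)))) \<longlonglongrightarrow> 0"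
    by (rule tendsto_norm_zero[OF filterlim_compose[OF fast_error nk_top]])
  then have "eventually (\<lambda>i. norm (\<xi> (nk i) - g (q (nk i))) < \<epsilon> / T') sequentially"
    using T' \<epsilon> by (intro order_tendstoD) auto
  then obtain n0 where n0: "\<And>i. i \<ge> n0 \<Longrightarrow> norm (\<xi> (nk i) - g (q (nk i))) < \<epsilon> / T'"
    unfolding eventually_sequentially by blast
  show ?thesis
  proof (intro exI[of _ n0] allI impI)
    fix n k assume n: "n0 \<le> n" and k: "n + 1 \<le> k \<and> k \<le> m_fun hs (tau_seq hs n + T')"
    have "norm (\<Sum>i\<in>{n..<k}. hs (Suc i) *\<^sub>R (fhat (Suc i) - f i)) \<le> (\<Sum>i\<in>{n..<k}. hs (Suc i) * (\<epsilon> / T'))"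
    proof (rule sum_norm_le)
      fix i assume "i \<in> {n..<k}"
      then have "norm (fhat (Suc i) - f i) \<le> \<epsilon> / T'" using n0[of i] n err[of i] by simp
      then have "hs (Suc i) * norm (fhat (Suc i) - f i) \<le> hs (Suc i) * (\<epsilon> / T')"
        using hs_pos[of i] by (intro mult_left_mono) auto
      then show "norm (hs (Suc i) *\<^sub>R (fhat (Suc i) - f i)) \<le> hs (Suc i) * (\<epsilon> / T')"
        using hs_pos[of i] by simp
    qed
    also have "\<dots> = (\<Sum>i\<in>{n..<k}. hs (Suc i)) * (\<epsilon> / T')" by (rule sum_distrib_right[symmetric])
    also have "(\<Sum>i\<in>{n..<k}. hs (Suc i)) = tau_seq hs k - tau_seq hs n"
      using k sum_diff_nat_ivl[of 0 n k "\<lambda>i. hs (Suc i)"] by (simp add: tau_seq_def lessThan_atLeast0)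
    also have "(tau_seq hs k - tau_seq hs n) * (\<epsilon> / T') \<le> T' * (\<epsilon> / T')"
    proof (rule mult_right_mono)
      show "tau_seq hs k - tau_seq hs n \<le> T'"
        using tau_seq_m_fun[OF hs, of n "tau_seq hs n + T'" k] T' k by simp
    qed (use T' \<epsilon> in auto)
    finally show "norm (\<Sum>i\<in>{n..<k}. hs (Suc i) *\<^sub>R (fhat (Suc i) - f i)) \<le> \<epsilon>" using T' by simp
  qed
qed

lemma asymptotic_simulation_path:
  "asymptotic_simulation (C_HB g T) (Fflow_HB \<kappa> T g) (D_HB g T) G_HB E (\<lambda>k j. fst (X k j)) hs"
  unfolding asymptotic_simulation_def Let_def
proof (intro conjI impI)
  show "hs_dom E" "hs_complete E" "admissible hs" by (rule dom complete hs)+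
  have "(\<lambda>(k, j). fst (X k j)) ` E = fst ` (\<lambda>(k, j). X k j) ` E" by (auto simp: image_image case_prod_beta)
  then show "hs_bounded E (\<lambda>k j. fst (X k j))"
    using bdd unfolding hs_bounded_def by (simp add: bounded_fst)
  let ?f = "\<lambda>k. Fflow_HB \<kappa> T g (fst (X k (jbar E k)))"
  show "\<exists>f. bounded (range f) \<and> acc_points (\<lambda>k. (fst (X k (jbar E k)), f k)) \<subseteq> {(x, Fflow_HB \<kappa> T g x) |x. x \<in> C_HB g T} \<and>
      (\<forall>T'>0. \<forall>\<epsilon>>0. \<exists>n0. \<forall>n\<ge>n0. \<forall>k. n + 1 \<le> k \<and> k \<le> m_fun hs (tau_seq hs n + T') \<longrightarrow>
        norm (\<Sum>i = n..<k. hs (Suc i) *\<^sub>R ((1 / hs (Suc i)) *\<^sub>R (fst (X (Suc i) (jbar E (Suc i - 1)))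
          - fst (X (Suc i - 1) (jbar E (Suc i - 1)))) - f i)) \<le> \<epsilon>)"
  \<comment> \<open>The witness is the exact vector field at the simulated state: accumulation
    points lie on its graph by continuity, and only their membership in \<open>C_HB\<close> involves
    the tracking error.\<close>
  proof (intro exI[of _ ?f] conjI)
    obtain R where R: "\<And>n. norm (Z n) \<le> R" using bound by blast
    have "fst (X k (jbar E k)) \<in> cball 0 R" for k
      using norm_fst_le[of "fst (Z (nk k))" "snd (Z (nk k))"] R[of "nk k"] by (simp add: nk(5))
    then have "range ?f \<subseteq> Fflow_HB \<kappa> T g ` cball 0 R" by auto
    moreover have "compact (Fflow_HB \<kappa> T g ` cball 0 R)"
      by (intro compact_continuous_image continuous_on_subset[OF continuous_Fflow]) auto
    ultimately show "bounded (range ?f)" by (meson bounded_subset compact_imp_bounded)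
    show "acc_points (\<lambda>k. (fst (X k (jbar E k)), ?f k)) \<subseteq> {(x, Fflow_HB \<kappa> T g x) |x. x \<in> C_HB g T}"
    proof
      fix z assume "z \<in> acc_points (\<lambda>k. (fst (X k (jbar E k)), ?f k))"
      then obtain r where r: "strict_mono r" "((\<lambda>k. (fst (X k (jbar E k)), ?f k)) \<circ> r) \<longlonglongrightarrow> z"
        unfolding acc_points_def by blast
      have x: "(\<lambda>i. fst (Z (nk (r i)))) \<longlonglongrightarrow> fst z"
        using tendsto_fst[OF r(2)] by (simp add: nk(5) o_def)
      have "(\<lambda>i. Fflow_HB \<kappa> T g (fst (Z (nk (r i))))) \<longlonglongrightarrow> Fflow_HB \<kappa> T g (fst z)"
        by (rule continuous_on_tendsto_compose[OF continuous_Fflow x]) auto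
      moreover have "(\<lambda>i. Fflow_HB \<kappa> T g (fst (Z (nk (r i))))) \<longlonglongrightarrow> snd z"
        using tendsto_snd[OF r(2)] by (simp add: nk(5) o_def)
      ultimately have "snd z = Fflow_HB \<kappa> T g (fst z)" by (rule LIMSEQ_unique[symmetric])
      moreover have "fst z \<in> C_HB g T"
        by (rule limit_C[OF filterlim_compose[OF nk_top filterlim_subseq[OF r(1)]] x]) (rule nk(1))
      ultimately show "z \<in> {(x, Fflow_HB \<kappa> T g x) |x. x \<in> C_HB g T}" by (cases z) auto
    qed
    show "\<forall>T'>0. \<forall>\<epsilon>>0. \<exists>n0. \<forall>n\<ge>n0. \<forall>k. n + 1 \<le> k \<and> k \<le> m_fun hs (tau_seq hs n + T') \<longrightarrow>
        norm (\<Sum>i = n..<k. hs (Suc i) *\<^sub>R ((1 / hs (Suc i)) *\<^sub>R (fst (X (Suc i) (jbar E (Suc i - 1)))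
          - fst (X (Suc i - 1) (jbar E (Suc i - 1)))) - ?f i)) \<le> \<epsilon>"
      by (intro allI impI flow_window)
  qed
  show "acc_points (\<lambda>j. (fst (X (kbar E j) j), fst (X (kbar E j) (Suc j)))) \<subseteq> {(x, G_HB x) |x. x \<in> D_HB g T}"
    if "hs_complete_j E"
  proof
    \<comment> \<open>Completeness in \<open>j\<close> makes every row occupied; on an empty row
      \<open>kbar E j\<close> would be a \<open>LEAST\<close> over the empty set.\<close>
    have "\<exists>k. (k, Suc j) \<in> E" for j
    proof -
      obtain k j' where j': "(k, j') \<in> E" "j < j'"
        using \<open>hs_complete_j E\<close> unfolding hs_complete_j_def by blast
      then show ?thesis by (intro dom_row[OF j'(1)]) simp
    qed
    note in_E = kbar_in[OF this]
    define nj where "nj j = kbar E j + j" for j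
    have nj: "\<not> flow (nj j)" "Z (nj j) = X (kbar E j) j" "Z (Suc (nj j)) = X (kbar E j) (Suc j)" for j
      using pt_eq[OF in_E(1)[of j]] pt_eq[OF in_E(2)[of j]] by (auto simp: nj_def flow_def Z_def)
    have nj_top: "filterlim nj at_top sequentially"
      by (rule filterlim_at_top_mono[OF filterlim_ident]) (simp add: nj_def)
    fix z assume "z \<in> acc_points (\<lambda>j. (fst (X (kbar E j) j), fst (X (kbar E j) (Suc j))))"
    then obtain r where r: "strict_mono r"
      "((\<lambda>j. (fst (X (kbar E j) j), fst (X (kbar E j) (Suc j)))) \<circ> r) \<longlonglongrightarrow> z"
      unfolding acc_points_def by blast
    have x: "(\<lambda>i. fst (Z (nj (r i)))) \<longlonglongrightarrow> fst z"
      using tendsto_fst[OF r(2)] by (simp add: nj o_def)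
    have G: "fst (X (kbar E j) (Suc j)) = G_HB (fst (Z (nj j)))" for j
      using jump_eq[OF in_E(1,2)] by (simp add: nj)
    have "(\<lambda>i. G_HB (fst (Z (nj (r i))))) \<longlonglongrightarrow> G_HB (fst z)"
      by (rule continuous_on_tendsto_compose[OF continuous_G x]) auto
    moreover have "(\<lambda>i. G_HB (fst (Z (nj (r i))))) \<longlonglongrightarrow> snd z"
      using tendsto_snd[OF r(2)] by (simp add: G o_def)
    ultimately have "snd z = G_HB (fst z)" by (rule LIMSEQ_unique[symmetric])
    moreover have "fst z \<in> D_HB g T"
      by (rule limit_D[OF filterlim_compose[OF nj_top filterlim_subseq[OF r(1)]] x]) (rule nj(1))
    ultimately show "z \<in> {(x, G_HB x) |x. x \<in> D_HB g T}" by (cases z) auto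
  qed
qed

lemma omega_limit_path:
  "omega_limit E (\<lambda>k j. fst (X k j)) \<subseteq> {x. \<forall>x'. \<Psi> x \<le> \<Psi> x'} \<times> {0} \<times> {0..2 * T}"
proof
  obtain R where R: "\<And>n. norm (Z n) \<le> R" using bound by blast
  note bounds = component_bounds[OF R]
  interpret restarting_path \<Psi> g L \<kappa> T R qmin q p \<tau> \<xi> flow H
  proof
    show "q (Suc n) = q n + H n *\<^sub>R p n \<and> p (Suc n) = p n + H n *\<^sub>R (- (\<kappa> *\<^sub>R p n) - \<xi> n)
        \<and> \<tau> (Suc n) = \<tau> n + H n * min 1 (2 - \<tau> n / T)" if "flow n" for n
      using flow_Z[OF that] by blast
    show "q (Suc n) = q n \<and> p (Suc n) = 0 \<and> \<tau> (Suc n) = 0 \<and> 0 \<le> inner (\<xi> n) (p n) \<and> T \<le> \<tau> n"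
      if "\<not> flow n" for n
      using jump_Z[OF that] by blast
    show "0 \<le> H n" for n using hs_pos by (simp add: H_def less_imp_le)
    show "H n = 0" if "\<not> flow n" for n using that by (simp add: H_def)
    show "H \<longlonglongrightarrow> 0" unfolding H_def[abs_def] using hs by (intro flow_tendsto_zero) (simp add: admissible_def)
    show "filterlim (\<lambda>n. \<Sum>i<n. H i) at_top sequentially" unfolding H_def using hs by (rule sum_flow_top)
  qed (use grad lip L minimal crit \<kappa> T bounds fast_error in auto)
  fix z assume "z \<in> omega_limit E (\<lambda>k j. fst (X k j))"
  then obtain s where s: "\<And>i. s i \<in> E" "filterlim (\<lambda>i. fst (s i) + snd (s i)) at_top sequentially"
    "(\<lambda>i. fst (X (fst (s i)) (snd (s i)))) \<longlonglongrightarrow> z"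
    unfolding omega_limit_def by blast
  \<comment> \<open>Points of the domain that go to infinity are points of the traversal with
    indices that go to infinity, so limits along the traversal carry over.\<close>
  define m where "m i = fst (s i) + snd (s i)" for i
  have m: "filterlim m at_top sequentially" using s(2) by (simp add: m_def[abs_def])
  have "Z (m i) = X (fst (s i)) (snd (s i))" for i
    using pt_eq[of "fst (s i)" "snd (s i)"] s(1)[of i] by (simp add: Z_def m_def)
  then have lim: "(\<lambda>i. fst (Z (m i))) \<longlonglongrightarrow> z" using s(3) by simp
  have q_lim: "(\<lambda>i. q (m i)) \<longlonglongrightarrow> fst z" unfolding q_def using lim by (rule tendsto_fst)
  have p_lim: "(\<lambda>i. p (m i)) \<longlonglongrightarrow> fst (snd z)"
    unfolding p_def using lim by (intro tendsto_fst tendsto_snd)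
  have \<tau>_lim: "(\<lambda>i. \<tau> (m i)) \<longlonglongrightarrow> snd (snd z)" unfolding \<tau>_def using lim by (intro tendsto_snd)
  have "isCont \<Psi> (fst z)" using grad[of "fst z"] unfolding gderiv_def by (rule has_derivative_continuous)
  then have "(\<lambda>i. \<Psi> (q (m i))) \<longlonglongrightarrow> \<Psi> (fst z)" using q_lim by (rule isCont_tendsto_compose)
  moreover have "(\<lambda>i. \<Psi> (q (m i))) \<longlonglongrightarrow> \<Psi> qmin" by (rule filterlim_compose[OF potential_tendsto m])
  ultimately have "\<Psi> (fst z) = \<Psi> qmin" by (rule LIMSEQ_unique)
  then have 1: "fst z \<in> {x. \<forall>x'. \<Psi> x \<le> \<Psi> x'}" using minimal by simp
  have 2: "fst (snd z) = 0" using p_lim filterlim_compose[OF momentum_tendsto m] by (rule LIMSEQ_unique)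
  have "(\<lambda>i. max (\<tau> (m i) - 2 * T) 0) \<longlonglongrightarrow> max (snd (snd z) - 2 * T) 0"
    by (intro tendsto_max tendsto_diff \<tau>_lim tendsto_const)
  then have "max (snd (snd z) - 2 * T) 0 = 0"
    using filterlim_compose[OF timer_upper m] by (rule LIMSEQ_unique)
  moreover have "(\<lambda>i. max (- \<tau> (m i)) 0) \<longlonglongrightarrow> max (- snd (snd z)) 0"
    by (intro tendsto_max tendsto_minus \<tau>_lim tendsto_const)
  then have "max (- snd (snd z)) 0 = 0"
    using filterlim_compose[OF timer_lower m] by (rule LIMSEQ_unique)
  ultimately have "snd (snd z) \<in> {0..2 * T}" by (simp add: max_def split: if_splits)
  with 1 2 show "z \<in> {x. \<forall>x'. \<Psi> x \<le> \<Psi> x'} \<times> {0} \<times> {0..2 * T}"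
    by (cases z) (auto simp: mem_Times_iff)
qed

end

section \<open>Almost sure tracking\<close>

lemma (in prob_space) filtered_vector_noise_tendsto_zero:
  fixes g :: "nat \<Rightarrow> nat \<Rightarrow> 'a \<Rightarrow> 'b::euclidean_space" and a :: "nat \<Rightarrow> 'a \<Rightarrow> 'b" and h :: "nat \<Rightarrow> real"
  assumes y_rv: "\<And>k. k \<ge> 1 \<Longrightarrow> y k \<in> measurable M (count_space UNIV)"
    and y_unif: "\<And>k. k \<ge> 1 \<Longrightarrow> distr M (count_space UNIV) (y k) = measure_pmf (pmf_of_set {1..N})"
    and y_indep: "indep_vars (\<lambda>_. count_space UNIV) y {1..}"
    and N: "N \<ge> 1"
    and g: "\<And>k i. g k i \<in> borel_measurable (filt M y k)" and g_bound: "\<And>k i \<omega>. norm (g k i \<omega>) \<le> B"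
    and g_mean: "\<And>k \<omega>. (\<Sum>i\<in>{1..N}. g k i \<omega>) = 0"
    and h: "\<And>k. 0 \<le> h k" "\<And>k. h k \<le> 1" and h_lim: "h \<longlonglongrightarrow> 0"
    and h_top: "filterlim (\<lambda>n. \<Sum>k<n. h k) at_top sequentially"
    and m: "1 \<le> m" and h_sum: "summable (\<lambda>k. h k ^ (m + 1))"
    and a_0: "\<And>\<omega>. a 0 \<omega> = 0"
    and a_Suc: "\<And>k \<omega>. a (Suc k) \<omega> = (1 - h k) *\<^sub>R a k \<omega> + h k *\<^sub>R g k (y (Suc k) \<omega>) \<omega>"
  shows "AE \<omega> in M. (\<lambda>k. a k \<omega>) \<longlonglongrightarrow> 0"
proof -
  have "AE \<omega> in M. (\<lambda>k. inner (a k \<omega>) b) \<longlonglongrightarrow> 0" if b: "b \<in> Basis" for b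
  proof (rule filtered_noise_tendsto_zero[where g = "\<lambda>k i \<omega>. inner (g k i \<omega>) b" and h = h and B = B,
        OF y_rv y_unif y_indep N])
    show "(\<lambda>\<omega>. inner (g k i \<omega>) b) \<in> borel_measurable (filt M y k)" for k i
      using g by measurable
    show "\<bar>inner (g k i \<omega>) b\<bar> \<le> B" for k i \<omega>
      using Basis_le_norm[OF b, of "g k i \<omega>"] g_bound[of k i \<omega>] by linarith
    show "(\<Sum>i\<in>{1..N}. inner (g k i \<omega>) b) = 0" for k \<omega>
      using g_mean[of k \<omega>] by (simp add: inner_sum_left[symmetric])
  qed (use h h_lim h_top m h_sum in \<open>auto simp: a_0 a_Suc inner_add_left\<close>)
  then have "AE \<omega> in M. \<forall>b\<in>Basis. (\<lambda>k. inner (a k \<omega>) b) \<longlonglongrightarrow> 0"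
    by (intro AE_finite_allI) auto
  then show ?thesis
  proof eventually_elim
    case (elim \<omega>)
    then show ?case by (subst tendsto_componentwise_iff) simp
  qed
qed

text \<open>Uniqueness of the derivative of \<open>real N * \<Psi> x\<close>. The identity makes the
  uniformly sampled noise centred.\<close>

lemma gradient_sum:
  fixes \<Psi>\<^sub>i :: "nat \<Rightarrow> 'a::euclidean_space \<Rightarrow> real"
  assumes grad: "GDERIV \<Psi> x :> g"
    and sum: "\<And>x. \<Psi> x = (\<Sum>i\<in>{1..N}. \<Psi>\<^sub>i i x) / real N" and N: "N \<ge> 1"
    and grad_i: "\<And>i. i \<in> {1..N} \<Longrightarrow> GDERIV (\<Psi>\<^sub>i i) x :> g\<^sub>i i"
  shows "(\<Sum>i\<in>{1..N}. g\<^sub>i i) = real N *\<^sub>R g"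
proof -
  have "((\<lambda>x. \<Sum>i\<in>{1..N}. \<Psi>\<^sub>i i x) has_derivative (\<lambda>h. \<Sum>i\<in>{1..N}. inner h (g\<^sub>i i))) (at x)"
    using grad_i unfolding gderiv_def by (intro has_derivative_sum)
  then have "((\<lambda>x. real N * \<Psi> x) has_derivative (\<lambda>h. inner h (\<Sum>i\<in>{1..N}. g\<^sub>i i))) (at x)"
    using N by (simp add: sum inner_sum_right)
  moreover have "((\<lambda>x. real N * \<Psi> x) has_derivative (\<lambda>h. real N * inner h g)) (at x)"
    using grad unfolding gderiv_def by (intro has_derivative_mult_right)
  ultimately have "(\<lambda>h. inner h (\<Sum>i\<in>{1..N}. g\<^sub>i i)) = (\<lambda>h. real N * inner h g)"
    by (rule has_derivative_unique)
  then have "inner h (\<Sum>i\<in>{1..N}. g\<^sub>i i) = inner h (real N *\<^sub>R g)" for h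
    by (simp add: fun_eq_iff)
  then show ?thesis by (metis vector_eq_rdot inner_commute)
qed

text \<open>The moment estimate requires step sizes of at most \<open>1\<close>. As \<open>h\<close>
  tends to zero, truncation alters finitely many terms, so the partial sums eventually differ by the
  constant \<open>c\<close>.\<close>

lemma truncated_steps:
  assumes "admissible h"
  shows "(\<lambda>k. min 1 (h (Suc k))) \<longlonglongrightarrow> 0"
    and "filterlim (\<lambda>n. \<Sum>k<n. min 1 (h (Suc k))) at_top sequentially"
proof -
  have h: "\<And>k. 0 < h (Suc k)" "(\<lambda>k. h (Suc k)) \<longlonglongrightarrow> 0"
    "filterlim (\<lambda>n. \<Sum>k<n. h (Suc k)) at_top sequentially"
    using assms LIMSEQ_Suc[of h 0] by (auto simp: admissible_def)
  have "(\<lambda>k. min 1 (h (Suc k))) \<longlonglongrightarrow> min 1 0" by (intro tendsto_min tendsto_const h(2))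
  then show "(\<lambda>k. min 1 (h (Suc k))) \<longlonglongrightarrow> 0" by simp
  have "eventually (\<lambda>k. h (Suc k) < 1) sequentially" using h(2) by (rule order_tendstoD) simp
  then obtain n0 where n0: "\<And>k. k \<ge> n0 \<Longrightarrow> h (Suc k) < 1" unfolding eventually_sequentially by blast
  define c where "c = (\<Sum>k<n0. h (Suc k) - min 1 (h (Suc k)))"
  have "(\<Sum>k<n. h (Suc k) - min 1 (h (Suc k))) = c" if "n0 \<le> n" for n
    unfolding c_def using that n0 by (intro sum.mono_neutral_right) (auto simp: less_imp_le)
  then have eq: "- c + (\<Sum>k<n. h (Suc k)) = (\<Sum>k<n. min 1 (h (Suc k)))" if "n0 \<le> n" for n
    using that by (simp add: sum_subtractf algebra_simps)
  have "filterlim (\<lambda>n. - c + (\<Sum>k<n. h (Suc k))) at_top sequentially"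
    by (rule filterlim_tendsto_add_at_top[OF tendsto_const h(3)])
  then show "filterlim (\<lambda>n. \<Sum>k<n. min 1 (h (Suc k))) at_top sequentially"
    by (rule filterlim_at_top_mono) (use eq in \<open>auto simp: eventually_sequentially intro!: exI[of _ n0]\<close>)
qed

text \<open>The moment argument needs an integer \<open>m\<close>, here \<open>rho\<close> rounded
  up. For a step of at most \<open>1\<close> the larger exponent gives a smaller power; for a larger
  step the truncated power is \<open>1\<close>, which \<open>h (Suc k) powr (1 + rho)\<close>
  dominates.\<close>

lemma truncated_steps_summable:
  fixes h :: "nat \<Rightarrow> real" and rho :: real
  assumes h: "\<And>k. 0 < h (Suc k)" and rho: "1 \<le> rho"
    and sum: "summable (\<lambda>k. h (Suc k) powr (1 + rho))"
  shows "summable (\<lambda>k. min 1 (h (Suc k)) ^ (nat \<lceil>rho\<rceil> + 1))"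
proof (rule summable_comparison_test'[OF sum])
  fix k
  have rho': "1 + rho \<le> real (nat \<lceil>rho\<rceil> + 1)" using rho by simp
  show "norm (min 1 (h (Suc k)) ^ (nat \<lceil>rho\<rceil> + 1)) \<le> h (Suc k) powr (1 + rho)"
  proof (cases "h (Suc k) \<le> 1")
    case True
    have "min 1 (h (Suc k)) ^ (nat \<lceil>rho\<rceil> + 1) = h (Suc k) powr real (nat \<lceil>rho\<rceil> + 1)"
      using True h[of k] by (subst powr_realpow) (auto simp: min_def)
    also have "\<dots> \<le> h (Suc k) powr (1 + rho)"
      using True h[of k] rho' by (intro powr_mono') auto
    finally show ?thesis using h[of k] by simp
  next
    case False
    then show ?thesis using rho by (simp add: ge_one_powr_ge_zero)
  qed
qed

theorem theorem3:
  fixes Psi :: "'a::euclidean_space \<Rightarrow> real" and gPsi :: "'a \<Rightarrow> 'a"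
    and N :: nat and Psi_i :: "nat \<Rightarrow> 'a \<Rightarrow> real" and gPsi_i :: "nat \<Rightarrow> 'a \<Rightarrow> 'a"
    and \<kappa> T rho :: real and hs hf :: "nat \<Rightarrow> real"
    and M :: "'w measure" and y :: "nat \<Rightarrow> 'w \<Rightarrow> nat"
    and hdom :: "'w \<Rightarrow> (nat \<times> nat) set"
    and X :: "'w \<Rightarrow> nat \<Rightarrow> nat \<Rightarrow> ('a \<times> 'a \<times> real) \<times> 'a"
    and \<Omega>hat :: "'w set"
  assumes grad: "\<And>x. GDERIV Psi x :> gPsi x"
    and grad_cont: "continuous_on UNIV gPsi"
    and sublevel: "\<And>c. compact {q. Psi q \<le> c}"
    and grad_lip: "\<exists>L. lipschitz_on L UNIV gPsi"
    and crit: "{q. \<forall>x. Psi q \<le> Psi x} = {q. gPsi q = 0}"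
    and N_pos: "N \<ge> 1"
    and Psi_sum: "\<And>x. Psi x = (\<Sum>i\<in>{1..N}. Psi_i i x) / real N"
    and grad_i: "\<And>i x. i \<in> {1..N} \<Longrightarrow> GDERIV (Psi_i i) x :> gPsi_i i x"
    and grad_i_cont: "\<And>i. i \<in> {1..N} \<Longrightarrow> continuous_on UNIV (gPsi_i i)"
    and kappa_pos: "\<kappa> > 0" and T_pos: "T > 0"
    and two_ts: "two_timescale_admissible hs hf"
    and rho_ge: "rho \<ge> 1"
    and hf_sum: "summable (\<lambda>k. hf (Suc k) powr (1 + rho))"
    and prob: "prob_space M"
    and y_rv: "\<And>k. k \<ge> 1 \<Longrightarrow> y k \<in> measurable M (count_space UNIV)"
    and y_unif: "\<And>k. k \<ge> 1 \<Longrightarrow> distr M (count_space UNIV) (y k) = measure_pmf (pmf_of_set {1..N})"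
    and y_indep: "prob_space.indep_vars M (\<lambda>_. count_space UNIV) y {1..}"
    and sol: "solution_S M y gPsi_i \<kappa> T hs hf hdom X"
    and Omega_hat: "\<Omega>hat \<subseteq> space M"
    and bdd: "AE \<omega> in M. \<omega> \<in> \<Omega>hat \<longrightarrow> hs_bounded (hdom \<omega>) (X \<omega>) \<and> hs_complete (hdom \<omega>)"
  shows "AE \<omega> in M. \<omega> \<in> \<Omega>hat \<longrightarrow>
           asymptotic_simulation (C_HB gPsi T) (Fflow_HB \<kappa> T gPsi) (D_HB gPsi T) G_HB
              (hdom \<omega>) (\<lambda>k j. fst (X \<omega> k j)) hs \<and>
           omega_limit (hdom \<omega>) (\<lambda>k j. fst (X \<omega> k j))
              \<subseteq> {q. \<forall>x. Psi q \<le> Psi x} \<times> {0} \<times> {0..2 * T}"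
proof -
  interpret prob_space M by (rule prob)
  have hf: "admissible hf" using two_ts by (simp add: two_timescale_admissible_def)
  have hf_pos: "0 < hf (Suc k)" for k using hf by (simp add: admissible_def)
  obtain L0 where "lipschitz_on L0 UNIV gPsi" using grad_lip by blast
  then have lip: "lipschitz_on (max 1 L0) UNIV gPsi" by (rule lipschitz_on_le) simp
  have Psi_cont: "continuous_on S Psi" for S
    using grad unfolding gderiv_def
    by (meson continuous_at_imp_continuous_on has_derivative_continuous)
  obtain qmin where qmin: "\<And>x. Psi qmin \<le> Psi x"
  proof -
    \<comment> \<open>A minimiser over the compact sublevel set of \<open>Psi 0\<close>, which
      contains \<open>0\<close>, is a global one.\<close>
    have "\<exists>z\<in>{q. Psi q \<le> Psi 0}. \<forall>x\<in>{q. Psi q \<le> Psi 0}. Psi z \<le> Psi x"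
      by (rule continuous_attains_inf[OF sublevel _ Psi_cont]) auto
    then obtain z where z: "Psi z \<le> Psi 0" "\<And>x. Psi x \<le> Psi 0 \<Longrightarrow> Psi z \<le> Psi x" by blast
    have "Psi z \<le> Psi x" for x using z(1) z(2)[of x] by (cases "Psi x \<le> Psi 0") auto
    then show thesis by (rule that)
  qed
  have crit_min: "Psi x = Psi qmin" if "gPsi x = 0" for x
  proof -
    from that crit have "x \<in> {q. \<forall>x. Psi q \<le> Psi x}" by simp
    then have "Psi x \<le> Psi qmin" by blast
    then show ?thesis using qmin[of x] by simp
  qed

  define h where "h k = min 1 (hf (Suc k))" for k
  \<comment> \<open>Jumps preserve the position, so all points of a slice share it; reading it off the graph slice
    makes it adapted.\<close>
  define Q where "Q k \<omega> = fst (fst (snd (snd (SOME z. z \<in> graph_slice (hdom \<omega>) (X \<omega>) k))))" for k \<omega>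
  have Q_meas: "Q k \<in> borel_measurable (filt M y k)" for k
  proof -
    have slice: "(\<lambda>\<omega>. graph_slice (hdom \<omega>) (X \<omega>) k) \<in> measurable (filt M y k) (count_space UNIV)"
      using sol unfolding solution_S_def by blast
    \<comment> \<open>Every function on a discrete space is measurable, even one that chooses a
      point of the slice.\<close>
    have "(\<lambda>S. fst (fst (snd (snd (SOME z. z \<in> S))))) \<in> borel_measurable
        (count_space (UNIV :: (nat \<times> nat \<times> ('a \<times> 'a \<times> real) \<times> 'a) set set))" by simp
    from measurable_compose[OF slice this] show ?thesis by (simp add: Q_def[abs_def])
  qed

  \<comment> \<open>The bound of \<open>X \<omega>\<close> depends on \<open>\<omega>\<close>, so
    each natural \<open>R\<close> gets its own truncation. The cut depends on
    \<open>Q k \<omega>\<close> alone, not on the next sample, and therefore preserves the zero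
    mean. Outside \<open>{1..N}\<close> the value \<open>0\<close> replaces \<open>gPsi_i\<close>,
    which is unconstrained there.\<close>
  define noise where "noise R k i \<omega> = (if i \<in> {1..N} \<and> norm (Q k \<omega>) \<le> real R
      then gPsi_i i (Q k \<omega>) - gPsi (Q k \<omega>) else 0)" for R k i \<omega>
  define a where "a R k \<omega> = rec_nat 0 (\<lambda>k v. (1 - h k) *\<^sub>R v + h k *\<^sub>R noise R k (y (Suc k) \<omega>) \<omega>) k" for R k \<omega>
  have a_Suc: "a R (Suc k) \<omega> = (1 - h k) *\<^sub>R a R k \<omega> + h k *\<^sub>R noise R k (y (Suc k) \<omega>) \<omega>" for R k \<omega>
    by (simp add: a_def)

  have "AE \<omega> in M. (\<lambda>k. a R k \<omega>) \<longlonglongrightarrow> 0" for R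
  proof -
    have "\<exists>B. \<forall>q\<in>cball 0 (real R). norm (gPsi_i i q - gPsi q) \<le> B" if "i \<in> {1..N}" for i
    proof -
      have "compact ((\<lambda>q. gPsi_i i q - gPsi q) ` cball 0 (real R))"
        using grad_i_cont[OF that] grad_cont
        by (intro compact_continuous_image continuous_on_diff) (auto intro: continuous_on_subset)
      from compact_imp_bounded[OF this] show ?thesis unfolding bounded_iff by auto
    qed
    then obtain B where B: "\<And>i q. i \<in> {1..N} \<Longrightarrow> norm q \<le> real R \<Longrightarrow> norm (gPsi_i i q - gPsi q) \<le> B i"
      by (metis mem_cball_0)
    define B' where "B' = (\<Sum>i\<in>{1..N}. \<bar>B i\<bar>)"
    have B'_nonneg: "0 \<le> B'" by (simp add: B'_def sum_nonneg)
    show ?thesis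
    proof (rule filtered_vector_noise_tendsto_zero[where g = "noise R" and B = B' and h = h and m = "nat \<lceil>rho\<rceil>",
          OF y_rv y_unif y_indep N_pos])
      show "noise R k i \<in> borel_measurable (filt M y k)" for k i
      proof (cases "i \<in> {1..N}")
        case True
        have "(\<lambda>q. if norm q \<le> real R then gPsi_i i q - gPsi q else 0) \<in> borel_measurable borel"
          using borel_measurable_continuous_onI[OF grad_i_cont[OF True]]
            borel_measurable_continuous_onI[OF grad_cont] by measurable
        from measurable_compose[OF Q_meas this] True show ?thesis by (simp add: noise_def[abs_def])
      next
        case False
        then have "noise R k i = (\<lambda>_. 0)" by (auto simp: noise_def)
        then show ?thesis by simp
      qed
      show "norm (noise R k i \<omega>) \<le> B'" for k i \<omega>
      proof (cases "i \<in> {1..N} \<and> norm (Q k \<omega>) \<le> real R")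
        case True
        then have "norm (noise R k i \<omega>) \<le> \<bar>B i\<bar>" using B[of i "Q k \<omega>"] by (simp add: noise_def)
        also have "\<dots> \<le> B'" unfolding B'_def using True by (intro member_le_sum) auto
        finally show ?thesis .
      next
        case False
        then show ?thesis using B'_nonneg by (auto simp: noise_def)
      qed
      show "(\<Sum>i\<in>{1..N}. noise R k i \<omega>) = 0" for k \<omega>
      proof (cases "norm (Q k \<omega>) \<le> real R")
        case True
        then have "(\<Sum>i\<in>{1..N}. noise R k i \<omega>) = (\<Sum>i\<in>{1..N}. gPsi_i i (Q k \<omega>) - gPsi (Q k \<omega>))"
          by (intro sum.cong) (auto simp: noise_def)
        also have "\<dots> = 0"
          using gradient_sum[OF grad Psi_sum N_pos grad_i, of "Q k \<omega>"]
          by (simp add: sum_subtractf sum_constant_scaleR)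
        finally show ?thesis .
      qed (simp add: noise_def)
      show "1 \<le> nat \<lceil>rho\<rceil>" using rho_ge by linarith
      show "0 \<le> h k" "h k \<le> 1" for k using hf_pos[of k] by (auto simp: h_def)
      show "h \<longlonglongrightarrow> 0" "filterlim (\<lambda>n. \<Sum>k<n. h k) at_top sequentially"
        using truncated_steps[OF hf] by (simp_all add: h_def[abs_def])
      show "summable (\<lambda>k. h k ^ (nat \<lceil>rho\<rceil> + 1))"
        unfolding h_def using hf_pos rho_ge hf_sum by (rule truncated_steps_summable)
    qed (simp_all add: a_def)
  qed
  \<comment> \<open>There are countably many radii, so one null set serves all of them, and
    \<open>R\<close> may afterwards be chosen depending on the path.\<close>
  then have a_lim: "AE \<omega> in M. \<forall>R. (\<lambda>k. a R k \<omega>) \<longlonglongrightarrow> 0" by (simp add: AE_all_countable)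

  have "AE \<omega> in M. y (Suc k) \<omega> \<in> {1..N}" for k
  proof -
    have Suc_k: "1 \<le> Suc k" by simp
    have "set_pmf (pmf_of_set {1..N}) = {1..N}" using N_pos by (intro set_pmf_of_set) auto
    then have "AE i in distr M (count_space UNIV) (y (Suc k)). i \<in> {1..N}"
      unfolding y_unif[OF Suc_k] AE_measure_pmf_iff by blast
    then show ?thesis using y_rv[OF Suc_k] by (subst (asm) AE_distr_iff) auto
  qed
  then have "AE \<omega> in M. \<forall>k. y (Suc k) \<omega> \<in> {1..N}" by (simp add: AE_all_countable)
  with a_lim bdd AE_space show ?thesis
  proof eventually_elim
    case (elim \<omega>)
    show ?case
    proof
      assume "\<omega> \<in> \<Omega>hat"
      with elim have bounded: "hs_bounded (hdom \<omega>) (X \<omega>)" and complete: "hs_complete (hdom \<omega>)" by auto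
      have sol_\<omega>: "hs_dom (hdom \<omega>)"
        "\<And>k j. (k, j) \<in> hdom \<omega> \<Longrightarrow> (Suc k, j) \<in> hdom \<omega> \<Longrightarrow>
           X \<omega> k j \<in> C_S T \<and>
           fst (X \<omega> (Suc k) j) = fst (X \<omega> k j) + hs (Suc k) *\<^sub>R F_HB \<kappa> T (fst (X \<omega> k j)) (snd (X \<omega> k j)) \<and>
           snd (X \<omega> (Suc k) j) = snd (X \<omega> k j) +
              hf (Suc k) *\<^sub>R (gPsi_i (y (Suc k) \<omega>) (fst (fst (X \<omega> k j))) - snd (X \<omega> k j))"
        "\<And>k j. (k, j) \<in> hdom \<omega> \<Longrightarrow> (k, Suc j) \<in> hdom \<omega> \<Longrightarrow>
           X \<omega> k j \<in> D_S T \<and>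
           fst (X \<omega> k (Suc j)) = G_HB (fst (X \<omega> k j)) \<and>
           snd (X \<omega> k (Suc j)) = snd (X \<omega> k j)"
        using sol \<open>\<omega> \<in> space M\<close> unfolding solution_S_def by blast+
      interpret complete_hs_dom "hdom \<omega>" by (rule complete_hs_dom.intro[OF sol_\<omega>(1) complete])
      have Q_eq: "Q k \<omega> = fst (fst (X \<omega> k j))" if "(k, j) \<in> hdom \<omega>" for k j
      proof -
        have "\<exists>z. z \<in> graph_slice (hdom \<omega>) (X \<omega>) k" using that by (auto simp: graph_slice_def)
        then have "(SOME z. z \<in> graph_slice (hdom \<omega>) (X \<omega>) k) \<in> graph_slice (hdom \<omega>) (X \<omega>) k"
          by (rule someI_ex)
        then obtain j' where j': "(SOME z. z \<in> graph_slice (hdom \<omega>) (X \<omega>) k) = (k, j', X \<omega> k j')"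
          "(k, j') \<in> hdom \<omega>" by (auto simp: graph_slice_def)
        have "fst (fst (X \<omega> k j')) = fst (fst (X \<omega> k j))"
        proof (rule jump_invariant_eq[where f = "\<lambda>k j. fst (fst (X \<omega> k j))", OF _ j'(2) that])
          fix k j assume "(k, j) \<in> hdom \<omega>" "(k, Suc j) \<in> hdom \<omega>"
          then show "fst (fst (X \<omega> k (Suc j))) = fst (fst (X \<omega> k j))"
            using sol_\<omega>(3)[of k j] by (simp add: G_HB_def split: prod.splits)
        qed
        then show ?thesis by (simp add: Q_def j'(1))
      qed
      obtain R0 where R0: "\<And>k j. (k, j) \<in> hdom \<omega> \<Longrightarrow> norm (X \<omega> k j) \<le> R0"
        using bounded unfolding hs_bounded_def bounded_iff by force
      \<comment> \<open>With this radius the truncation never acts along the path, so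
        \<open>noise R\<close> is the true sampling noise.\<close>
      obtain R :: nat where R: "R0 \<le> real R" using real_arch_simple by blast
      have Q_bound: "norm (fst (fst (X \<omega> k j))) \<le> real R" if "(k, j) \<in> hdom \<omega>" for k j
        using R0[OF that] R norm_fst_le[of "fst (X \<omega> k j)" "snd (X \<omega> k j)"]
          norm_fst_le[of "fst (fst (X \<omega> k j))" "snd (fst (X \<omega> k j))"] by simp
      interpret sim_path "hdom \<omega>" Psi gPsi "max 1 L0" \<kappa> T qmin "X \<omega>" hs hf
        "\<lambda>k. noise R k (y (Suc k) \<omega>) \<omega>" "\<lambda>k. a R k \<omega>"
      proof
        fix k j assume kj: "(k, j) \<in> hdom \<omega>" "(Suc k, j) \<in> hdom \<omega>"
        have "gPsi (fst (fst (X \<omega> k j))) + noise R k (y (Suc k) \<omega>) \<omega> = gPsi_i (y (Suc k) \<omega>) (fst (fst (X \<omega> k j)))"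
          using elim Q_eq[OF kj(1)] Q_bound[OF kj(1)] by (simp add: noise_def)
        with sol_\<omega>(2)[OF kj] show "X \<omega> k j \<in> C_S T
            \<and> fst (X \<omega> (Suc k) j) = fst (X \<omega> k j) + hs (Suc k) *\<^sub>R F_HB \<kappa> T (fst (X \<omega> k j)) (snd (X \<omega> k j))
            \<and> snd (X \<omega> (Suc k) j) = snd (X \<omega> k j) + hf (Suc k) *\<^sub>R
                (gPsi (fst (fst (X \<omega> k j))) + noise R k (y (Suc k) \<omega>) \<omega> - snd (X \<omega> k j))"
          by simp
      next
        fix k
        show "a R (Suc k) \<omega> = (1 - min 1 (hf (Suc k))) *\<^sub>R a R k \<omega>
            + min 1 (hf (Suc k)) *\<^sub>R noise R k (y (Suc k) \<omega>) \<omega>"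
          unfolding a_Suc by (simp add: h_def)
      next
        show "(\<lambda>k. a R k \<omega>) \<longlonglongrightarrow> 0" using elim by blast
      next
        fix x assume "gPsi x = 0"
        then show "Psi x = Psi qmin" by (rule crit_min)
      next
        fix k j assume "(k, j) \<in> hdom \<omega>" "(k, Suc j) \<in> hdom \<omega>"
        then show "X \<omega> k j \<in> D_S T \<and> fst (X \<omega> k (Suc j)) = G_HB (fst (X \<omega> k j))
            \<and> snd (X \<omega> k (Suc j)) = snd (X \<omega> k j)" by (rule sol_\<omega>(3))
      qed (rule grad lip qmin kappa_pos T_pos two_ts bounded max.cobounded1)+
      show "asymptotic_simulation (C_HB gPsi T) (Fflow_HB \<kappa> T gPsi) (D_HB gPsi T) G_HB
              (hdom \<omega>) (\<lambda>k j. fst (X \<omega> k j)) hs \<and>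
           omega_limit (hdom \<omega>) (\<lambda>k j. fst (X \<omega> k j))
              \<subseteq> {q. \<forall>x. Psi q \<le> Psi x} \<times> {0} \<times> {0..2 * T}"
        using asymptotic_simulation_path omega_limit_path by blast
    qed
  qed
qed

end
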